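(* Let $p\in(0,1)$. Let $(\Delta_0,\Delta_1,\Delta_2)$ be a random variable with $\mathrm{Dirichlet}(\tfrac12,\tfrac12,\tfrac12)$ distribution. Let $\mu_0,\mu_1,\mu_2$ be independent and distributed like $\mu^p$, and, conditionally on $\mu_0$, let $(X_0,Y_0)$ be a random point of distribution $\mu_0$. Let $\beta$ be an independent Bernoulli random variable of parameter $p$. (Here $(\Delta_0,\Delta_1,\Delta_2)$, $(\mu_0,(X_0,Y_0))$, $\mu_1$, $\mu_2$ and $\beta$ are independent.) Define the piecewise affine maps of the unit square into itself $$\begin{aligned} \theta_0(x,y)&=(\eta_0(x),\zeta_0(y))=\Delta_0(x,y)+(1-\Delta_0)(\mathbf 1_{[x>X_0]},\mathbf 1_{[y>Y_0]}),\\ \theta_1(x,y)&=(\eta_1(x),\zeta_1(y))=\Delta_1(x,y)+\Delta_0(X_0,Y_0)+\Delta_2(0,\beta),\\ \theta_2(x,y)&=(\eta_2(x),\zeta_2(y))=\Delta_2(x,y)+\Delta_0(X_0,Y_0)+\Delta_1(1,1-\beta). \end{aligned}$$ Then $$\Delta_0\,(\theta_0)_*\mu_0+\Delta_1\,(\theta_1)_*\mu_1+\Delta_2\,(\theta_2)_*\mu_2\stackrel d=\mu^p,$$ where $(\theta_k)_*\mu_k$ denotes the pushforward of $\mu_k$ by $\theta_k$.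
   Context: A permuton is a probability measure on $[0,1]^2$ with both marginals uniform on $[0,1]$. For distinct reals $x_1,\dots,x_k$, $\mathrm{rank}(x_1,\dots,x_k)$ is the permutation $\alpha$ of $\{1,\dots,k\}$ with $\alpha(i)<\alpha(j)\iff x_i<x_j$. For a random permuton $\mu$, $\mathrm{subperm}_k(\mu)=\mathrm{rank}(Y_1,\dots,Y_k)\circ \mathrm{rank}(X_1,\dots,X_k)^{-1}$, where conditionally on $\mu$ the $(X_i,Y_i)$, $1\le i\le k$, are independent with law $\mu$. The law of a random permuton is determined by the laws of $\mathrm{subperm}_k(\mu)$, $k\ge1$. For a rooted plane tree $t$ with leaves labeled $1,\dots,k$ in left-to-right order and internal nodes decorated with signs in $\{\oplus,\ominus\}$, let $\tilde t$ be obtained by reversing the order of the children of every node with sign $\ominus$; $\mathrm{perm}(t)$ is the permutation $\sigma$ with $\sigma(i)$ the position in $\tilde t$ of leaf $i$. The biased Brownian separable permuton $\mu^p$ is the random permuton whose law is determined by $\mathrm{subperm}_k(\mu^p)\stackrel d=\mathrm{perm}(t_{k,p})$ for all $k\ge1$, where $t_{k,p}$ is a uniform rooted plane binary tree with $k$ leaves whose internal nodes carry i.i.d. signs, $\oplus$ with probability $p$ and $\ominus$ with probability $1-p$.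
   Formalization: The Bernoulli variable β has parameter 1−p instead of p: with the stated maps β=1 places block 1 above block 2 (a ⊖ configuration), so the claim with parameter p fails for every p≠1/2, already for the law of subperm_2. *)

theory Defs
  imports "HOL-Probability.Probability" "HOL-Combinatorics.Permutations"
begin

section \<open>Permutons and the permutations sampled from them\<close>

text \<open>
  Permutons are measures on the whole plane; the marginal conditions force them to be
  carried by the unit square.
\<close>
definition permuton :: "(real \<times> real) measure \<Rightarrow> bool" where
  "permuton \<mu> \<longleftrightarrow> prob_space \<mu> \<and> sets \<mu> = sets borel \<and>
     distr \<mu> borel fst = uniform_measure lborel {0..1} \<and>
     distr \<mu> borel snd = uniform_measure lborel {0..1}"

text \<open>
  The law of a random permuton, as a probability measure on the space of probability measures
  on the plane. The sigma-algebra of \<^const>\<open>prob_algebra\<close>, generated by the evaluations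
  on Borel sets, is the Borel sigma-algebra of the weak topology.
\<close>
definition random_permuton_law :: "(real \<times> real) measure measure \<Rightarrow> bool" where
  "random_permuton_law P \<longleftrightarrow>
     prob_space P \<and> sets P = sets (prob_algebra borel) \<and> (AE \<mu> in P. permuton \<mu>)"

text \<open>
  Permutations of \<open>{1..k}\<close> are functions on \<^typ>\<open>nat\<close> that fix all other numbers.
  The rank is only meaningful for distinct values.
\<close>
definition rank_perm :: "nat \<Rightarrow> (nat \<Rightarrow> real) \<Rightarrow> nat \<Rightarrow> nat" where
  "rank_perm k x = (THE \<alpha>. \<alpha> permutes {1..k} \<and>
     (\<forall>i\<in>{1..k}. \<forall>j\<in>{1..k}. \<alpha> i < \<alpha> j \<longleftrightarrow> x i < x j))"

definition points_perm :: "nat \<Rightarrow> (nat \<Rightarrow> real \<times> real) \<Rightarrow> nat \<Rightarrow> nat" where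
  "points_perm k z = rank_perm k (\<lambda>i. snd (z i)) \<circ> inv (rank_perm k (\<lambda>i. fst (z i)))"

text \<open>
  Law of the permutation sampled from a random permuton with law \<open>P\<close>: draw \<open>\<mu>\<close> from \<open>P\<close>,
  then \<open>k\<close> independent points from \<open>\<mu>\<close>.
\<close>
definition subperm_law :: "nat \<Rightarrow> (real \<times> real) measure measure \<Rightarrow> (nat \<Rightarrow> nat) measure" where
  "subperm_law k P =
     distr (P \<bind> (\<lambda>\<mu>. PiM {1..k} (\<lambda>_. \<mu>))) (count_space UNIV) (points_perm k)"


section \<open>Signed plane binary trees\<close>

datatype ('s, 'l) btree = Leaf 'l | Node 's "('s, 'l) btree" "('s, 'l) btree"

fun leaves :: "('s, 'l) btree \<Rightarrow> 'l list" where
  "leaves (Leaf a) = [a]"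
| "leaves (Node s l r) = leaves l @ leaves r"

text \<open>The sign \<^const>\<open>True\<close> stands for \<open>\<oplus>\<close>, and \<^const>\<open>False\<close> for \<open>\<ominus>\<close>.\<close>
fun twist :: "(bool, 'l) btree \<Rightarrow> (bool, 'l) btree" where
  "twist (Leaf a) = Leaf a"
| "twist (Node s l r) =
     (if s then Node s (twist l) (twist r) else Node s (twist r) (twist l))"

definition tree_perm :: "(bool, nat) btree \<Rightarrow> nat \<Rightarrow> nat" where
  "tree_perm t i =
     (if i \<in> set (leaves t) then Suc (length (takeWhile (\<lambda>j. j \<noteq> i) (leaves (twist t)))) else i)"

fun random_signs :: "real \<Rightarrow> (unit, 'l) btree \<Rightarrow> (bool, 'l) btree pmf" where
  "random_signs p (Leaf a) = return_pmf (Leaf a)"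
| "random_signs p (Node u l r) =
     do {
       s \<leftarrow> bernoulli_pmf p;
       l' \<leftarrow> random_signs p l;
       r' \<leftarrow> random_signs p r;
       return_pmf (Node s l' r')
     }"

definition random_tree :: "nat \<Rightarrow> real \<Rightarrow> (bool, nat) btree pmf" where
  "random_tree k p =
     bind_pmf (pmf_of_set {t :: (unit, nat) btree. leaves t = [1..<Suc k]}) (random_signs p)"


section \<open>The biased Brownian separable permuton\<close>

text \<open>\<open>P\<close> is the law of the biased Brownian separable permuton of parameter \<open>p\<close>.\<close>
definition brownian_separable_law :: "real \<Rightarrow> (real \<times> real) measure measure \<Rightarrow> bool" where
  "brownian_separable_law p P \<longleftrightarrow> random_permuton_law P \<and>
     (\<forall>k\<ge>1. subperm_law k P = measure_pmf (map_pmf tree_perm (random_tree k p)))"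


section \<open>Ingredients of the recursive decomposition\<close>

definition simplex3 :: "(real \<times> real \<times> real) set" where
  "simplex3 = {(a, b, c). 0 \<le> a \<and> 0 \<le> b \<and> 0 \<le> c \<and> a + b + c = 1}"

text \<open>The density is that of the first two coordinates; the third one is determined.\<close>
definition dirichlet3 :: "real \<Rightarrow> real \<Rightarrow> real \<Rightarrow> (real \<times> real \<times> real) measure" where
  "dirichlet3 a b c =
     distr
       (density lborel (\<lambda>(x, y). ennreal
          (if 0 < x \<and> 0 < y \<and> x + y < 1
           then Gamma (a + b + c) / (Gamma a * Gamma b * Gamma c) *
                  (x powr (a - 1) * y powr (b - 1) * (1 - x - y) powr (c - 1))
           else 0)))
       borel (\<lambda>(x, y). (x, y, 1 - x - y))"

text \<open>Conditionally on the random measure \<open>\<mu>\<close>, the random point \<open>Z\<close> has law \<open>\<mu>\<close>.\<close>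
definition random_point_of ::
  "'w measure \<Rightarrow> ('w \<Rightarrow> (real \<times> real) measure) \<Rightarrow> ('w \<Rightarrow> real \<times> real) \<Rightarrow> bool" where
  "random_point_of M \<mu> Z \<longleftrightarrow> Z \<in> borel_measurable M \<and>
     (\<forall>B\<in>sets borel. AE \<omega> in M.
        real_cond_exp M (vimage_algebra (space M) \<mu> (prob_algebra borel))
          (\<lambda>\<omega>. indicator B (Z \<omega>)) \<omega> = measure (\<mu> \<omega>) B)"

definition theta0 :: "real \<Rightarrow> real \<times> real \<Rightarrow> real \<times> real \<Rightarrow> real \<times> real" where
  "theta0 d0 Z z =
     d0 *\<^sub>R z + (1 - d0) *\<^sub>R (of_bool (fst z > fst Z), of_bool (snd z > snd Z))"

text \<open>
  In the next two maps \<open>b = 0\<close> puts the first block below the second one (as a node \<open>\<oplus>\<close> does),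
  and \<open>b = 1\<close> puts it above (as a node \<open>\<ominus>\<close> does).
  Since \<open>\<oplus>\<close> has probability \<open>p\<close>, the event \<open>b = 1\<close> has to carry probability \<open>1 - p\<close>.
\<close>
definition theta1 ::
  "real \<Rightarrow> real \<Rightarrow> real \<Rightarrow> real \<times> real \<Rightarrow> real \<Rightarrow> real \<times> real \<Rightarrow> real \<times> real" where
  "theta1 d0 d1 d2 Z b z = d1 *\<^sub>R z + d0 *\<^sub>R Z + d2 *\<^sub>R (0, b)"

definition theta2 ::
  "real \<Rightarrow> real \<Rightarrow> real \<Rightarrow> real \<times> real \<Rightarrow> real \<Rightarrow> real \<times> real \<Rightarrow> real \<times> real" where
  "theta2 d0 d1 d2 Z b z = d2 *\<^sub>R z + d0 *\<^sub>R Z + d1 *\<^sub>R (1, 1 - b)"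

definition mixture3 ::
  "real \<Rightarrow> (real \<times> real) measure \<Rightarrow> real \<Rightarrow> (real \<times> real) measure \<Rightarrow>
   real \<Rightarrow> (real \<times> real) measure \<Rightarrow> (real \<times> real) measure" where
  "mixture3 a \<mu> b \<nu> c \<rho> = measure_of UNIV (sets borel)
     (\<lambda>A. ennreal a * emeasure \<mu> A + ennreal b * emeasure \<nu> A + ennreal c * emeasure \<rho> A)"

end

theory Submission
  imports Defs
begin

text \<open>
  The law of a random permuton is determined by the laws of the two orders (horizontal and vertical)
  of finitely many points sampled from it, because the empirical ranks of many points approximate the
  distribution function of the permuton. For \<open>\<mu>\<^sup>p\<close> these orders are those of the leaves of a weighted
  labelled tree \<open>t\<close> and of its twisted version.

  Points sampled from the mixture fall into three blocks, and given the block sizes their orders are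
  obtained by splicing the orders of two samples of \<open>\<mu>\<^sub>1\<close> and \<open>\<mu>\<^sub>2\<close>, placed according to \<open>\<beta>\<close>, into
  those of a sample of \<open>\<mu>\<^sub>0\<close> at the place of \<open>(X\<^sub>0, Y\<^sub>0)\<close>. Correspondingly, a tree with two additional
  leaves \<open>a\<close> and \<open>b\<close> is cut at the node where \<open>a\<close> and \<open>b\<close> separate: the subtrees of this node contain
  the blocks 1 and 2, and the rest of the tree, with a leaf \<open>e\<close> in place of the node, contains block 0.
  Forgetting \<open>a\<close> and \<open>b\<close> does not change the law of the remaining orders. The number of labelled plane
  binary trees with \<open>n + 1\<close> leaves is \<open>4\<^sup>n (1/2)\<^sub>n\<close>, a rising factorial, so the block sizes seen in the tree
  have probabilities proportional to products of three numbers \<open>(1/2)\<^sub>n\<close>, which are the moments of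
  the Dirichlet law with parameters \<open>1/2\<close>.
\<close>

section \<open>Labelled signed trees\<close>

text \<open>A permutation forgets which sampled point is which, whereas belonging to a block is a
  property of the individual point. Hence everything is phrased with orders on a set of labels, and
  only \<open>brownian_separable_orders\<close> goes back to permutations. The point
  \<open>Z\<close> counts as one more sampled point of \<open>\<mu>0\<close>, labelled
  \<open>e\<close>, so the piece of block 0 has an additional leaf too. For \<open>n\<close> sampled
  points in blocks of sizes \<open>n0 + n1 + n2 = n\<close>, the three pieces have
  \<open>n0 + 1\<close>, \<open>n1 + 1\<close> and \<open>n2 + 1\<close> leaves, the whole tree has
  \<open>n + 2\<close>, and exchanging \<open>a\<close> and \<open>b\<close> doubles the count. A
  partition thus has probability
  \<open>2 * 4^n (1/2)_n0 (1/2)_n1 (1/2)_n2 / (4^(n+1) (1/2)_(n+1))\<close>, and since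
  \<open>(1/2)_(n+1) = (1/2) (3/2)_n\<close> this equals the moment of order
  \<open>(n0, n1, n2)\<close> of the Dirichlet law, with no constant left over. The same cut, with a
  constant functional, also gives the number of trees by induction. Laws of orders are handled as
  integrals of an arbitrary real function \<open>h\<close> of finitely many possible orders, which
  replaces questions of integrability by finite sums.\<close>

definition labelled_trees :: "'l set \<Rightarrow> (bool, 'l) btree set" where
  "labelled_trees J = {t. distinct (leaves t) \<and> set (leaves t) = J}"

text \<open>Only the signs are weighted; the uniform choice of the shape is left to a normalising
  constant. For a fixed shape the weights of all its signings add up to 1.\<close>

fun sign_weight :: "real \<Rightarrow> (bool, 'l) btree \<Rightarrow> real" where
  "sign_weight p (Leaf x) = 1"
| "sign_weight p (Node s l r) = (if s then p else 1 - p) * sign_weight p l * sign_weight p r"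

text \<open>
  The relation \<open>i\<close> is left of \<open>j\<close> after reversing the children of the nodes whose sign \<open>f\<close>
  maps to \<^const>\<open>False\<close>: with \<open>f = (\<lambda>_. True)\<close> this is the order of the leaves of \<open>t\<close>, with
  \<open>f = id\<close> the order of the leaves of \<^term>\<open>twist t\<close>.
\<close>
fun tree_order :: "(bool \<Rightarrow> bool) \<Rightarrow> (bool, 'l) btree \<Rightarrow> ('l \<times> 'l) set" where
  "tree_order f (Leaf x) = {}"
| "tree_order f (Node s l r) = tree_order f l \<union> tree_order f r \<union>
     (if f s then set (leaves l) \<times> set (leaves r) else set (leaves r) \<times> set (leaves l))"

abbreviation tree_orders :: "(bool, 'l) btree \<Rightarrow> ('l \<times> 'l) set \<times> ('l \<times> 'l) set" where
  "tree_orders t \<equiv> (tree_order (\<lambda>_. True) t, tree_order id t)"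

fun graft :: "(bool, 'l) btree \<Rightarrow> 'l \<Rightarrow> (bool, 'l) btree \<Rightarrow> (bool, 'l) btree" where
  "graft (Leaf x) e u = (if x = e then u else Leaf x)"
| "graft (Node s l r) e u = Node s (graft l e u) (graft r e u)"

section \<open>Finiteness, relabelling and leaf orders of labelled trees\<close>

lemma leaves_nonempty: "leaves t \<noteq> []"
  by (induction t) auto

text \<open>A child has fewer leaves than its parent because its sibling has at least one, so
  induction on the bound works. The bound on the length stands in for distinctness, since it lets
  both children keep the same label set \<open>J\<close>.\<close>

lemma finite_bounded_trees:
  assumes "finite J"
  shows "finite {t :: (bool, 'l) btree. set (leaves t) \<subseteq> J \<and> length (leaves t) \<le> n}"
proof (induction n)
  case 0
  then show ?case by (simp add: leaves_nonempty)
next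
  case (Suc n)
  let ?S = "{t :: (bool, 'l) btree. set (leaves t) \<subseteq> J \<and> length (leaves t) \<le> n}"
  have "{t :: (bool, 'l) btree. set (leaves t) \<subseteq> J \<and> length (leaves t) \<le> Suc n} \<subseteq>
    Leaf ` J \<union> (\<lambda>(s, l, r). Node s l r) ` (UNIV \<times> ?S \<times> ?S)" (is "_ \<subseteq> ?R")
  proof
    fix t :: "(bool, 'l) btree"
    assume t: "t \<in> {t. set (leaves t) \<subseteq> J \<and> length (leaves t) \<le> Suc n}"
    show "t \<in> ?R"
    proof (cases t)
      case (Leaf x)
      then show ?thesis using t by auto
    next
      case (Node s l r)
      have "length (leaves l) \<noteq> 0" "length (leaves r) \<noteq> 0"
        by (simp_all add: leaves_nonempty)
      moreover have "length (leaves l) + length (leaves r) \<le> Suc n" using t Node by simp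
      ultimately have "length (leaves l) \<le> n" "length (leaves r) \<le> n" by linarith+
      then have "(s, l, r) \<in> UNIV \<times> ?S \<times> ?S" using t Node by auto
      then show ?thesis using Node by (auto intro!: image_eqI[of _ _ "(s, l, r)"])
    qed
  qed
  moreover have "finite ?R"
    using Suc assms by auto
  ultimately show ?case by (rule finite_subset)
qed

lemma finite_labelled_trees:
  assumes "finite J"
  shows "finite (labelled_trees J)"
proof (rule finite_subset)
  show "labelled_trees J \<subseteq> {t. set (leaves t) \<subseteq> J \<and> length (leaves t) \<le> card J}"
    by (auto simp: labelled_trees_def distinct_card[symmetric])
qed (rule finite_bounded_trees[OF assms])

lemma labelled_trees_singleton: "labelled_trees {x} = {Leaf x}"
proof -
  have "t = Leaf x" if t: "distinct (leaves t)" "set (leaves t) = {x}" for t :: "(bool, 'a) btree"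
  proof (cases t)
    case (Leaf y)
    then show ?thesis using t by auto
  next
    case (Node s l r)
    have "set (leaves l) \<noteq> {}" "set (leaves r) \<noteq> {}"
      by (simp_all add: leaves_nonempty)
    moreover have "set (leaves l) \<subseteq> {x}" "set (leaves r) \<subseteq> {x}" using t Node by auto
    ultimately have "set (leaves l) = {x}" "set (leaves r) = {x}" by (metis subset_singletonD)+
    then show ?thesis using t Node by auto
  qed
  then show ?thesis by (auto simp: labelled_trees_def)
qed

lemma tree_order_subset: "tree_order f t \<subseteq> set (leaves t) \<times> set (leaves t)"
  by (induction t) (auto split: if_splits)

lemma leaves_map: "leaves (map_btree g h t) = map h (leaves t)"
  by (induction t) auto

lemma sign_weight_map: "sign_weight p (map_btree id h t) = sign_weight p t"
  by (induction t) auto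

lemma tree_order_map: "tree_order f (map_btree id h t) = map_prod h h ` tree_order f t"
  by (induction t) (auto simp: leaves_map image_Un map_prod_surj_on)

lemma tree_order_total:
  assumes "i \<in> set (leaves t)" "j \<in> set (leaves t)" "i \<noteq> j"
  shows "(i, j) \<in> tree_order f t \<or> (j, i) \<in> tree_order f t"
  using assms by (induction t) auto

lemma tree_order_asym:
  assumes "distinct (leaves t)" "(i, j) \<in> tree_order f t"
  shows "(j, i) \<notin> tree_order f t"
  using assms
proof (induction t)
  case (Leaf x)
  then show ?case by simp
next
  case (Node s l r)
  have "tree_order f l \<subseteq> set (leaves l) \<times> set (leaves l)"
    "tree_order f r \<subseteq> set (leaves r) \<times> set (leaves r)"
    by (rule tree_order_subset)+
  then show ?case using Node by (auto split: if_splits)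
qed

section \<open>Grafting a tree at a leaf\<close>

lemma graft_absent: "e \<notin> set (leaves t) \<Longrightarrow> graft t e u = t"
  by (induction t) auto

lemma set_leaves_graft:
  "e \<in> set (leaves t) \<Longrightarrow> set (leaves (graft t e u)) = (set (leaves t) - {e}) \<union> set (leaves u)"
proof (induction t)
  case (Node s l r)
  show ?case
  proof (cases "e \<in> set (leaves l)")
    case True
    then show ?thesis using Node by (cases "e \<in> set (leaves r)") (auto simp: graft_absent)
  next
    case False
    then show ?thesis using Node by (auto simp: graft_absent)
  qed
qed auto

lemma distinct_leaves_graft:
  assumes "distinct (leaves t)" "distinct (leaves u)" "set (leaves t) \<inter> set (leaves u) \<subseteq> {e}"
  shows "distinct (leaves (graft t e u))"
  using assms
proof (induction t)
  case (Node s l r)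
  have *: "distinct (leaves (graft l e u))" "distinct (leaves (graft r e u))"
    using Node by auto
  consider "e \<in> set (leaves l)" "e \<notin> set (leaves r)" | "e \<in> set (leaves r)" "e \<notin> set (leaves l)"
    | "e \<notin> set (leaves r)" "e \<notin> set (leaves l)" using Node by auto
  then show ?case
  proof cases
    case 1
    then show ?thesis using * Node.prems by (auto simp: graft_absent set_leaves_graft)
  next
    case 2
    then show ?thesis using * Node.prems by (auto simp: graft_absent set_leaves_graft)
  next
    case 3
    then show ?thesis using * Node.prems by (auto simp: graft_absent)
  qed
qed auto

lemma sign_weight_graft:
  assumes "distinct (leaves t)" "e \<in> set (leaves t)"
  shows "sign_weight p (graft t e u) = sign_weight p t * sign_weight p u"
  using assms
proof (induction t)
  case (Node s l r)
  then consider "e \<in> set (leaves l)" "e \<notin> set (leaves r)" | "e \<in> set (leaves r)" "e \<notin> set (leaves l)"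
    by auto
  then show ?case using Node by cases (auto simp: graft_absent)
qed auto

text \<open>Reversing children acts node by node, so for every \<open>f\<close> the leaves of
  \<open>u\<close> stay together and compare with the other leaves exactly as \<open>e\<close>
  did.\<close>

lemma tree_order_graft:
  assumes "distinct (leaves t)" "e \<in> set (leaves t)" "e \<notin> set (leaves u)"
  shows "tree_order f (graft t e u) =
    {(i, j). i \<noteq> e \<and> j \<noteq> e \<and> (i, j) \<in> tree_order f t} \<union>
    {(i, j). (i, e) \<in> tree_order f t \<and> j \<in> set (leaves u)} \<union>
    {(i, j). i \<in> set (leaves u) \<and> (e, j) \<in> tree_order f t} \<union> tree_order f u"
  using assms
proof (induction t)
  case (Node s l r)
  have L: "tree_order f l \<subseteq> set (leaves l) \<times> set (leaves l)"
    and R: "tree_order f r \<subseteq> set (leaves r) \<times> set (leaves r)"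
    by (rule tree_order_subset)+
  from Node consider "e \<in> set (leaves l)" "e \<notin> set (leaves r)" | "e \<in> set (leaves r)" "e \<notin> set (leaves l)"
    by auto
  then show ?case
  proof cases
    case 1
    then have r: "(e, x) \<notin> tree_order f r" "(x, e) \<notin> tree_order f r" for x using R by auto
    have IH: "tree_order f (graft l e u) =
      {(i, j). i \<noteq> e \<and> j \<noteq> e \<and> (i, j) \<in> tree_order f l} \<union>
      {(i, j). (i, e) \<in> tree_order f l \<and> j \<in> set (leaves u)} \<union>
      {(i, j). i \<in> set (leaves u) \<and> (e, j) \<in> tree_order f l} \<union> tree_order f u"
      using Node.IH(1) Node.prems 1 by simp
    show ?thesis
      unfolding graft.simps tree_order.simps graft_absent[OF 1(2)] set_leaves_graft[OF 1(1)] IH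
      using r 1 by (cases "f s"; simp; blast)
  next
    case 2
    then have l: "(e, x) \<notin> tree_order f l" "(x, e) \<notin> tree_order f l" for x using L by auto
    have IH: "tree_order f (graft r e u) =
      {(i, j). i \<noteq> e \<and> j \<noteq> e \<and> (i, j) \<in> tree_order f r} \<union>
      {(i, j). (i, e) \<in> tree_order f r \<and> j \<in> set (leaves u)} \<union>
      {(i, j). i \<in> set (leaves u) \<and> (e, j) \<in> tree_order f r} \<union> tree_order f u"
      using Node.IH(2) Node.prems 2 by simp
    show ?thesis
      unfolding graft.simps tree_order.simps graft_absent[OF 2(2)] set_leaves_graft[OF 2(1)] IH
      using l 2 by (cases "f s"; simp; blast)
  qed
qed auto

section \<open>Cutting a tree at the node where two leaves separate\<close>

text \<open>Descend from the root. If the root separates \<open>a\<close> and \<open>b\<close>, then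
  \<open>t0\<close> is the single leaf \<open>e\<close>; otherwise both lie in one child, and the
  other child is kept as part of \<open>t0\<close>.\<close>

lemma graft_split_exists:
  assumes "distinct (leaves t)" "(a, b) \<in> tree_order (\<lambda>_. True) t" "e \<notin> set (leaves t)"
  shows "\<exists>t0 s t1 t2. t = graft t0 e (Node s t1 t2) \<and> e \<in> set (leaves t0) \<and>
    a \<in> set (leaves t1) \<and> b \<in> set (leaves t2) \<and> distinct (leaves t0) \<and>
    distinct (leaves t1) \<and> distinct (leaves t2) \<and>
    set (leaves t0) \<inter> (set (leaves t1) \<union> set (leaves t2)) = {} \<and>
    set (leaves t1) \<inter> set (leaves t2) = {}"
  using assms
proof (induction t)
  case (Leaf x)
  then show ?case by simp
next
  case (Node s l r)
  consider (both) "a \<in> set (leaves l)" "b \<in> set (leaves r)"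
    | (left) "(a, b) \<in> tree_order (\<lambda>_. True) l" | (right) "(a, b) \<in> tree_order (\<lambda>_. True) r"
    using Node.prems by auto
  then show ?case
  proof cases
    case both
    then show ?thesis using Node.prems
      by (intro exI[of _ "Leaf e"] exI[of _ s] exI[of _ l] exI[of _ r]) auto
  next
    case left
    have "\<exists>t0 s t1 t2. l = graft t0 e (Node s t1 t2) \<and> e \<in> set (leaves t0) \<and>
      a \<in> set (leaves t1) \<and> b \<in> set (leaves t2) \<and> distinct (leaves t0) \<and>
      distinct (leaves t1) \<and> distinct (leaves t2) \<and>
      set (leaves t0) \<inter> (set (leaves t1) \<union> set (leaves t2)) = {} \<and>
      set (leaves t1) \<inter> set (leaves t2) = {}"
      by (rule Node.IH(1)) (use Node.prems left in simp_all)
    then obtain t0 s' t1 t2 where *: "l = graft t0 e (Node s' t1 t2)" "e \<in> set (leaves t0)"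
      "a \<in> set (leaves t1)" "b \<in> set (leaves t2)" "distinct (leaves t0)"
      "distinct (leaves t1)" "distinct (leaves t2)"
      "set (leaves t0) \<inter> (set (leaves t1) \<union> set (leaves t2)) = {}"
      "set (leaves t1) \<inter> set (leaves t2) = {}"
      by (elim exE conjE)
    have leaves_l: "set (leaves l) = set (leaves t0) - {e} \<union> (set (leaves t1) \<union> set (leaves t2))"
      using *(1,2) by (simp add: set_leaves_graft)
    have disj: "set (leaves l) \<inter> set (leaves r) = {}" "distinct (leaves r)" "e \<notin> set (leaves r)"
      using Node.prems by simp_all
    have "Node s l r = graft (Node s t0 r) e (Node s' t1 t2)"
      using *(1) disj by (simp add: graft_absent)
    moreover have "e \<in> set (leaves (Node s t0 r))" "distinct (leaves (Node s t0 r))"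
      "set (leaves (Node s t0 r)) \<inter> (set (leaves t1) \<union> set (leaves t2)) = {}"
      using *(2,5,8) disj leaves_l by auto
    ultimately show ?thesis using *(3,4,6,7,9) by blast
  next
    case right
    have "\<exists>t0 s t1 t2. r = graft t0 e (Node s t1 t2) \<and> e \<in> set (leaves t0) \<and>
      a \<in> set (leaves t1) \<and> b \<in> set (leaves t2) \<and> distinct (leaves t0) \<and>
      distinct (leaves t1) \<and> distinct (leaves t2) \<and>
      set (leaves t0) \<inter> (set (leaves t1) \<union> set (leaves t2)) = {} \<and>
      set (leaves t1) \<inter> set (leaves t2) = {}"
      by (rule Node.IH(2)) (use Node.prems right in simp_all)
    then obtain t0 s' t1 t2 where *: "r = graft t0 e (Node s' t1 t2)" "e \<in> set (leaves t0)"
      "a \<in> set (leaves t1)" "b \<in> set (leaves t2)" "distinct (leaves t0)"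
      "distinct (leaves t1)" "distinct (leaves t2)"
      "set (leaves t0) \<inter> (set (leaves t1) \<union> set (leaves t2)) = {}"
      "set (leaves t1) \<inter> set (leaves t2) = {}"
      by (elim exE conjE)
    have leaves_r: "set (leaves r) = set (leaves t0) - {e} \<union> (set (leaves t1) \<union> set (leaves t2))"
      using *(1,2) by (simp add: set_leaves_graft)
    have disj: "set (leaves l) \<inter> set (leaves r) = {}" "distinct (leaves l)" "e \<notin> set (leaves l)"
      using Node.prems by simp_all
    have "Node s l r = graft (Node s l t0) e (Node s' t1 t2)"
      using *(1) disj by (simp add: graft_absent)
    moreover have "e \<in> set (leaves (Node s l t0))" "distinct (leaves (Node s l t0))"
      "set (leaves (Node s l t0)) \<inter> (set (leaves t1) \<union> set (leaves t2)) = {}"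
      using *(2,5,8) disj leaves_r by auto
    ultimately show ?thesis using *(3,4,6,7,9) by blast
  qed
qed

text \<open>A leaf that occurs only in \<open>u\<close> marks the place of the graft, so the
  position of \<open>e\<close> can be read off from the grafted tree.\<close>

lemma leaf_of_grafted:
  assumes "a \<notin> set (leaves t)" "a \<in> set (leaves u)"
  shows "a \<in> set (leaves (graft t e u)) \<longleftrightarrow> e \<in> set (leaves t)"
  using assms by (cases "e \<in> set (leaves t)") (auto simp: set_leaves_graft graft_absent)

text \<open>If \<open>t\<close> is not just \<open>e\<close>, the grafted node lies entirely in one
  child of the root; that child then contains both \<open>a\<close> and \<open>b\<close>, although
  the root of the left-hand side separates them.\<close>

lemma graft_node_eq_node:
  assumes eq: "Node s t1 t2 = graft t e (Node s' t1' t2')"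
    and "e \<in> set (leaves t)" "t \<noteq> Leaf e" "distinct (leaves (Node s t1 t2))"
    and "a \<in> set (leaves t1)" "b \<in> set (leaves t2)" "a \<in> set (leaves t1')" "b \<in> set (leaves t2')"
  shows False
proof (cases t)
  case (Leaf x)
  then show ?thesis using assms by auto
next
  case (Node s'' l r)
  then have t: "t1 = graft l e (Node s' t1' t2')" "t2 = graft r e (Node s' t1' t2')"
    using eq by auto
  have disj: "set (leaves t1) \<inter> set (leaves t2) = {}" using assms(4) by simp
  from assms(2) Node consider "e \<in> set (leaves l)" | "e \<in> set (leaves r)" by auto
  then show ?thesis
  proof cases
    case 1
    then have "b \<in> set (leaves t1)" using t(1) assms(8) by (simp add: set_leaves_graft)
    then show ?thesis using disj assms(6) by blast
  next
    case 2
    then have "a \<in> set (leaves t2)" using t(2) assms(7) by (simp add: set_leaves_graft)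
    then show ?thesis using disj assms(5) by blast
  qed
qed

text \<open>Both decompositions are followed downwards at once. They stop at the same node by
  \<open>graft_node_eq_node\<close>, and until then the leaf \<open>a\<close> tells both which child
  to enter.\<close>

lemma graft_split_unique:
  assumes "graft t0 e (Node s t1 t2) = graft t0' e (Node s' t1' t2')"
    and "distinct (leaves t0)" "e \<in> set (leaves t0)" "e \<in> set (leaves t0')" "distinct (leaves t0')"
    and "distinct (leaves (Node s t1 t2))" "distinct (leaves (Node s' t1' t2'))"
    and "a \<in> set (leaves t1)" "b \<in> set (leaves t2)" "a \<in> set (leaves t1')" "b \<in> set (leaves t2')"
    and "a \<notin> set (leaves t0)" "a \<notin> set (leaves t0')"
  shows "t0 = t0' \<and> s = s' \<and> t1 = t1' \<and> t2 = t2'"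
  using assms
proof (induction t0 arbitrary: t0')
  case (Leaf x)
  then have x: "x = e" by simp
  show ?case
  proof (cases "t0' = Leaf e")
    case True
    then show ?thesis using Leaf x by auto
  next
    case False
    then show ?thesis using graft_node_eq_node[of s t1 t2 t0' e s' t1' t2' a b] Leaf x by auto
  qed
next
  case (Node q l r)
  show ?case
  proof (cases t0')
    case (Leaf x)
    then have "x = e" using Node by auto
    then show ?thesis using graft_node_eq_node[of s' t1' t2' "Node q l r" e s t1 t2 a b] Node.prems Leaf
      by auto
  next
    case N': (Node q' l' r')
    have eq: "q = q'" "graft l e (Node s t1 t2) = graft l' e (Node s' t1' t2')"
      "graft r e (Node s t1 t2) = graft r' e (Node s' t1' t2')"
      using Node.prems(1) N' by auto
    \<comment> \<open>The leaf \<open>a\<close> occurs in a grafted child exactly if the graft took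
      place there, and the grafted children on the two sides agree.\<close>
    have iff: "e \<in> set (leaves k) \<longleftrightarrow> e \<in> set (leaves k')"
      if "graft k e (Node s t1 t2) = graft k' e (Node s' t1' t2')"
        "a \<notin> set (leaves k)" "a \<notin> set (leaves k')" for k k'
      using that Node.prems(8,10) leaf_of_grafted[of a k "Node s t1 t2" e]
        leaf_of_grafted[of a k' "Node s' t1' t2'" e] by simp
    have il: "e \<in> set (leaves l) \<longleftrightarrow> e \<in> set (leaves l')"
      by (rule iff) (use eq Node.prems N' in auto)
    have ir: "e \<in> set (leaves r) \<longleftrightarrow> e \<in> set (leaves r')"
      by (rule iff) (use eq Node.prems N' in auto)
    from Node.prems consider "e \<in> set (leaves l)" "e \<notin> set (leaves r)"
      | "e \<in> set (leaves r)" "e \<notin> set (leaves l)" by auto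
    then show ?thesis
    proof cases
      case 1
      have "l = l' \<and> s = s' \<and> t1 = t1' \<and> t2 = t2'"
        by (rule Node.IH(1)) (use Node.prems N' eq 1 il in auto)
      then show ?thesis using 1 ir eq N' by (auto simp: graft_absent)
    next
      case 2
      have "r = r' \<and> s = s' \<and> t1 = t1' \<and> t2 = t2'"
        by (rule Node.IH(2)) (use Node.prems N' eq 2 ir in auto)
      then show ?thesis using 2 il eq N' by (auto simp: graft_absent)
    qed
  qed
qed

section \<open>Partitions into three blocks and rising factorials\<close>

definition fiber :: "'i set \<Rightarrow> ('i \<Rightarrow> nat) \<Rightarrow> nat \<Rightarrow> 'i set" where
  "fiber I c k = {i \<in> I. c i = k}"

lemma fiber_subset: "fiber I c k \<subseteq> I"
  by (auto simp: fiber_def)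

lemma finite_fiber [simp]: "finite I \<Longrightarrow> finite (fiber I c k)"
  by (simp add: fiber_def)

lemma card_fiber_insert:
  assumes "finite I" "i \<notin> I"
  shows "card (fiber (insert i I) (c(i := j)) k) = card (fiber I c k) + (if j = k then 1 else 0)"
proof -
  have "fiber (insert i I) (c(i := j)) k = (if j = k then insert i (fiber I c k) else fiber I c k)"
    using assms by (auto simp: fiber_def)
  moreover have "i \<notin> fiber I c k" using assms by (auto simp: fiber_def)
  ultimately show ?thesis using assms by simp
qed

lemma card_fibers:
  assumes "finite I" "c \<in> I \<rightarrow>\<^sub>E {0, 1, 2}"
  shows "card (fiber I c 0) + card (fiber I c 1) + card (fiber I c 2) = card I"
proof -
  have "I = fiber I c 0 \<union> fiber I c 1 \<union> fiber I c 2"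
    using assms(2) by (auto simp: fiber_def dest: PiE_mem)
  moreover have "card (fiber I c 0 \<union> fiber I c 1 \<union> fiber I c 2) =
    card (fiber I c 0) + card (fiber I c 1) + card (fiber I c 2)"
    using assms(1) by (subst card_Un_disjoint | auto simp: fiber_def)+
  ultimately show ?thesis by simp
qed

lemma sum_PiE_insert:
  fixes F :: "_ \<Rightarrow> 'b :: comm_monoid_add"
  assumes "i \<notin> I"
  shows "(\<Sum>c\<in>insert i I \<rightarrow>\<^sub>E S. F c) = (\<Sum>c\<in>I \<rightarrow>\<^sub>E S. \<Sum>j\<in>S. F (c(i := j)))"
proof -
  have "(\<Sum>c\<in>insert i I \<rightarrow>\<^sub>E S. F c) = (\<Sum>(j, c)\<in>S \<times> (I \<rightarrow>\<^sub>E S). F (c(i := j)))"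
    unfolding PiE_insert_eq
    by (subst sum.reindex[OF inj_combinator[OF assms]]) (simp add: case_prod_unfold)
  also have "\<dots> = (\<Sum>j\<in>S. \<Sum>c\<in>I \<rightarrow>\<^sub>E S. F (c(i := j)))"
    by (simp add: sum.cartesian_product)
  also have "\<dots> = (\<Sum>c\<in>I \<rightarrow>\<^sub>E S. \<Sum>j\<in>S. F (c(i := j)))"
    by (rule sum.swap)
  finally show ?thesis .
qed

text \<open>Adding one element to block \<open>j\<close> multiplies the product by \<open>x j + k j\<close>, and these factors
  add up to \<open>\<Sum>x + card I\<close> whatever the partition is.\<close>
lemma sum_prod_pochhammer_fibers:
  fixes x :: "nat \<Rightarrow> real"
  assumes "finite I"
  shows "(\<Sum>c\<in>I \<rightarrow>\<^sub>E {0, 1, 2}. pochhammer (x 0) (card (fiber I c 0)) *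
      pochhammer (x 1) (card (fiber I c 1)) * pochhammer (x 2) (card (fiber I c 2))) =
    pochhammer (x 0 + x 1 + x 2) (card I)"
  using assms
proof (induction I)
  case empty
  then show ?case by (simp add: fiber_def)
next
  case (insert i I)
  let ?P = "\<lambda>I c. pochhammer (x 0) (card (fiber I c 0)) *
      pochhammer (x 1) (card (fiber I c 1)) * pochhammer (x 2) (card (fiber I c 2))"
  have step: "(\<Sum>j\<in>{0, 1, 2}. ?P (insert i I) (c(i := j))) = ?P I c * (x 0 + x 1 + x 2 + card I)"
    if c: "c \<in> I \<rightarrow>\<^sub>E {0, 1, 2}" for c
  proof -
    have eq: "real (card I) = card (fiber I c 0) + card (fiber I c 1) + card (fiber I c 2)"
      using card_fibers[OF insert(1) c] by simp
    show ?thesis unfolding eq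
      using insert(1,2) by (simp add: card_fiber_insert pochhammer_Suc algebra_simps)
  qed
  have "(\<Sum>c\<in>insert i I \<rightarrow>\<^sub>E {0, 1, 2}. ?P (insert i I) c) =
    (\<Sum>c\<in>I \<rightarrow>\<^sub>E {0, 1, 2}. ?P I c * (x 0 + x 1 + x 2 + card I))"
    unfolding sum_PiE_insert[OF insert(2)] by (intro sum.cong refl step)
  also have "\<dots> = pochhammer (x 0 + x 1 + x 2) (card I) * (x 0 + x 1 + x 2 + card I)"
    unfolding sum_distrib_right[symmetric] insert(3) ..
  finally show ?case using insert(1,2) by (simp add: pochhammer_Suc)
qed

section \<open>Splicing orders, and trees decomposed at a branch point\<close>

text \<open>The common normal form of both sides of the theorem: grafted trees reach it in
  \<open>tree_order_join_branches\<close>, mapped points in \<open>order_on_line_map\<close>. All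
  points of blocks 1 and 2 take the place of \<open>e\<close> in \<open>r0\<close>, and
  \<open>s\<close> decides which of these two blocks comes before the other.\<close>

definition splice_order :: "'i set \<Rightarrow> ('i \<Rightarrow> nat) \<Rightarrow> 'i \<Rightarrow> bool \<Rightarrow> ('i \<times> 'i) set \<Rightarrow> ('i \<times> 'i) set \<Rightarrow>
    ('i \<times> 'i) set \<Rightarrow> ('i \<times> 'i) set" where
  "splice_order I c e s r0 r1 r2 = {(i, j) \<in> I \<times> I.
     (c i = 0 \<and> c j = 0 \<and> (i, j) \<in> r0) \<or> (c i = 0 \<and> c j \<noteq> 0 \<and> (i, e) \<in> r0) \<or>
     (c i \<noteq> 0 \<and> c j = 0 \<and> (e, j) \<in> r0) \<or> (c i = 1 \<and> c j = 1 \<and> (i, j) \<in> r1) \<or>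
     (c i = 2 \<and> c j = 2 \<and> (i, j) \<in> r2) \<or> (if s then c i = 1 \<and> c j = 2 else c i = 2 \<and> c j = 1)}"

definition restrict_orders ::
  "'i set \<Rightarrow> ('i \<times> 'i) set \<times> ('i \<times> 'i) set \<Rightarrow> ('i \<times> 'i) set \<times> ('i \<times> 'i) set" where
  "restrict_orders J r = (fst r \<inter> J \<times> J, snd r \<inter> J \<times> J)"

locale branching =
  fixes I :: "'i set" and e a b :: 'i
  assumes finite_I: "finite I" and fresh: "e \<notin> I" "a \<notin> I" "b \<notin> I" "e \<noteq> a" "e \<noteq> b" "a \<noteq> b"
begin

definition branchings ::
  "('i \<Rightarrow> nat) \<Rightarrow> ((bool, 'i) btree \<times> bool \<times> (bool, 'i) btree \<times> (bool, 'i) btree) set" where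
  "branchings c = labelled_trees (insert e (fiber I c 0)) \<times> UNIV \<times>
     labelled_trees (insert a (fiber I c 1)) \<times> labelled_trees (insert b (fiber I c 2))"

definition join_branches where
  "join_branches = (\<lambda>(t0, s, t1, t2). graft t0 e (Node s t1 t2))"

text \<open>Restriction to \<open>I\<close> removes \<open>a\<close> and \<open>b\<close> from the
  orders of \<open>t1\<close> and \<open>t2\<close>, whereas \<open>e\<close> stays in the order of
  \<open>t0\<close> because it marks where to splice. The sign of the branch point enters only
  through \<open>f s\<close>, so it has no effect on the horizontal order.\<close>

lemma tree_order_join_branches:
  assumes c: "c \<in> I \<rightarrow>\<^sub>E {0, 1, 2}" and x: "(t0, s, t1, t2) \<in> branchings c"
  shows "tree_order f (join_branches (t0, s, t1, t2)) \<inter> I \<times> I =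
    splice_order I c e (f s) (tree_order f t0) (tree_order f t1 \<inter> fiber I c 1 \<times> fiber I c 1)
      (tree_order f t2 \<inter> fiber I c 2 \<times> fiber I c 2)"
proof -
  have L: "set (leaves t0) = insert e (fiber I c 0)" "set (leaves t1) = insert a (fiber I c 1)"
    "set (leaves t2) = insert b (fiber I c 2)" "distinct (leaves t0)"
    using x by (auto simp: branchings_def labelled_trees_def)
  have e: "e \<notin> set (leaves (Node s t1 t2))"
    using L fresh by (auto simp: fiber_def)
  have c3: "i \<in> I \<Longrightarrow> c i = 0 \<or> c i = 1 \<or> c i = 2" for i
    using c by (auto dest: PiE_mem)
  have O0: "\<And>i j. (i, j) \<in> tree_order f t0 \<Longrightarrow> i \<in> insert e (fiber I c 0) \<and> j \<in> insert e (fiber I c 0)"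
    using tree_order_subset[of f t0] L by auto
  have O1: "\<And>i j. (i, j) \<in> tree_order f t1 \<Longrightarrow> i \<in> insert a (fiber I c 1) \<and> j \<in> insert a (fiber I c 1)"
    using tree_order_subset[of f t1] L by auto
  have O2: "\<And>i j. (i, j) \<in> tree_order f t2 \<Longrightarrow> i \<in> insert b (fiber I c 2) \<and> j \<in> insert b (fiber I c 2)"
    using tree_order_subset[of f t2] L by auto
  have M: "i \<in> set (leaves t0) \<longleftrightarrow> c i = 0" "i \<in> set (leaves t1) \<longleftrightarrow> c i = 1"
    "i \<in> set (leaves t2) \<longleftrightarrow> c i = 2" if "i \<in> I" for i
    using that fresh L by (auto simp: fiber_def)
  have "(i, j) \<in> tree_order f (graft t0 e (Node s t1 t2)) \<longleftrightarrow> (i, j) \<in> splice_order I c e (f s) (tree_order f t0)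
      (tree_order f t1 \<inter> fiber I c 1 \<times> fiber I c 1) (tree_order f t2 \<inter> fiber I c 2 \<times> fiber I c 2)"
    if ij: "i \<in> I" "j \<in> I" for i j
  proof -
    have ne: "i \<noteq> e" "j \<noteq> e" "i \<noteq> a" "j \<noteq> a" "i \<noteq> b" "j \<noteq> b" using ij fresh by auto
    have P: "c i \<noteq> 0 \<or> c j \<noteq> 0 \<Longrightarrow> (i, j) \<notin> tree_order f t0"
      "c i \<noteq> 0 \<Longrightarrow> (i, e) \<notin> tree_order f t0" "c j \<noteq> 0 \<Longrightarrow> (e, j) \<notin> tree_order f t0"
      "c i \<noteq> 1 \<or> c j \<noteq> 1 \<Longrightarrow> (i, j) \<notin> tree_order f t1"
      "c i \<noteq> 2 \<or> c j \<noteq> 2 \<Longrightarrow> (i, j) \<notin> tree_order f t2"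
      using O0[of i j] O0[of i e] O0[of e j] O1[of i j] O2[of i j] ne by (auto simp: fiber_def)
    have "(i, j) \<in> tree_order f (graft t0 e (Node s t1 t2)) \<longleftrightarrow> (i, j) \<in> tree_order f t0 \<or>
      ((i, e) \<in> tree_order f t0 \<and> (c j = 1 \<or> c j = 2)) \<or>
      ((e, j) \<in> tree_order f t0 \<and> (c i = 1 \<or> c i = 2)) \<or>
      (i, j) \<in> tree_order f t1 \<or> (i, j) \<in> tree_order f t2 \<or>
      (if f s then c i = 1 \<and> c j = 2 else c i = 2 \<and> c j = 1)"
      unfolding tree_order_graft[OF L(4) _ e, of f, unfolded L(1), OF insertI1]
      using ne M[OF ij(1)] M[OF ij(2)] by (simp del: One_nat_def) blast
    then show ?thesis
      unfolding splice_order_def using c3[OF ij(1)] c3[OF ij(2)] ij P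
      by (elim disjE; simp add: fiber_def)
  qed
  moreover have "splice_order I c e (f s) r0 r1 r2 \<subseteq> I \<times> I" for r0 r1 r2
    unfolding splice_order_def by blast
  ultimately show ?thesis
    unfolding join_branches_def prod.case by blast
qed

lemma sign_weight_join_branches:
  assumes "(t0, s, t1, t2) \<in> branchings c"
  shows "sign_weight p (join_branches (t0, s, t1, t2)) =
    sign_weight p t0 * (if s then p else 1 - p) * sign_weight p t1 * sign_weight p t2"
  using assms
  by (auto simp: join_branches_def branchings_def labelled_trees_def sign_weight_graft)

text \<open>The cut is unique, and the leaf sets of its three pieces determine \<open>c\<close>
  because \<open>e\<close>, \<open>a\<close> and \<open>b\<close> lie outside \<open>I\<close>.
  Conversely every tree with \<open>a\<close> left of \<open>b\<close> can be cut, and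
  \<open>c\<close> records the piece in which each label ends up.\<close>

lemma bij_join_branches:
  "bij_betw (\<lambda>(c, x). join_branches x) (SIGMA c : I \<rightarrow>\<^sub>E {0, 1, 2}. branchings c)
     {t \<in> labelled_trees (insert a (insert b I)). (a, b) \<in> tree_order (\<lambda>_. True) t}"
  unfolding bij_betw_def
proof (intro conjI equalityI subsetI)
  show "inj_on (\<lambda>(c, x). join_branches x) (SIGMA c : I \<rightarrow>\<^sub>E {0, 1, 2}. branchings c)"
  proof (rule inj_onI, clarify)
    fix c c' t0 s t1 t2 t0' s' t1' t2'
    assume c: "c \<in> I \<rightarrow>\<^sub>E {0, 1, 2}" "c' \<in> I \<rightarrow>\<^sub>E {0, 1, 2}"
      and x: "(t0, s, t1, t2) \<in> branchings c" "(t0', s', t1', t2') \<in> branchings c'"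
      and eq: "join_branches (t0, s, t1, t2) = join_branches (t0', s', t1', t2')"
    have *: "t0 = t0' \<and> s = s' \<and> t1 = t1' \<and> t2 = t2'"
      by (rule graft_split_unique[where a = a and b = b and e = e])
        (use x eq fresh in \<open>auto simp: join_branches_def branchings_def labelled_trees_def fiber_def\<close>)
    have "c i = c' i" for i
    proof (cases "i \<in> I")
      case True
      then have ne: "i \<noteq> e" "i \<noteq> a" "i \<noteq> b" using fresh by auto
      have "insert e (fiber I c 0) = insert e (fiber I c' 0)"
        "insert a (fiber I c 1) = insert a (fiber I c' 1)"
        "insert b (fiber I c 2) = insert b (fiber I c' 2)"
        using x * by (auto simp: branchings_def labelled_trees_def)
      then have "c i = 0 \<longleftrightarrow> c' i = 0" "c i = 1 \<longleftrightarrow> c' i = 1" "c i = 2 \<longleftrightarrow> c' i = 2"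
        using ne True by (auto simp: fiber_def set_eq_iff)
      moreover have "c i = 0 \<or> c i = 1 \<or> c i = 2" using PiE_mem[OF c(1) True] by simp
      ultimately show ?thesis by (elim disjE) simp_all
    next
      case False
      then show ?thesis using c by (auto simp: PiE_def extensional_def)
    qed
    then show "c = c' \<and> (t0, s, t1, t2) = (t0', s', t1', t2')" using * by auto
  qed
next
  fix t assume "t \<in> (\<lambda>(c, x). join_branches x) ` (SIGMA c : I \<rightarrow>\<^sub>E {0, 1, 2}. branchings c)"
  then obtain c t0 s t1 t2 where c: "c \<in> I \<rightarrow>\<^sub>E {0, 1, 2}" and x: "(t0, s, t1, t2) \<in> branchings c"
    and t: "t = graft t0 e (Node s t1 t2)"
    by (auto simp: join_branches_def)
  have L: "set (leaves t0) = insert e (fiber I c 0)" "set (leaves t1) = insert a (fiber I c 1)"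
    "set (leaves t2) = insert b (fiber I c 2)" "distinct (leaves t0)" "distinct (leaves t1)"
    "distinct (leaves t2)"
    using x by (auto simp: branchings_def labelled_trees_def)
  have "I = fiber I c 0 \<union> fiber I c 1 \<union> fiber I c 2"
    using c by (auto simp: fiber_def dest: PiE_mem)
  moreover have "e \<notin> fiber I c 0" using fresh by (auto simp: fiber_def)
  ultimately have "set (leaves t) = insert a (insert b I)"
    unfolding t using L by (subst set_leaves_graft) auto
  moreover have "distinct (leaves t)"
    unfolding t by (rule distinct_leaves_graft) (use L fresh in \<open>auto simp: fiber_def\<close>)
  moreover have "(a, b) \<in> tree_order (\<lambda>_. True) t"
    unfolding t using L fresh by (subst tree_order_graft) (auto simp: fiber_def)
  ultimately show "t \<in> {t \<in> labelled_trees (insert a (insert b I)). (a, b) \<in> tree_order (\<lambda>_. True) t}"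
    by (simp add: labelled_trees_def)
next
  fix t assume "t \<in> {t \<in> labelled_trees (insert a (insert b I)). (a, b) \<in> tree_order (\<lambda>_. True) t}"
  then have t: "distinct (leaves t)" "set (leaves t) = insert a (insert b I)"
    "(a, b) \<in> tree_order (\<lambda>_. True) t" by (auto simp: labelled_trees_def)
  then have "e \<notin> set (leaves t)" using fresh by auto
  from graft_split_exists[OF t(1,3) this] obtain t0 s t1 t2 where *:
    "t = graft t0 e (Node s t1 t2)" "e \<in> set (leaves t0)" "a \<in> set (leaves t1)" "b \<in> set (leaves t2)"
    "distinct (leaves t0)" "distinct (leaves t1)" "distinct (leaves t2)"
    "set (leaves t0) \<inter> (set (leaves t1) \<union> set (leaves t2)) = {}"
    "set (leaves t1) \<inter> set (leaves t2) = {}" by (elim exE conjE)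
  have L: "insert a (insert b I) = (set (leaves t0) - {e}) \<union> (set (leaves t1) \<union> set (leaves t2))"
    using *(2) unfolding t(2)[symmetric] *(1) by (simp add: set_leaves_graft)
  \<comment> \<open>The default value 2 is right because the three pieces cover \<open>I\<close>: a
    label in neither \<open>t0\<close> nor \<open>t1\<close> is a leaf of \<open>t2\<close>.\<close>
  define c where "c = restrict (\<lambda>i. if i \<in> set (leaves t0) then 0 else if i \<in> set (leaves t1) then 1
    else (2::nat)) I"
  have "c \<in> I \<rightarrow>\<^sub>E {0, 1, 2}" by (auto simp: c_def)
  moreover have sub: "set (leaves t0) - {e} \<subseteq> I" "set (leaves t1) - {a} \<subseteq> I" "set (leaves t2) - {b} \<subseteq> I"
  proof -
    have nin: "a \<notin> set (leaves t0)" "b \<notin> set (leaves t0)" "b \<notin> set (leaves t1)" "a \<notin> set (leaves t2)"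
      using *(3,4,8,9) by blast+
    have "set (leaves t0) - {e} \<subseteq> insert a (insert b I)" "set (leaves t1) \<subseteq> insert a (insert b I)"
      "set (leaves t2) \<subseteq> insert a (insert b I)"
      unfolding L by blast+
    then show "set (leaves t0) - {e} \<subseteq> I" "set (leaves t1) - {a} \<subseteq> I" "set (leaves t2) - {b} \<subseteq> I"
      using nin by blast+
  qed
  have cover: "I \<subseteq> set (leaves t0) \<union> set (leaves t1) \<union> set (leaves t2)"
    using equalityD1[OF L] by blast
  have fib0: "fiber I c 0 = I \<inter> set (leaves t0)"
    by (auto simp: c_def fiber_def)
  have fib1: "fiber I c 1 = I \<inter> set (leaves t1)"
    using *(8) by (auto simp: c_def fiber_def)
  have "x \<in> fiber I c 2 \<longleftrightarrow> x \<in> I \<and> x \<notin> set (leaves t0) \<and> x \<notin> set (leaves t1)" for x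
    by (simp add: c_def fiber_def)
  then have fib2: "fiber I c 2 = I \<inter> set (leaves t2)"
    using cover *(8,9) by blast
  have "set (leaves t0) = insert e (fiber I c 0)" "set (leaves t1) = insert a (fiber I c 1)"
    "set (leaves t2) = insert b (fiber I c 2)"
    unfolding fib0 fib1 fib2 using sub *(2,3,4) by blast+
  ultimately have "(c, t0, s, t1, t2) \<in> (SIGMA c : I \<rightarrow>\<^sub>E {0, 1, 2}. branchings c)"
    using *(5,6,7) by (simp add: branchings_def labelled_trees_def)
  moreover have "t = (\<lambda>(c, x). join_branches x) (c, t0, s, t1, t2)"
    using *(1) by (simp add: join_branches_def)
  ultimately show "t \<in> (\<lambda>(c, x). join_branches x) ` (SIGMA c : I \<rightarrow>\<^sub>E {0, 1, 2}. branchings c)"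
    by blast
qed

lemma finite_branchings: "finite (branchings c)"
  unfolding branchings_def using finite_I by (intro finite_cartesian_product finite_labelled_trees) simp_all

text \<open>The labels \<open>a\<close> and \<open>b\<close> can be exchanged, which accounts for the factor 2.\<close>
lemma sum_trees_by_order:
  fixes h :: "_ \<Rightarrow> real"
  shows "(\<Sum>t\<in>labelled_trees (insert a (insert b I)). sign_weight p t * h (restrict_orders I (tree_orders t))) =
    2 * (\<Sum>t\<in>{t \<in> labelled_trees (insert a (insert b I)). (a, b) \<in> tree_order (\<lambda>_. True) t}.
      sign_weight p t * h (restrict_orders I (tree_orders t)))"
proof -
  let ?T = "labelled_trees (insert a (insert b I)) :: (bool, 'i) btree set"
  let ?F = "\<lambda>t. sign_weight p t * h (restrict_orders I (tree_orders t))"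
  let ?A = "{t \<in> ?T. (a, b) \<in> tree_order (\<lambda>_. True) t}"
  let ?B = "{t \<in> ?T. (b, a) \<in> tree_order (\<lambda>_. True) t}"
  let ?\<tau> = "Transposition.transpose a b"
  let ?m = "map_btree id ?\<tau> :: (bool, 'i) btree \<Rightarrow> _"
  have fin: "finite ?T" using finite_I by (intro finite_labelled_trees) simp
  have T: "?T = ?A \<union> ?B"
    using tree_order_total[of a _ b "\<lambda>_. True"] fresh by (auto simp: labelled_trees_def)
  have disj: "?A \<inter> ?B = {}"
    by (auto simp: labelled_trees_def dest: tree_order_asym)
  have mm: "?m (?m t) = t" for t
    by (simp add: btree.map_comp o_def btree.map_ident_strong)
  have tau_I: "?\<tau> ` insert a (insert b I) = insert a (insert b I)"
    using fresh by (auto simp: Transposition.transpose_def image_iff)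
  have mT: "?m t \<in> ?T" if "t \<in> ?T" for t
  proof -
    have "set (leaves (?m t)) = ?\<tau> ` set (leaves t)" by (simp add: leaves_map)
    moreover have "distinct (leaves (?m t))"
      using that by (simp add: leaves_map distinct_map labelled_trees_def
          inj_on_transpose del: inj_on_insert)
    ultimately show ?thesis using that tau_I by (simp add: labelled_trees_def)
  qed
  have ord: "tree_order f (?m t) = map_prod ?\<tau> ?\<tau> ` tree_order f t" for f t
    by (rule tree_order_map)
  have mem: "(i, j) \<in> tree_order f (?m t) \<longleftrightarrow> (?\<tau> i, ?\<tau> j) \<in> tree_order f t" for i j f t
    unfolding ord by (force simp: map_prod_def image_iff)
  \<comment> \<open>The transposition of \<open>a\<close> and \<open>b\<close> fixes every label in
    \<open>I\<close>, so the restricted orders do not notice it.\<close>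
  have res: "tree_order f (?m t) \<inter> I \<times> I = tree_order f t \<inter> I \<times> I" for f t
  proof (rule set_eqI)
    fix x
    show "x \<in> tree_order f (?m t) \<inter> I \<times> I \<longleftrightarrow> x \<in> tree_order f t \<inter> I \<times> I"
    proof (cases x)
      case (Pair i j)
      show ?thesis
      proof (cases "i \<in> I \<and> j \<in> I")
        case True
        then have "?\<tau> i = i" "?\<tau> j = j" using fresh by (auto simp: Transposition.transpose_def)
        then show ?thesis using Pair mem[of i j f t] by simp
      qed (use Pair in auto)
    qed
  qed
  have F: "?F (?m t) = ?F t" for t
    by (simp add: sign_weight_map restrict_orders_def res)
  have "sum ?F ?B = sum ?F ?A"
    by (rule sum.reindex_bij_witness[where i = ?m and j = ?m]) (use mm mT mem F in auto)
  moreover have "sum ?F ?T = sum ?F ?A + sum ?F ?B"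
    using fin disj by (subst T, intro sum.union_disjoint) auto
  ultimately show ?thesis by simp
qed

text \<open>The first order is spliced with \<open>True\<close> and the second with
  \<open>s\<close>: from left to right the piece of \<open>a\<close> always precedes that of
  \<open>b\<close>, and only the vertical order is reversed by a negative sign.\<close>

lemma sum_trees_branching:
  fixes h :: "_ \<Rightarrow> real"
  shows "(\<Sum>t\<in>labelled_trees (insert a (insert b I)). sign_weight p t * h (restrict_orders I (tree_orders t))) =
    2 * (\<Sum>c\<in>I \<rightarrow>\<^sub>E {0, 1, 2}. \<Sum>(t0, s, t1, t2)\<in>branchings c.
      sign_weight p t0 * (if s then p else 1 - p) * sign_weight p t1 * sign_weight p t2 *
      h (splice_order I c e True (tree_order (\<lambda>_. True) t0)
           (tree_order (\<lambda>_. True) t1 \<inter> fiber I c 1 \<times> fiber I c 1)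
           (tree_order (\<lambda>_. True) t2 \<inter> fiber I c 2 \<times> fiber I c 2),
         splice_order I c e s (tree_order id t0)
           (tree_order id t1 \<inter> fiber I c 1 \<times> fiber I c 1)
           (tree_order id t2 \<inter> fiber I c 2 \<times> fiber I c 2)))" (is "_ = 2 * ?R")
proof -
  let ?F = "\<lambda>t. sign_weight p t * h (restrict_orders I (tree_orders t))"
  have "sum ?F {t \<in> labelled_trees (insert a (insert b I)). (a, b) \<in> tree_order (\<lambda>_. True) t} =
    (\<Sum>(c, x)\<in>(SIGMA c : I \<rightarrow>\<^sub>E {0, 1, 2}. branchings c). ?F (join_branches x))"
    by (subst sum.reindex_bij_betw[OF bij_join_branches, symmetric]) (simp add: case_prod_unfold)
  also have "\<dots> = (\<Sum>c\<in>I \<rightarrow>\<^sub>E {0, 1, 2}. \<Sum>x\<in>branchings c. ?F (join_branches x))"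
    by (subst sum.Sigma) (auto simp: finite_PiE finite_I finite_branchings)
  also have "\<dots> = ?R"
  proof (intro sum.cong refl, clarify, goal_cases)
    case (1 c t0 s t1 t2)
    show ?case
      using tree_order_join_branches[OF 1, of "\<lambda>_. True"] tree_order_join_branches[OF 1, of id]
        sign_weight_join_branches[OF 1(2), of p]
      by (simp add: restrict_orders_def)
  qed
  finally show ?thesis using sum_trees_by_order[of p h] by simp
qed

end

section \<open>Counting labelled trees\<close>

text \<open>Since the signings of one shape have total weight 1, this is the number of unsigned
  plane binary trees whose leaves carry the labels \<open>J\<close>; in particular it does not
  depend on \<open>p\<close>.\<close>

definition tree_mass :: "real \<Rightarrow> 'i set \<Rightarrow> real" where
  "tree_mass p J = (\<Sum>t\<in>labelled_trees J. sign_weight p t)"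

text \<open>This is \<open>(2k)! / k!\<close>, the Catalan number of \<open>k\<close> times
  \<open>(k+1)!\<close>: the number of labelled plane binary trees with \<open>k + 1\<close>
  leaves.\<close>

definition half_mass :: "nat \<Rightarrow> real" where
  "half_mass k = 4 ^ k * pochhammer (1/2) k"

text \<open>The 2 on the right will cancel the factor from exchanging \<open>a\<close> and
  \<open>b\<close>, and \<open>3/2\<close> is the sum of the three Dirichlet parameters.\<close>

lemma half_mass_Suc: "half_mass (Suc k) = 2 * 4 ^ k * pochhammer (3/2) k"
  by (simp add: half_mass_def pochhammer_rec)

context branching
begin

text \<open>The decomposition for a constant \<open>h\<close>; the two signs of the branch point
  contribute \<open>p + (1 - p) = 1\<close>.\<close>

lemma tree_mass_rec:
  "tree_mass p (insert a (insert b I)) =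
    2 * (\<Sum>c\<in>I \<rightarrow>\<^sub>E {0, 1, 2}. tree_mass p (insert e (fiber I c 0)) *
      tree_mass p (insert a (fiber I c 1)) * tree_mass p (insert b (fiber I c 2)))"
proof -
  have "(\<Sum>(t0, s, t1, t2)\<in>branchings c.
      sign_weight p t0 * (if s then p else 1 - p) * sign_weight p t1 * sign_weight p t2) =
    tree_mass p (insert e (fiber I c 0)) *
      tree_mass p (insert a (fiber I c 1)) * tree_mass p (insert b (fiber I c 2))" for c
    unfolding branchings_def tree_mass_def
    unfolding sum.cartesian_product[symmetric] sum_distrib_left[symmetric] sum_distrib_right[symmetric]
    by (simp add: UNIV_bool)
  then show ?thesis
    using sum_trees_branching[of p "\<lambda>_. 1"] by (simp add: tree_mass_def)
qed

end

lemma tree_mass_eq: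
  fixes J :: "nat set"
  assumes "finite J" "card J = Suc n"
  shows "tree_mass p J = half_mass n"
  using assms
proof (induction n arbitrary: J rule: less_induct)
  case (less n)
  show ?case
  proof (cases n)
    case 0
    then obtain x where "J = {x}" using less.prems by (auto simp: card_Suc_eq)
    then show ?thesis using 0 by (simp add: tree_mass_def labelled_trees_singleton half_mass_def)
  next
    case (Suc k)
    obtain a J' where a: "J = insert a J'" "a \<notin> J'" "card J' = Suc k"
      using less.prems Suc by (metis card_Suc_eq)
    obtain b I where b: "J' = insert b I" "b \<notin> I" "card I = k"
      using a(3) by (metis card_Suc_eq)
    have I: "finite I" using less.prems a b by simp
    obtain e where e: "e \<notin> J" using less.prems(1) by (metis ex_new_if_finite infinite_UNIV_nat)
    interpret branching I e a b
      by unfold_locales (use I a b e in auto)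
    have "tree_mass p J = 2 * (\<Sum>c\<in>I \<rightarrow>\<^sub>E {0, 1, 2}. tree_mass p (insert e (fiber I c 0)) *
      tree_mass p (insert a (fiber I c 1)) * tree_mass p (insert b (fiber I c 2)))"
      using a b tree_mass_rec by simp
    also have "\<dots> = 2 * (\<Sum>c\<in>I \<rightarrow>\<^sub>E {0, 1, 2}. half_mass (card (fiber I c 0)) *
      half_mass (card (fiber I c 1)) * half_mass (card (fiber I c 2)))"
    proof (intro arg_cong[where f = "\<lambda>x. 2 * x"] sum.cong refl)
      fix c assume "c \<in> I \<rightarrow>\<^sub>E {0, 1, 2::nat}"
      \<comment> \<open>The blocks partition the \<open>k = n - 1\<close> labels of
        \<open>I\<close>; with its one additional leaf a piece still falls under the induction
        hypothesis.\<close>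
      from card_fibers[OF I this] have le: "card (fiber I c j) < n" if "j \<in> {0, 1, 2}" for j
        using that b Suc by auto
      have "x \<notin> I \<Longrightarrow> card (insert x (fiber I c j)) = Suc (card (fiber I c j))" for x j
        using I fiber_subset[of I c j] by (subst card_insert_disjoint) auto
      then have tm: "tree_mass p (insert x (fiber I c j)) = half_mass (card (fiber I c j))"
        if "x \<notin> I" "j \<in> {0, 1, 2}" for x j
        using that I le by (intro less.IH) simp_all
      show "tree_mass p (insert e (fiber I c 0)) * tree_mass p (insert a (fiber I c 1)) *
          tree_mass p (insert b (fiber I c 2)) =
        half_mass (card (fiber I c 0)) * half_mass (card (fiber I c 1)) * half_mass (card (fiber I c 2))"
        using fresh tm by simp
    qed
    \<comment> \<open>The exponents of 4 add up to \<open>k\<close> for every partition, so the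
      power of 4 is a common factor.\<close>
    also have "\<dots> = 2 * (\<Sum>c\<in>I \<rightarrow>\<^sub>E {0, 1, 2}. 4 ^ k * (pochhammer (1/2) (card (fiber I c 0)) *
      pochhammer (1/2) (card (fiber I c 1)) * pochhammer (1/2) (card (fiber I c 2))))"
      using card_fibers[OF I] b
      by (intro arg_cong[where f = "\<lambda>x. 2 * x"] sum.cong refl)
        (simp add: half_mass_def power_add[symmetric] ac_simps flip: power_add)
    also have "\<dots> = 2 * 4 ^ k * pochhammer (3/2) k"
      unfolding sum_distrib_left[symmetric]
      using sum_prod_pochhammer_fibers[OF I, of "\<lambda>_. 1/2"] b by simp
    finally show ?thesis using Suc by (simp add: half_mass_Suc)
  qed
qed

section \<open>Orders of sampled points\<close>

lemma borel_measurable_fst_snd [measurable]: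
  "(fst :: real \<times> real \<Rightarrow> real) \<in> borel \<rightarrow>\<^sub>M borel" "(snd :: real \<times> real \<Rightarrow> real) \<in> borel \<rightarrow>\<^sub>M borel"
  by (intro borel_measurable_continuous_onI continuous_intros)+

lemma measurable_finite_range:
  assumes "finite S" "\<And>x. x \<in> space M \<Longrightarrow> f x \<in> S"
    and "\<And>r. r \<in> S \<Longrightarrow> {x \<in> space M. f x = r} \<in> sets M"
  shows "f \<in> M \<rightarrow>\<^sub>M count_space UNIV"
proof -
  have "f -` {r} \<inter> space M = {x \<in> space M. f x = r}" for r by auto
  then have "f \<in> M \<rightarrow>\<^sub>M count_space S"
    using assms(2,3) by (intro measurable_count_space_eq2[OF assms(1), THEN iffD2]) auto
  then show ?thesis
    by (rule measurable_compose[of _ _ _ "\<lambda>x. x"]) simp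
qed

lemma (in prob_space) integrable_finite_range:
  fixes h :: "_ \<Rightarrow> real"
  assumes "f \<in> M \<rightarrow>\<^sub>M count_space UNIV" "finite S" "\<And>x. x \<in> space M \<Longrightarrow> f x \<in> S"
  shows "integrable M (\<lambda>x. h (f x))"
proof (rule integrable_const_bound)
  show "AE x in M. norm (h (f x)) \<le> (\<Sum>r\<in>S. \<bar>h r\<bar>)"
    using assms by (intro AE_I2) (auto intro!: member_le_sum)
  show "(\<lambda>x. h (f x)) \<in> borel_measurable M"
    by (rule measurable_compose[OF assms(1)]) simp
qed

definition order_on :: "'i set \<Rightarrow> ('i \<Rightarrow> real) \<Rightarrow> ('i \<times> 'i) set" where
  "order_on I x = {(i, j) \<in> I \<times> I. x i < x j}"

definition sample_orders ::
  "'i set \<Rightarrow> ('i \<Rightarrow> real \<times> real) \<Rightarrow> ('i \<times> 'i) set \<times> ('i \<times> 'i) set" where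
  "sample_orders I z = (order_on I (\<lambda>i. fst (z i)), order_on I (\<lambda>i. snd (z i)))"

text \<open>A convenient finite set containing all values of \<open>sample_orders\<close>; most of
  its elements are not orders at all.\<close>

definition order_pairs :: "'i set \<Rightarrow> (('i \<times> 'i) set \<times> ('i \<times> 'i) set) set" where
  "order_pairs I = Pow (I \<times> I) \<times> Pow (I \<times> I)"

lemma finite_order_pairs: "finite I \<Longrightarrow> finite (order_pairs I)"
  by (simp add: order_pairs_def)

lemma sample_orders_in: "sample_orders I z \<in> order_pairs I"
  by (auto simp: sample_orders_def order_pairs_def order_on_def)

lemma sample_orders_cong: "(\<And>i. i \<in> I \<Longrightarrow> z i = z' i) \<Longrightarrow> sample_orders I z = sample_orders I z'"
  by (auto simp: sample_orders_def order_on_def)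

lemma order_on_eq_iff:
  "order_on I x = r \<longleftrightarrow> r \<subseteq> I \<times> I \<and> (\<forall>i\<in>I. \<forall>j\<in>I. x i < x j \<longleftrightarrow> (i, j) \<in> r)"
  by (auto simp: order_on_def)

lemma measurable_order_on:
  assumes "finite I" and "\<And>i. i \<in> I \<Longrightarrow> (\<lambda>z. x z i) \<in> borel_measurable M"
  shows "(\<lambda>z. order_on I (x z)) \<in> M \<rightarrow>\<^sub>M count_space UNIV"
proof (rule measurable_finite_range)
  show "finite (Pow (I \<times> I))" using assms by simp
  show "order_on I (x z) \<in> Pow (I \<times> I)" for z by (auto simp: order_on_def)
  fix r
  note [measurable] = assms(2)
  show "{z \<in> space M. order_on I (x z) = r} \<in> sets M"
    unfolding order_on_eq_iff using assms(1) by measurable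
qed

lemma measurable_sample_orders:
  assumes "finite I"
  shows "sample_orders I \<in> PiM I (\<lambda>_. borel) \<rightarrow>\<^sub>M count_space UNIV"
proof -
  have "(\<lambda>z. order_on I (\<lambda>i. f (z i))) \<in> PiM I (\<lambda>_. borel) \<rightarrow>\<^sub>M count_space UNIV"
    if "f \<in> borel_measurable borel" for f :: "real \<times> real \<Rightarrow> real"
    using that by (intro measurable_order_on assms measurable_compose[OF measurable_component_singleton])
  from this[OF borel_measurable_fst_snd(1)] this[OF borel_measurable_fst_snd(2)]
  have [measurable]:
    "(\<lambda>z. order_on I (\<lambda>i. fst (z i :: real \<times> real))) \<in> PiM I (\<lambda>_. borel) \<rightarrow>\<^sub>M count_space UNIV"
    "(\<lambda>z. order_on I (\<lambda>i. snd (z i :: real \<times> real))) \<in> PiM I (\<lambda>_. borel) \<rightarrow>\<^sub>M count_space UNIV" .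
  show ?thesis
  proof (rule measurable_finite_range[OF finite_order_pairs[OF assms] sample_orders_in])
    fix r :: "('a \<times> 'a) set \<times> ('a \<times> 'a) set"
    have "{z \<in> space (PiM I (\<lambda>_. borel)). order_on I (\<lambda>i. fst (z i)) = fst r \<and> order_on I (\<lambda>i. snd (z i)) = snd r}
      \<in> sets (PiM I (\<lambda>_. borel))"
      by measurable
    then show "{z \<in> space (PiM I (\<lambda>_. borel)). sample_orders I z = r} \<in> sets (PiM I (\<lambda>_. borel))"
      by (simp add: sample_orders_def prod_eq_iff)
  qed
qed

text \<open>On a rectangle the product measure is a finite product of evaluations of
  \<open>\<mu>\<close>, each measurable by the definition of the sigma-algebra; rectangles are
  stable under intersection and generate.\<close>

lemma measurable_PiM_kernel:
  assumes "finite I"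
  shows "(\<lambda>\<mu>. PiM I (\<lambda>_. \<mu>)) \<in> prob_algebra N \<rightarrow>\<^sub>M prob_algebra (PiM I (\<lambda>_. N))"
proof (rule measurable_prob_algebra_generated)
  show "sets (PiM I (\<lambda>_. N)) = sigma_sets (\<Pi>\<^sub>E i\<in>I. space N) (prod_algebra I (\<lambda>_. N))"
    by (rule sets_PiM)
  show "Int_stable (prod_algebra I (\<lambda>_. N))" by (rule Int_stable_prod_algebra)
  show "prod_algebra I (\<lambda>_. N) \<subseteq> Pow (\<Pi>\<^sub>E i\<in>I. space N)" by (rule prod_algebra_sets_into_space)
  fix \<mu> assume "\<mu> \<in> space (prob_algebra N)"
  then have \<mu>: "prob_space \<mu>" "sets \<mu> = sets N" by (auto simp: space_prob_algebra)
  show "prob_space (PiM I (\<lambda>_. \<mu>))" using \<mu> by (intro prob_space_PiM)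
  show "sets (PiM I (\<lambda>_. \<mu>)) = sets (PiM I (\<lambda>_. N))" using \<mu> by (intro sets_PiM_cong) auto
next
  fix A assume "A \<in> prod_algebra I (\<lambda>_. N)"
  then obtain X where X: "A = (\<Pi>\<^sub>E i\<in>I. X i)" "\<And>i. i \<in> I \<Longrightarrow> X i \<in> sets N"
    using assms by (auto simp: prod_algebra_eq_finite)
  have "(\<lambda>\<mu>. \<Prod>i\<in>I. emeasure \<mu> (X i)) \<in> borel_measurable (prob_algebra N)"
    using X by (intro borel_measurable_prod_ennreal)
      (auto simp: prob_algebra_def intro!: measurable_restrict_space1)
  also have "?this \<longleftrightarrow> (\<lambda>\<mu>. emeasure (PiM I (\<lambda>_. \<mu>)) A) \<in> borel_measurable (prob_algebra N)"
  proof (intro measurable_cong)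
    fix \<mu> assume "\<mu> \<in> space (prob_algebra N)"
    then have \<mu>: "prob_space \<mu>" "sets \<mu> = sets N" by (auto simp: space_prob_algebra)
    interpret product_sigma_finite "\<lambda>_. \<mu>"
      using \<mu>(1) by (simp add: product_sigma_finite_def prob_space_imp_sigma_finite)
    show "(\<Prod>i\<in>I. emeasure \<mu> (X i)) = emeasure (PiM I (\<lambda>_. \<mu>)) A"
      unfolding X(1) using X(2) \<mu> assms by (subst emeasure_PiM) auto
  qed
  finally show "(\<lambda>\<mu>. emeasure (PiM I (\<lambda>_. \<mu>)) A) \<in> borel_measurable (prob_algebra N)" .
qed

definition sample_law :: "'i set \<Rightarrow> (real \<times> real) measure measure \<Rightarrow> ('i \<Rightarrow> real \<times> real) measure" where
  "sample_law I P = P \<bind> (\<lambda>\<mu>. PiM I (\<lambda>_. \<mu>))"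

definition relabel where
  "relabel g r = (map_prod g g ` fst r, map_prod g g ` snd r)"

lemma tree_orders_map: "tree_orders (map_btree id g t) = relabel g (tree_orders t)"
  by (simp add: relabel_def tree_order_map)

locale random_measure_law =
  fixes P :: "(real \<times> real) measure measure"
  assumes prob_P: "prob_space P" and sets_P: "sets P = sets (prob_algebra borel)"
begin

sublocale P: prob_space P by (rule prob_P)

lemma P_in_prob_algebra: "P \<in> space (prob_algebra (prob_algebra borel))"
  using prob_P sets_P by (simp add: space_prob_algebra)

lemma space_P: "space P = space (prob_algebra borel)"
  by (rule sets_eq_imp_space_eq[OF sets_P])

lemma kernel: "finite I \<Longrightarrow> (\<lambda>\<mu>. PiM I (\<lambda>_. \<mu>)) \<in> P \<rightarrow>\<^sub>M prob_algebra (PiM I (\<lambda>_. borel))"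
  using measurable_PiM_kernel[of I borel] by (simp add: measurable_cong_sets[OF sets_P refl])

lemma prob_space_sample_law: "finite I \<Longrightarrow> prob_space (sample_law I P)"
  unfolding sample_law_def
  by (rule prob_space_bind'[OF P_in_prob_algebra measurable_PiM_kernel])

lemma sets_sample_law: "finite I \<Longrightarrow> sets (sample_law I P) = sets (PiM I (\<lambda>_. borel))"
  unfolding sample_law_def
  by (rule sets_bind'[OF P_in_prob_algebra measurable_PiM_kernel])

lemma space_sample_law: "finite I \<Longrightarrow> space (sample_law I P) = space (PiM I (\<lambda>_. borel))"
  using sets_sample_law by (rule sets_eq_imp_space_eq)

lemma integral_sample_law:
  fixes h :: "_ \<Rightarrow> real"
  assumes I: "finite I"
  shows "(\<integral>z. h (sample_orders I z) \<partial>sample_law I P) =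
    (\<integral>\<mu>. (\<integral>z. h (sample_orders I z) \<partial>PiM I (\<lambda>_. \<mu>)) \<partial>P)"
  unfolding sample_law_def
proof (rule integral_bind[where K = "PiM I (\<lambda>_. borel)" and B = "\<Sum>r\<in>order_pairs I. \<bar>h r\<bar>" and B' = 1])
  show "(\<lambda>z. h (sample_orders I z)) \<in> borel_measurable (PiM I (\<lambda>_. borel))"
    by (rule measurable_compose[OF measurable_sample_orders[OF I]]) simp
  show "\<bar>h (sample_orders I z)\<bar> \<le> (\<Sum>r\<in>order_pairs I. \<bar>h r\<bar>)" for z
    using I by (intro member_le_sum[of _ _ "\<lambda>r. \<bar>h r\<bar>"]) (auto simp: sample_orders_in finite_order_pairs)
  show "(\<lambda>\<mu>. PiM I (\<lambda>_. \<mu>)) \<in> P \<rightarrow>\<^sub>M subprob_algebra (PiM I (\<lambda>_. borel))"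
    by (rule measurable_prob_algebraD[OF kernel[OF I]])
  show "finite_measure P" by unfold_locales
  show "AE \<mu> in P. emeasure (PiM I (\<lambda>_. \<mu>)) (space (PiM I (\<lambda>_. \<mu>))) \<le> ennreal 1"
    using measurable_space[OF kernel[OF I]]
    by (intro AE_I2) (simp add: space_prob_algebra prob_space.emeasure_space_1)
qed

text \<open>True for a fixed \<open>\<mu>\<close> by independence and identical distribution, hence
  after mixing over \<open>\<mu>\<close>. It serves both for renaming points (\<open>g\<close>
  bijective) and for forgetting points (\<open>g\<close> an inclusion).\<close>

lemma distr_sample_law_reindex:
  assumes g: "inj_on g I" "g \<in> I \<rightarrow> J" and J: "finite J"
  shows "distr (sample_law J P) (PiM I (\<lambda>_. borel)) (\<lambda>z. \<lambda>i\<in>I. z (g i)) = sample_law I P"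
proof -
  have I: "finite I" using inj_on_finite[OF g(1) _ J] g(2) by auto
  have "distr (sample_law J P) (PiM I (\<lambda>_. borel)) (\<lambda>z. \<lambda>i\<in>I. z (g i)) =
    P \<bind> (\<lambda>\<mu>. distr (PiM J (\<lambda>_. \<mu>)) (PiM I (\<lambda>_. borel)) (\<lambda>z. \<lambda>i\<in>I. z (g i)))"
    unfolding sample_law_def
  proof (rule distr_bind)
    show "(\<lambda>\<mu>. PiM J (\<lambda>_. \<mu>)) \<in> P \<rightarrow>\<^sub>M subprob_algebra (PiM J (\<lambda>_. borel))"
      by (rule measurable_prob_algebraD[OF kernel[OF J]])
    show "space P \<noteq> {}" by (rule P.not_empty)
    show "(\<lambda>z. \<lambda>i\<in>I. z (g i)) \<in> PiM J (\<lambda>_. borel) \<rightarrow>\<^sub>M PiM I (\<lambda>_. borel)"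
      using g by (intro measurable_restrict measurable_component_singleton) auto
  qed
  also have "\<dots> = P \<bind> (\<lambda>\<mu>. PiM I (\<lambda>_. \<mu>))"
  proof (rule bind_cong_All[OF ballI])
    fix \<mu> assume "\<mu> \<in> space P"
    then have \<mu>: "prob_space \<mu>" "sets \<mu> = sets borel" by (auto simp: space_P space_prob_algebra)
    have "distr (PiM J (\<lambda>_. \<mu>)) (PiM I (\<lambda>_. borel)) (\<lambda>z. \<lambda>i\<in>I. z (g i)) =
      distr (PiM J (\<lambda>_. \<mu>)) (PiM I (\<lambda>_. \<mu>)) (\<lambda>z. \<lambda>i\<in>I. z (g i))"
      using \<mu> by (intro distr_cong refl sets_PiM_cong) auto
    then show "distr (PiM J (\<lambda>_. \<mu>)) (PiM I (\<lambda>_. borel)) (\<lambda>z. \<lambda>i\<in>I. z (g i)) = PiM I (\<lambda>_. \<mu>)"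
      using distr_PiM_reindex[of J "\<lambda>_. \<mu>" g I] \<mu> g by simp
  qed
  finally show ?thesis by (simp add: sample_law_def)
qed

lemma sample_law_reindex:
  fixes h :: "_ \<Rightarrow> real"
  assumes g: "bij_betw g I J" and J: "finite J"
  shows "(\<integral>z. h (sample_orders J z) \<partial>sample_law J P) =
    (\<integral>y. h (relabel g (sample_orders I y)) \<partial>sample_law I P)"
proof -
  have I: "finite I" using g J by (simp add: bij_betw_finite)
  have inj: "inj_on g I" "g \<in> I \<rightarrow> J" using g by (auto simp: bij_betw_def)
  have "(\<integral>y. h (relabel g (sample_orders I y)) \<partial>sample_law I P) =
    (\<integral>z. h (relabel g (sample_orders I (\<lambda>i\<in>I. z (g i)))) \<partial>sample_law J P)"
    unfolding distr_sample_law_reindex[OF inj J, symmetric]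
  proof (rule integral_distr)
    show "(\<lambda>z. \<lambda>i\<in>I. z (g i)) \<in> sample_law J P \<rightarrow>\<^sub>M PiM I (\<lambda>_. borel)"
      unfolding measurable_cong_sets[OF sets_sample_law[OF J] refl]
      using inj by (intro measurable_restrict measurable_component_singleton) auto
    show "(\<lambda>y. h (relabel g (sample_orders I y))) \<in> borel_measurable (PiM I (\<lambda>_. borel))"
      by (rule measurable_compose[OF measurable_sample_orders[OF I]]) simp
  qed
  moreover have "relabel g (sample_orders I (\<lambda>i\<in>I. z (g i))) = sample_orders J z" for z :: "_ \<Rightarrow> real \<times> real"
  proof -
    have "map_prod g g ` order_on I (\<lambda>i. f ((\<lambda>i\<in>I. z (g i)) i)) = order_on J (\<lambda>i. f (z i))"
      for f :: "real \<times> real \<Rightarrow> real"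
    proof
      show "map_prod g g ` order_on I (\<lambda>i. f ((\<lambda>i\<in>I. z (g i)) i)) \<subseteq> order_on J (\<lambda>i. f (z i))"
        using inj by (auto simp: order_on_def)
      show "order_on J (\<lambda>i. f (z i)) \<subseteq> map_prod g g ` order_on I (\<lambda>i. f ((\<lambda>i\<in>I. z (g i)) i))"
      proof clarify
        fix i j assume *: "(i, j) \<in> order_on J (\<lambda>i. f (z i))"
        then obtain i' j' where "i' \<in> I" "j' \<in> I" "i = g i'" "j = g j'"
          using g by (auto simp: bij_betw_def order_on_def)
        then show "(i, j) \<in> map_prod g g ` order_on I (\<lambda>i. f ((\<lambda>i\<in>I. z (g i)) i))"
          using * by (intro image_eqI[of _ _ "(i', j')"]) (auto simp: order_on_def)
      qed
    qed
    then show ?thesis by (simp add: relabel_def sample_orders_def)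
  qed
  ultimately show ?thesis by simp
qed

end

section \<open>Ranks, sampled permutations and orders\<close>

lemma card_less_less_iff:
  fixes x :: "'i \<Rightarrow> real"
  assumes "finite I" "i \<in> I" "j \<in> I"
  shows "card {l \<in> I. x l < x i} < card {l \<in> I. x l < x j} \<longleftrightarrow> x i < x j"
proof
  assume "x i < x j"
  then show "card {l \<in> I. x l < x i} < card {l \<in> I. x l < x j}"
    using assms by (intro psubset_card_mono) auto
next
  assume *: "card {l \<in> I. x l < x i} < card {l \<in> I. x l < x j}"
  show "x i < x j"
  proof (rule ccontr)
    assume "\<not> x i < x j"
    then have "card {l \<in> I. x l < x j} \<le> card {l \<in> I. x l < x i}"
      using assms by (intro card_mono) auto
    then show False using * by simp
  qed
qed

lemma bij_betw_card_less:
  fixes x :: "'i \<Rightarrow> real"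
  assumes "finite I" "inj_on x I"
  shows "bij_betw (\<lambda>i. card {l \<in> I. x l < x i}) I {..<card I}"
proof -
  have "inj_on (\<lambda>i. card {l \<in> I. x l < x i}) I"
  proof (rule inj_onI)
    fix i j assume "i \<in> I" "j \<in> I" "card {l \<in> I. x l < x i} = card {l \<in> I. x l < x j}"
    then have "x i = x j"
      using card_less_less_iff[OF assms(1), of i j x] card_less_less_iff[OF assms(1), of j i x] by auto
    then show "i = j" using assms(2) \<open>i \<in> I\<close> \<open>j \<in> I\<close> by (auto dest: inj_onD)
  qed
  moreover have "(\<lambda>i. card {l \<in> I. x l < x i}) ` I \<subseteq> {..<card I}"
    using assms(1) by (auto intro!: psubset_card_mono)
  ultimately show ?thesis
    using card_subset_eq[of "{..<card I}" "(\<lambda>i. card {l \<in> I. x l < x i}) ` I"]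
    by (simp add: bij_betw_def card_image)
qed

text \<open>Justifies the definite description. Any admissible permutation maps the points below
  \<open>i\<close> onto the numbers below its value at \<open>i\<close>, so counting them forces
  this value.\<close>

lemma rank_perm:
  assumes "inj_on x {1..k}"
  shows "rank_perm k x permutes {1..k}"
    and "\<And>i j. i \<in> {1..k} \<Longrightarrow> j \<in> {1..k} \<Longrightarrow> rank_perm k x i < rank_perm k x j \<longleftrightarrow> x i < x j"
proof -
  \<comment> \<open>\<open>Suc\<close> because ranks start at 1, and the identity outside
    \<open>{1..k}\<close> as \<open>permutes\<close> requires.\<close>
  define \<alpha> where "\<alpha> i = (if i \<in> {1..k} then Suc (card {l \<in> {1..k}. x l < x i}) else i)" for i
  let ?Q = "\<lambda>\<alpha>. \<alpha> permutes {1..k} \<and> (\<forall>i\<in>{1..k}. \<forall>j\<in>{1..k}. \<alpha> i < \<alpha> j \<longleftrightarrow> x i < x j)"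
  have "bij_betw (Suc \<circ> (\<lambda>i. card {l \<in> {1..k}. x l < x i})) {1..k} {1..k}"
    by (rule bij_betw_trans[OF bij_betw_card_less])
      (use assms in \<open>auto simp: bij_betw_def lessThan_atLeast0 image_Suc_lessThan\<close>)
  then have "bij_betw \<alpha> {1..k} {1..k}"
    by (rule bij_betw_cong[THEN iffD1, rotated]) (simp add: \<alpha>_def)
  then have "\<alpha> permutes {1..k}"
    by (rule bij_imp_permutes) (auto simp: \<alpha>_def)
  moreover have "\<alpha> i < \<alpha> j \<longleftrightarrow> x i < x j" if "i \<in> {1..k}" "j \<in> {1..k}" for i j
    using that card_less_less_iff[of "{1..k}" i j x] by (simp add: \<alpha>_def)
  ultimately have Q: "?Q \<alpha>" by auto
  have unique: "\<alpha>' = \<alpha>" if Q': "?Q \<alpha>'" for \<alpha>'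
  proof
    fix i
    show "\<alpha>' i = \<alpha> i"
    proof (cases "i \<in> {1..k}")
      case True
      have \<alpha>': "\<alpha>' permutes {1..k}" using Q' by simp
      have "{m \<in> {1..k}. m < \<alpha>' i} = \<alpha>' ` {l \<in> {1..k}. x l < x i}"
      proof (intro equalityI subsetI)
        fix m assume m: "m \<in> {m \<in> {1..k}. m < \<alpha>' i}"
        then obtain l where "l \<in> {1..k}" "m = \<alpha>' l"
          using permutes_image[OF \<alpha>'] by (metis (no_types, lifting) imageE mem_Collect_eq)
        then show "m \<in> \<alpha>' ` {l \<in> {1..k}. x l < x i}" using Q' m True by auto
      next
        fix m assume "m \<in> \<alpha>' ` {l \<in> {1..k}. x l < x i}"
        then obtain l where l: "l \<in> {1..k}" "m = \<alpha>' l" "x l < x i" by auto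
        then have "\<alpha>' l \<in> {1..k}" using permutes_in_image[OF \<alpha>'] by blast
        then show "m \<in> {m \<in> {1..k}. m < \<alpha>' i}" using Q' l True by auto
      qed
      moreover have "{m \<in> {1..k}. m < \<alpha>' i} = {1..<\<alpha>' i}"
        using permutes_in_image[OF \<alpha>', of i] True by auto
      ultimately have "card {1..<\<alpha>' i} = card {l \<in> {1..k}. x l < x i}"
        using card_image[OF permutes_inj_on[OF \<alpha>'], of "{l \<in> {1..k}. x l < x i}"] by simp
      moreover have "\<alpha>' i \<ge> 1" using permutes_in_image[OF \<alpha>', of i] True by auto
      ultimately show ?thesis using True by (simp add: \<alpha>_def)
    next
      case False
      then show ?thesis using Q' Q by (auto simp: permutes_def)
    qed
  qed
  have "?Q (rank_perm k x)"
    unfolding rank_perm_def by (rule theI[of ?Q, OF Q]) (rule unique)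
  then show "rank_perm k x permutes {1..k}"
    and "\<And>i j. i \<in> {1..k} \<Longrightarrow> j \<in> {1..k} \<Longrightarrow> rank_perm k x i < rank_perm k x j \<longleftrightarrow> x i < x j"
    by auto
qed

lemma rank_perm_eq_of_order:
  assumes "order_on {1..k} x = order_on {1..k} y"
  shows "rank_perm k x = rank_perm k y"
proof -
  have "x i < x j \<longleftrightarrow> y i < y j" if "i \<in> {1..k}" "j \<in> {1..k}" for i j
    using assms that by (auto simp: order_on_def set_eq_iff)
  then show ?thesis unfolding rank_perm_def
    by (intro arg_cong[where f = The] ext) auto
qed

text \<open>Even for coinciding coordinates the description defining the rank sees only the order of
  the values. So \<open>points_perm\<close> factors through \<open>sample_orders\<close>, which has
  finite range.\<close>

lemma points_perm_measurable:
  "points_perm k \<in> PiM {1..k} (\<lambda>_. borel) \<rightarrow>\<^sub>M count_space UNIV"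
proof -
  \<comment> \<open>Any sample with the prescribed orders will do, since the permutation does not
    depend on the choice.\<close>
  define F where "F r = points_perm k (SOME z. sample_orders {1..k} z = r)" for r
  have "points_perm k z = F (sample_orders {1..k} z)" for z
  proof -
    define z' where "z' = (SOME z'. sample_orders {1..k} z' = sample_orders {1..k} z)"
    have "sample_orders {1..k} z' = sample_orders {1..k} z"
      unfolding z'_def by (rule someI[of _ z]) (rule refl)
    then have "order_on {1..k} (\<lambda>i. fst (z' i)) = order_on {1..k} (\<lambda>i. fst (z i))"
      "order_on {1..k} (\<lambda>i. snd (z' i)) = order_on {1..k} (\<lambda>i. snd (z i))"
      unfolding sample_orders_def prod.inject by simp_all
    then show ?thesis
      unfolding F_def z'_def[symmetric] points_perm_def by (metis rank_perm_eq_of_order)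
  qed
  then have "points_perm k = (\<lambda>z. F (sample_orders {1..k} z))" by auto
  then show ?thesis
    using measurable_compose[OF measurable_sample_orders[of "{1..k}"], of F "count_space UNIV"] by simp
qed

text \<open>The two orders of the points \<open>(i, \<sigma> i)\<close>, that is, of the graph of
  the permutation with its points numbered from left to right.\<close>

definition perm_orders :: "nat \<Rightarrow> (nat \<Rightarrow> nat) \<Rightarrow> (nat \<times> nat) set \<times> (nat \<times> nat) set" where
  "perm_orders k \<sigma> = (order_on {1..k} real, order_on {1..k} (\<lambda>i. real (\<sigma> i)))"

text \<open>Naming each point by its horizontal rank makes the horizontal order the usual one, and
  \<open>points_perm\<close> sends the horizontal rank of a point to its vertical rank.\<close>

lemma relabel_rank:
  fixes z :: "nat \<Rightarrow> real \<times> real"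
  assumes x: "inj_on (\<lambda>i. fst (z i)) {1..k}" and y: "inj_on (\<lambda>i. snd (z i)) {1..k}"
  shows "relabel (rank_perm k (\<lambda>i. fst (z i))) (sample_orders {1..k} z) = perm_orders k (points_perm k z)"
proof -
  let ?\<rho> = "rank_perm k (\<lambda>i. fst (z i))" and ?\<rho>' = "rank_perm k (\<lambda>i. snd (z i))"
  note \<rho> = rank_perm[OF x] and \<rho>' = rank_perm[OF y]
  have *: "map_prod ?\<rho> ?\<rho> ` order_on {1..k} u = order_on {1..k} v"
    if "\<And>i j. i \<in> {1..k} \<Longrightarrow> j \<in> {1..k} \<Longrightarrow> v (?\<rho> i) < v (?\<rho> j) \<longleftrightarrow> u i < u j" for u v :: "nat \<Rightarrow> real"
  proof
    show "map_prod ?\<rho> ?\<rho> ` order_on {1..k} u \<subseteq> order_on {1..k} v"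
      using that permutes_in_image[OF \<rho>(1)] by (auto simp: order_on_def)
    show "order_on {1..k} v \<subseteq> map_prod ?\<rho> ?\<rho> ` order_on {1..k} u"
    proof clarify
      fix a b assume ab: "(a, b) \<in> order_on {1..k} v"
      then have "a \<in> ?\<rho> ` {1..k}" "b \<in> ?\<rho> ` {1..k}"
        unfolding permutes_image[OF \<rho>(1)] by (simp_all add: order_on_def)
      then obtain i j where "i \<in> {1..k}" "j \<in> {1..k}" "a = ?\<rho> i" "b = ?\<rho> j"
        by (elim imageE)
      then show "(a, b) \<in> map_prod ?\<rho> ?\<rho> ` order_on {1..k} u"
        using ab that by (intro image_eqI[of _ _ "(i, j)"]) (auto simp: order_on_def)
    qed
  qed
  have "points_perm k z (?\<rho> i) = ?\<rho>' i" for i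
    by (simp add: points_perm_def permutes_inverses[OF \<rho>(1)])
  then show ?thesis
    unfolding relabel_def sample_orders_def perm_orders_def prod.inject fst_conv snd_conv
    using \<rho>(2) \<rho>'(2) by (intro conjI *) simp_all
qed

lemma relabel_comp: "relabel g (relabel h r) = relabel (g \<circ> h) r"
  by (simp add: relabel_def image_comp map_prod_def o_def case_prod_unfold)

lemma relabel_cong:
  assumes "\<And>i. i \<in> I \<Longrightarrow> g i = g' i" "r \<in> order_pairs I"
  shows "relabel g r = relabel g' r"
  using assms unfolding relabel_def order_pairs_def prod.inject
  by (intro conjI image_cong refl) (auto simp: map_prod_def)

text \<open>Extensional functions, so that the set is finite and each bijection occurs once.\<close>

definition labellings :: "nat \<Rightarrow> 'i set \<Rightarrow> (nat \<Rightarrow> 'i) set" where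
  "labellings k J = {g \<in> {1..k} \<rightarrow>\<^sub>E J. bij_betw g {1..k} J}"

lemma finite_labellings: "finite J \<Longrightarrow> finite (labellings k J)"
  unfolding labellings_def by (rule finite_subset[of _ "{1..k} \<rightarrow>\<^sub>E J"]) (auto intro: finite_PiE)

lemma restrict_in_labellings:
  assumes "bij_betw g {1..k} J"
  shows "restrict g {1..k} \<in> labellings k J"
proof -
  have "bij_betw (restrict g {1..k}) {1..k} J"
    using assms by (subst bij_betw_cong[of _ _ g]) simp_all
  moreover have "restrict g {1..k} \<in> {1..k} \<rightarrow>\<^sub>E J"
    using bij_betwE[OF assms] by simp
  ultimately show ?thesis unfolding labellings_def by simp
qed

lemma labellings_nonempty:
  assumes "finite J" "card J = k"
  shows "labellings k J \<noteq> {}"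
proof -
  obtain g where "bij_betw g {1..k} J"
    using finite_same_card_bij[of "{1..k}" J] assms by auto
  from restrict_in_labellings[OF this] show ?thesis by blast
qed

text \<open>Composition with the horizontal rank permutes the labellings. Summed over all of them,
  it makes no difference whether the points are numbered in the order of sampling or from left to
  right.\<close>

lemma sum_labellings:
  fixes h :: "_ \<Rightarrow> real" and z :: "nat \<Rightarrow> real \<times> real"
  assumes x: "inj_on (\<lambda>i. fst (z i)) {1..k}" and y: "inj_on (\<lambda>i. snd (z i)) {1..k}"
  shows "(\<Sum>g\<in>labellings k J. h (relabel g (sample_orders {1..k} z))) =
    (\<Sum>g\<in>labellings k J. h (relabel g (perm_orders k (points_perm k z))))"
proof -
  let ?\<rho> = "rank_perm k (\<lambda>i. fst (z i))"
  note \<rho> = rank_perm(1)[OF x]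
  have bij: "restrict (g \<circ> \<pi>) {1..k} \<in> labellings k J"
    if "g \<in> labellings k J" "\<pi> permutes {1..k}" for g and \<pi> :: "nat \<Rightarrow> nat"
    using that
    by (intro restrict_in_labellings bij_betw_trans[OF permutes_imp_bij]) (simp_all add: labellings_def)
  have cancel: "restrict (restrict (g \<circ> \<pi>) {1..k} \<circ> \<pi>') {1..k} = g"
    if "g \<in> labellings k J" "\<pi>' permutes {1..k}" "\<And>i. \<pi> (\<pi>' i) = i" for g and \<pi> \<pi>' :: "nat \<Rightarrow> nat"
  proof
    fix i
    show "restrict (restrict (g \<circ> \<pi>) {1..k} \<circ> \<pi>') {1..k} i = g i"
      using that permutes_in_image[OF that(2), of i]
      by (auto simp: labellings_def PiE_def extensional_def restrict_def)
  qed
  show ?thesis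
  proof (rule sum.reindex_bij_witness[where j = "\<lambda>g. restrict (g \<circ> inv ?\<rho>) {1..k}"
        and i = "\<lambda>g. restrict (g \<circ> ?\<rho>) {1..k}"])
    fix g assume g: "g \<in> labellings k J"
    show "restrict (restrict (g \<circ> inv ?\<rho>) {1..k} \<circ> ?\<rho>) {1..k} = g"
      by (rule cancel[OF g \<rho>]) (simp add: permutes_inverses[OF \<rho>])
    show "restrict (restrict (g \<circ> ?\<rho>) {1..k} \<circ> inv ?\<rho>) {1..k} = g"
      by (rule cancel[OF g permutes_inv[OF \<rho>]]) (simp add: permutes_inverses[OF \<rho>])
    show "restrict (g \<circ> inv ?\<rho>) {1..k} \<in> labellings k J" "restrict (g \<circ> ?\<rho>) {1..k} \<in> labellings k J"
      by (rule bij[OF g permutes_inv[OF \<rho>]], rule bij[OF g \<rho>])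
    have "relabel (restrict (g \<circ> inv ?\<rho>) {1..k}) (perm_orders k (points_perm k z)) =
      relabel (g \<circ> inv ?\<rho>) (perm_orders k (points_perm k z))"
      by (rule relabel_cong[of "{1..k}"]) (auto simp: perm_orders_def order_pairs_def order_on_def)
    also have "\<dots> = relabel (g \<circ> inv ?\<rho>) (relabel ?\<rho> (sample_orders {1..k} z))"
      unfolding relabel_rank[OF x y] ..
    also have "\<dots> = relabel g (sample_orders {1..k} z)"
      unfolding relabel_comp
      by (rule relabel_cong[OF _ sample_orders_in]) (simp add: permutes_inverses[OF \<rho>])
    finally show "h (relabel (restrict (g \<circ> inv ?\<rho>) {1..k}) (perm_orders k (points_perm k z))) =
      h (relabel g (sample_orders {1..k} z))" by simp
  qed
qed

section \<open>Almost sure distinctness of the coordinates\<close>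

text \<open>By Fubini: with all points except the \<open>i\<close>-th fixed, a tie with the
  \<open>j\<close>-th means that the \<open>i\<close>-th point hits one given level of
  \<open>f\<close>, which is a null event.\<close>

lemma AE_distinct_values:
  fixes f :: "'a \<Rightarrow> real"
  assumes I: "finite I" and \<mu>: "prob_space \<mu>" and f[measurable]: "f \<in> borel_measurable \<mu>"
    and no_atom: "\<And>t. emeasure \<mu> {z \<in> space \<mu>. f z = t} = 0"
  shows "AE z in PiM I (\<lambda>_. \<mu>). inj_on (\<lambda>i. f (z i)) I"
proof -
  interpret product_sigma_finite "\<lambda>_. \<mu>"
    using \<mu> by (simp add: product_sigma_finite_def prob_space_imp_sigma_finite)
  have ne: "AE z in PiM I (\<lambda>_. \<mu>). f (z i) \<noteq> f (z j)" if ij: "i \<in> I" "j \<in> I" "i \<noteq> j" for i j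
  proof -
    let ?B = "{z \<in> space (PiM I (\<lambda>_. \<mu>)). f (z i) = f (z j)}"
    have [measurable]: "?B \<in> sets (PiM I (\<lambda>_. \<mu>))" using ij by measurable
    have ins: "insert i (I - {i}) = I" using ij by auto
    have "emeasure (PiM I (\<lambda>_. \<mu>)) ?B = (\<integral>\<^sup>+z. indicator ?B z \<partial>PiM (insert i (I - {i})) (\<lambda>_. \<mu>))"
      unfolding ins by simp
    also have "\<dots> = (\<integral>\<^sup>+x. (\<integral>\<^sup>+y. indicator ?B (x(i := y)) \<partial>\<mu>) \<partial>PiM (I - {i}) (\<lambda>_. \<mu>))"
    proof (rule product_nn_integral_insert)
      show "indicator ?B \<in> borel_measurable (PiM (insert i (I - {i})) (\<lambda>_. \<mu>))"
        unfolding ins by measurable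
    qed (use I in simp_all)
    also have "\<dots> = (\<integral>\<^sup>+x. 0 \<partial>PiM (I - {i}) (\<lambda>_. \<mu>))"
    proof (rule nn_integral_cong)
      fix x assume x: "x \<in> space (PiM (I - {i}) (\<lambda>_. \<mu>))"
      have "(\<integral>\<^sup>+y. indicator ?B (x(i := y)) \<partial>\<mu>) = (\<integral>\<^sup>+y. indicator {y \<in> space \<mu>. f y = f (x j)} y \<partial>\<mu>)"
      proof (rule nn_integral_cong)
        fix y assume "y \<in> space \<mu>"
        then have "x(i := y) \<in> space (PiM I (\<lambda>_. \<mu>))"
          using x ij by (auto simp: space_PiM PiE_def extensional_def)
        then show "indicator ?B (x(i := y)) = (indicator {y \<in> space \<mu>. f y = f (x j)} y :: ennreal)"
          using ij \<open>y \<in> space \<mu>\<close> by (simp add: indicator_def)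
      qed
      also have "\<dots> = 0" using no_atom by simp
      finally show "(\<integral>\<^sup>+y. indicator ?B (x(i := y)) \<partial>\<mu>) = 0" .
    qed
    finally show ?thesis by (intro AE_I[of _ _ ?B]) auto
  qed
  have "AE z in PiM I (\<lambda>_. \<mu>). \<forall>i\<in>I. \<forall>j\<in>I. i \<noteq> j \<longrightarrow> f (z i) \<noteq> f (z j)"
    using I ne by (simp add: AE_finite_all)
  then show ?thesis
    by (rule AE_mp) (auto intro!: AE_I2 simp: inj_on_def)
qed

lemma permuton_marginals:
  assumes "permuton \<mu>"
  shows "prob_space \<mu>" "sets \<mu> = sets borel" "space \<mu> = UNIV"
proof -
  show \<mu>: "prob_space \<mu>" "sets \<mu> = sets borel" using assms by (auto simp: permuton_def)
  show "space \<mu> = UNIV" using sets_eq_imp_space_eq[OF \<mu>(2)] by simp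
qed

lemma emeasure_permuton_strips:
  assumes "permuton \<mu>" and A: "A \<in> sets borel"
  shows "emeasure \<mu> {z. fst z \<in> A} = emeasure lborel ({0..1} \<inter> A)"
    and "emeasure \<mu> {z. snd z \<in> A} = emeasure lborel ({0..1} \<inter> A)"
proof -
  note \<mu> = permuton_marginals(1,2)[OF assms(1)] and sp = permuton_marginals(3)[OF assms(1)]
  have meas: "fst \<in> \<mu> \<rightarrow>\<^sub>M borel" "snd \<in> \<mu> \<rightarrow>\<^sub>M borel"
    by (simp_all add: measurable_cong_sets[OF \<mu>(2) refl])
  have "emeasure \<mu> {z. fst z \<in> A} = emeasure (distr \<mu> borel fst) A"
    using A meas sp by (subst emeasure_distr) (auto intro!: arg_cong[where f = "emeasure \<mu>"])
  also have "\<dots> = emeasure lborel ({0..1} \<inter> A)"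
    using assms A by (simp add: permuton_def emeasure_uniform_measure divide_ennreal_def)
  finally show "emeasure \<mu> {z. fst z \<in> A} = emeasure lborel ({0..1} \<inter> A)" .
  have "emeasure \<mu> {z. snd z \<in> A} = emeasure (distr \<mu> borel snd) A"
    using A meas sp by (subst emeasure_distr) (auto intro!: arg_cong[where f = "emeasure \<mu>"])
  also have "\<dots> = emeasure lborel ({0..1} \<inter> A)"
    using assms A by (simp add: permuton_def emeasure_uniform_measure divide_ennreal_def)
  finally show "emeasure \<mu> {z. snd z \<in> A} = emeasure lborel ({0..1} \<inter> A)" .
qed

text \<open>Expresses distinctness through the orders alone, which makes it a measurable event of
  the sample.\<close>

lemma inj_on_iff_order_on:
  "inj_on x I \<longleftrightarrow> (\<forall>i\<in>I. \<forall>j\<in>I. i \<noteq> j \<longrightarrow> (i, j) \<in> order_on I x \<or> (j, i) \<in> order_on I x)"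
proof -
  have "inj_on x I \<longleftrightarrow> (\<forall>i\<in>I. \<forall>j\<in>I. i \<noteq> j \<longrightarrow> x i \<noteq> x j)" by (auto simp: inj_on_def)
  then show ?thesis by (auto simp: order_on_def linorder_neq_iff)
qed

lemma permuton_AE_distinct:
  assumes "permuton \<mu>" "finite I"
  shows "AE z in PiM I (\<lambda>_. \<mu>). inj_on (\<lambda>i. fst (z i)) I \<and> inj_on (\<lambda>i. snd (z i)) I"
proof -
  note \<mu> = permuton_marginals(1-3)[OF assms(1)]
  have null: "emeasure lborel ({0..1} \<inter> {t}) = 0" for t :: real
    by (cases "t \<in> {0..1}") auto
  have "AE z in PiM I (\<lambda>_. \<mu>). inj_on (\<lambda>i. fst (z i)) I"
    using emeasure_permuton_strips(1)[OF assms(1), of "{_}"] null \<mu>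
    by (intro AE_distinct_values assms) (simp_all add: measurable_cong_sets[OF \<mu>(2) refl])
  moreover have "AE z in PiM I (\<lambda>_. \<mu>). inj_on (\<lambda>i. snd (z i)) I"
    using emeasure_permuton_strips(2)[OF assms(1), of "{_}"] null \<mu>
    by (intro AE_distinct_values assms) (simp_all add: measurable_cong_sets[OF \<mu>(2) refl])
  ultimately show ?thesis by auto
qed

section \<open>The random tree as a weighted sum over signed trees\<close>

fun erase_signs :: "(bool, 'l) btree \<Rightarrow> (unit, 'l) btree" where
  "erase_signs (Leaf x) = Leaf x"
| "erase_signs (Node s l r) = Node () (erase_signs l) (erase_signs r)"

lemma leaves_erase_signs: "leaves (erase_signs t) = leaves t"
  by (induction t) auto

lemma signings_Leaf: "{t'. erase_signs t' = Leaf x} = {Leaf x}"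
proof -
  have "erase_signs t' = Leaf x \<longleftrightarrow> t' = Leaf x" for t' :: "(bool, 'a) btree"
    by (cases t') auto
  then show ?thesis by auto
qed

lemma signings_Node:
  "{t'. erase_signs t' = Node u l r} =
    (\<lambda>(s, l', r'). Node s l' r') ` (UNIV \<times> {t'. erase_signs t' = l} \<times> {t'. erase_signs t' = r})"
proof -
  have "t' \<in> (\<lambda>(s, l', r'). Node s l' r') ` (UNIV \<times> {t'. erase_signs t' = l} \<times> {t'. erase_signs t' = r})"
    if "erase_signs t' = Node u l r" for t' :: "(bool, 'a) btree"
    using that by (cases t') (auto simp: image_iff)
  then show ?thesis by auto
qed

lemma expectation_bind_pmf_finite:
  fixes h :: "'b \<Rightarrow> real"
  assumes "finite (set_pmf q)" "\<And>x. x \<in> set_pmf q \<Longrightarrow> finite (set_pmf (f x))"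
  shows "measure_pmf.expectation (bind_pmf q f) h =
    measure_pmf.expectation q (\<lambda>x. measure_pmf.expectation (f x) h)"
  using assms
  by (subst pmf_expectation_bind[of "set_pmf q"])
    (auto simp: integral_measure_pmf[of "set_pmf q"] mult.commute)

lemma finite_set_random_signs: "finite (set_pmf (random_signs p t))"
  by (induction t) auto

lemma expectation_random_signs:
  fixes h :: "_ \<Rightarrow> real"
  assumes p: "0 < p" "p < 1"
  shows "measure_pmf.expectation (random_signs p t) h =
    (\<Sum>t' | erase_signs t' = t. sign_weight p t' * h t')"
proof (induction t arbitrary: h)
  case (Leaf x)
  then show ?case by (simp add: signings_Leaf)
next
  case (Node u l r)
  let ?A = "{t'. erase_signs t' = l}" and ?B = "{t'. erase_signs t' = r}"
  have "measure_pmf.expectation (random_signs p (Node u l r)) h =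
    measure_pmf.expectation (bernoulli_pmf p) (\<lambda>s. measure_pmf.expectation (random_signs p l)
      (\<lambda>l'. measure_pmf.expectation (random_signs p r) (\<lambda>r'. h (Node s l' r'))))"
    by (simp add: expectation_bind_pmf_finite finite_set_random_signs finite_subset[OF subset_UNIV])
  also have "\<dots> = (\<Sum>s\<in>UNIV. (if s then p else 1 - p) *
      (\<Sum>l'\<in>?A. sign_weight p l' * (\<Sum>r'\<in>?B. sign_weight p r' * h (Node s l' r'))))"
    unfolding Node.IH using p by (simp add: integral_measure_pmf[of UNIV] UNIV_bool)
  also have "\<dots> = (\<Sum>(s, l', r')\<in>UNIV \<times> ?A \<times> ?B. sign_weight p (Node s l' r') * h (Node s l' r'))"
    by (simp add: sum.cartesian_product[symmetric] sum_distrib_left algebra_simps)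
  also have "\<dots> = (\<Sum>t' | erase_signs t' = Node u l r. sign_weight p t' * h t')"
    unfolding signings_Node
    by (subst sum.reindex) (auto simp: inj_on_def case_prod_unfold)
  finally show ?case .
qed

text \<open>Polymorphic in the signs, so that it denotes both the shapes of
  \<open>random_tree\<close> (signs in \<open>unit\<close>) and the signed trees over them.\<close>

definition ordered_trees :: "nat \<Rightarrow> ('s, nat) btree set" where
  "ordered_trees k = {t. leaves t = [1..<Suc k]}"

lemma finite_ordered_signed_trees: "finite (ordered_trees k :: (bool, nat) btree set)"
  by (rule finite_subset[OF _ finite_labelled_trees[of "{1..<Suc k}"]])
    (auto simp: ordered_trees_def labelled_trees_def)

lemma erase_signs_ordered: "erase_signs ` ordered_trees k = ordered_trees k"
proof
  show "ordered_trees k \<subseteq> erase_signs ` ordered_trees k"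
  proof
    fix t :: "(unit, nat) btree" assume "t \<in> ordered_trees k"
    moreover have "erase_signs (map_btree (\<lambda>_. True) id t) = t"
      by (induction t) auto
    ultimately show "t \<in> erase_signs ` ordered_trees k"
      by (intro image_eqI[of _ _ "map_btree (\<lambda>_. True) id t"]) (auto simp: ordered_trees_def leaves_map)
  qed
qed (auto simp: ordered_trees_def leaves_erase_signs)

lemma ordered_trees_nonempty:
  assumes "k \<ge> 1"
  shows "ordered_trees k \<noteq> ({} :: (unit, nat) btree set)"
proof -
  have "\<exists>t :: (unit, nat) btree. leaves t = xs" if "xs \<noteq> []" for xs
    using that
  proof (induction xs rule: list_nonempty_induct)
    case (single x)
    show ?case by (rule exI[of _ "Leaf x"]) simp
  next
    case (cons x xs)
    then obtain t :: "(unit, nat) btree" where "leaves t = xs" by auto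
    then show ?case by (intro exI[of _ "Node () (Leaf x) t"]) simp
  qed
  from this[of "[1..<Suc k]"] assms show ?thesis by (auto simp: ordered_trees_def)
qed

text \<open>Grouping signed trees by shape. The constant is the number of shapes, but only its
  independence of \<open>h\<close> matters: it is eliminated later by taking a constant
  \<open>h\<close>.\<close>

lemma expectation_random_tree:
  assumes p: "0 < p" "p < 1" and k: "k \<ge> 1"
  shows "\<exists>c. \<forall>h :: _ \<Rightarrow> real. measure_pmf.expectation (random_tree k p) h =
    (\<Sum>t\<in>ordered_trees k. sign_weight p t * h t) / c"
proof (intro exI allI)
  fix h :: "_ \<Rightarrow> real"
  let ?T = "ordered_trees k :: (unit, nat) btree set"
  have fin: "finite ?T"
    unfolding erase_signs_ordered[symmetric] by (intro finite_imageI finite_ordered_signed_trees)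
  have ne: "?T \<noteq> {}" by (rule ordered_trees_nonempty[OF k])
  have "measure_pmf.expectation (random_tree k p) h =
    measure_pmf.expectation (pmf_of_set ?T) (\<lambda>t. measure_pmf.expectation (random_signs p t) h)"
    unfolding random_tree_def ordered_trees_def[symmetric]
    using fin ne by (intro expectation_bind_pmf_finite) (simp_all add: finite_set_random_signs)
  also have "\<dots> = (\<Sum>t\<in>?T. \<Sum>t' | erase_signs t' = t. sign_weight p t' * h t') / card ?T"
    using fin ne by (simp add: integral_pmf_of_set expectation_random_signs[OF p])
  also have "(\<Sum>t\<in>?T. \<Sum>t' | erase_signs t' = t. sign_weight p t' * h t') =
    (\<Sum>t\<in>?T. \<Sum>t' | t' \<in> ordered_trees k \<and> erase_signs t' = t. sign_weight p t' * h t')"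
    by (intro sum.cong) (auto simp: ordered_trees_def leaves_erase_signs)
  also have "\<dots> = (\<Sum>t\<in>ordered_trees k. sign_weight p t * h t)"
    using erase_signs_ordered[of k] by (intro sum.group fin finite_ordered_signed_trees) auto
  finally show "measure_pmf.expectation (random_tree k p) h =
    (\<Sum>t\<in>ordered_trees k. sign_weight p t * h t) / card ?T" .
qed

text \<open>A labelled tree amounts to a tree with leaves numbered from left to right, together with
  the labelling that sends each number to the label found at that position.\<close>

lemma sum_labelled_trees:
  fixes H :: "_ \<Rightarrow> real" and J :: "'a set"
  assumes J: "finite J" "card J = k"
  shows "(\<Sum>t\<in>labelled_trees J. sign_weight p t * H t) =
    (\<Sum>g\<in>labellings k J. \<Sum>t\<in>ordered_trees k. sign_weight p t * H (map_btree id g t))"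
proof -
  \<comment> \<open>\<open>?lab t\<close> reads the labels from left to right, with
    \<open>m - 1\<close> because lists are indexed from 0; \<open>?std\<close> undoes a
    labelling.\<close>
  let ?lab = "\<lambda>t. \<lambda>m\<in>{1..k}. leaves t ! (m - 1)"
  let ?std = "\<lambda>g. map_btree id (the_inv_into {1..k} g)"
  have upt: "map (\<lambda>m. xs ! (m - 1)) [1..<Suc (length xs)] = xs" for xs :: "'a list"
    by (rule nth_equalityI) (simp_all del: upt_Suc)
  have map_id: "map_btree id f (t :: (bool, 'c) btree) = t" if "\<And>x. x \<in> set (leaves t) \<Longrightarrow> f x = x" for f t
    using that by (induction t) auto
  have map_map: "map_btree id f (map_btree id g t) = map_btree id (f \<circ> g) t"
    for f :: "'d \<Rightarrow> 'e" and g :: "'c \<Rightarrow> 'd" and t :: "(bool, 'c) btree"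
    by (simp add: btree.map_comp)
  have "(\<Sum>t\<in>labelled_trees J. sign_weight p t * H t) =
    (\<Sum>(g, t)\<in>labellings k J \<times> ordered_trees k. sign_weight p t * H (map_btree id g t))"
  proof (rule sum.reindex_bij_witness[where j = "\<lambda>t. (?lab t, ?std (?lab t) t)"
        and i = "\<lambda>(g, t). map_btree id g t"])
    fix t :: "(bool, 'a) btree" assume t: "t \<in> labelled_trees J"
    then have dist: "distinct (leaves t)" and set: "set (leaves t) = J"
      and len: "length (leaves t) = k"
      using J distinct_card[of "leaves t"] by (auto simp: labelled_trees_def)
    have "bij_betw (\<lambda>m. leaves t ! (m - 1)) {1..k} J"
    proof -
      have "bij_betw (nth (leaves t)) {..<k} J"
        using dist len set by (auto intro: bij_betw_nth)
      moreover have "bij_betw (\<lambda>m. m - 1) {1..k} {..<k}"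
        by (rule bij_betwI[of _ _ _ Suc]) auto
      ultimately show ?thesis using bij_betw_trans by (auto simp: o_def)
    qed
    then have g: "?lab t \<in> labellings k J" by (rule restrict_in_labellings)
    then have inj: "inj_on (?lab t) {1..k}" and img: "?lab t ` {1..k} = J"
      by (auto simp: labellings_def bij_betw_def)
    have f: "?lab t (the_inv_into {1..k} (?lab t) x) = x" if "x \<in> J" for x
      using f_the_inv_into_f[OF inj] that img by simp
    show *: "(case (?lab t, ?std (?lab t) t) of (g, t) \<Rightarrow> map_btree id g t) = t"
      unfolding prod.case map_map by (rule map_id) (use f set in \<open>simp add: o_def\<close>)
    have "map (?lab t) [1..<Suc k] = map (\<lambda>m. leaves t ! (m - 1)) [1..<Suc k]"
      by (intro map_cong refl) auto
    then have "leaves t = map (?lab t) [1..<Suc k]"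
      using upt[of "leaves t"] unfolding len by metis
    then have "leaves (?std (?lab t) t) = map (the_inv_into {1..k} (?lab t) \<circ> ?lab t) [1..<Suc k]"
      unfolding leaves_map by (metis list.map_comp)
    also have "\<dots> = map (\<lambda>x. x) [1..<Suc k]"
    proof (intro map_cong refl)
      fix x assume "x \<in> set [1..<Suc k]"
      then have "x \<in> {1..k}" by auto
      then show "(the_inv_into {1..k} (?lab t) \<circ> ?lab t) x = x"
        unfolding o_apply by (rule the_inv_into_f_f[OF inj])
    qed
    finally have "?std (?lab t) t \<in> ordered_trees k" by (simp add: ordered_trees_def)
    then show "(?lab t, ?std (?lab t) t) \<in> labellings k J \<times> ordered_trees k" using g by simp
    show "(case (?lab t, ?std (?lab t) t) of (g, t) \<Rightarrow> sign_weight p t * H (map_btree id g t)) =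
      sign_weight p t * H t"
      using * by (simp add: sign_weight_map)
  next
    fix x assume x: "x \<in> labellings k J \<times> (ordered_trees k :: (bool, nat) btree set)"
    obtain g t where gt: "x = (g, t)" by (cases x)
    then have t: "leaves t = [1..<Suc k]" and g: "bij_betw g {1..k} J" "g \<in> {1..k} \<rightarrow>\<^sub>E J"
      using x by (auto simp: labellings_def ordered_trees_def)
    have inj: "inj_on g {1..k}" using g by (auto simp: bij_betw_def)
    have lab: "?lab (map_btree id g t) = g"
    proof
      fix m
      show "?lab (map_btree id g t) m = g m"
        using g(2) by (cases "m \<in> {1..k}")
          (auto simp: leaves_map t PiE_def extensional_def simp del: upt_Suc)
    qed
    show "(case x of (g, t) \<Rightarrow> map_btree id g t) \<in> labelled_trees J"
      using g inj by (simp add: gt labelled_trees_def leaves_map t distinct_map bij_betw_def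
          atLeastLessThanSuc_atLeastAtMost del: upt_Suc)
    have "?std g (map_btree id g t) = t"
      unfolding map_map
      by (rule map_id) (use t inj in \<open>auto simp: the_inv_into_f_f simp del: upt_Suc\<close>)
    then show "(?lab (case x of (g, t) \<Rightarrow> map_btree id g t),
        ?std (?lab (case x of (g, t) \<Rightarrow> map_btree id g t)) (case x of (g, t) \<Rightarrow> map_btree id g t)) = x"
      unfolding gt prod.case lab by simp
  qed
  then show ?thesis by (simp add: sum.cartesian_product)
qed

section \<open>Leaf orders and the permutation of a tree\<close>

definition position :: "'a list \<Rightarrow> 'a \<Rightarrow> nat" where
  "position xs x = length (takeWhile (\<lambda>y. y \<noteq> x) xs)"

lemma position_append:
  "position (xs @ ys) x = (if x \<in> set xs then position xs x else length xs + position ys x)"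
proof (cases "x \<in> set xs")
  case True
  then show ?thesis by (simp add: position_def takeWhile_append1[of x])
next
  case False
  then have "takeWhile (\<lambda>y. y \<noteq> x) (xs @ ys) = xs @ takeWhile (\<lambda>y. y \<noteq> x) ys"
    by (intro takeWhile_append2) auto
  then show ?thesis using False by (simp add: position_def)
qed

lemma position_less: "x \<in> set xs \<Longrightarrow> position xs x < length xs"
  by (induction xs) (auto simp: position_def)

lemma tree_order_position:
  assumes "distinct (leaves t)"
  shows "tree_order (\<lambda>_. True) t =
    {(i, j) \<in> set (leaves t) \<times> set (leaves t). position (leaves t) i < position (leaves t) j}"
  using assms
proof (induction t)
  case (Leaf x)
  then show ?case by auto
next
  case (Node s l r)
  have disj: "i \<in> set (leaves l) \<Longrightarrow> i \<notin> set (leaves r)" for i using Node.prems by auto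
  have lt: "i \<in> set (leaves l) \<Longrightarrow> position (leaves l) i < length (leaves l) + m" for i m
    using position_less[of i "leaves l"] by simp
  show ?case
  proof (rule set_eqI, clarify)
    fix i j
    show "(i, j) \<in> tree_order (\<lambda>_. True) (Node s l r) \<longleftrightarrow> (i, j) \<in> {(i, j) \<in> set (leaves (Node s l r)) \<times>
      set (leaves (Node s l r)). position (leaves (Node s l r)) i < position (leaves (Node s l r)) j}"
      using Node disj[of i] disj[of j] lt[of i] lt[of j, THEN less_imp_le]
      by (cases "i \<in> set (leaves l)"; cases "j \<in> set (leaves l)")
        (simp_all add: position_append not_less)
  qed
qed

lemma set_leaves_twist: "set (leaves (twist t)) = set (leaves t)"
  by (induction t) auto

lemma distinct_leaves_twist: "distinct (leaves t) \<Longrightarrow> distinct (leaves (twist t))"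
  by (induction t) (auto simp: set_leaves_twist)

lemma tree_order_twist: "tree_order (\<lambda>_. True) (twist t) = tree_order id t"
  by (induction t) (auto simp: set_leaves_twist)

text \<open>The leaves are numbered from left to right, which gives the first order; the value of
  \<open>tree_perm\<close> is one plus the position in the twisted tree, and the order of positions
  there is \<open>tree_order id t\<close>.\<close>

lemma perm_orders_tree_perm:
  assumes "t \<in> ordered_trees k"
  shows "perm_orders k (tree_perm t) = tree_orders t"
proof -
  have leaves: "leaves t = [1..<Suc k]" using assms by (simp add: ordered_trees_def)
  have set: "set (leaves t) = {1..k}" unfolding leaves by auto
  have dist: "distinct (leaves t)" unfolding leaves by simp
  have pos: "position [1..<Suc k] i = i - 1" if "i \<in> {1..k}" for i
  proof -
    have "[1..<Suc k] = [1..<i] @ [i..<Suc k]" using that upt_add_eq_append[of 1 i "Suc k - i"] by simp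
    moreover have "position [i..<Suc k] i = 0"
      using that by (subst upt_conv_Cons) (auto simp: position_def)
    ultimately show ?thesis by (simp add: position_append)
  qed
  have "position [1..<Suc k] i < position [1..<Suc k] j \<longleftrightarrow> real i < real j"
    if "i \<in> {1..k}" "j \<in> {1..k}" for i j
    unfolding pos[OF that(1)] pos[OF that(2)] using that by auto
  then have "order_on {1..k} real = tree_order (\<lambda>_. True) t"
    unfolding tree_order_position[OF dist] set unfolding leaves order_on_def by blast
  moreover have "order_on {1..k} (\<lambda>i. real (tree_perm t i)) = tree_order id t"
    unfolding tree_order_twist[symmetric] tree_order_position[OF distinct_leaves_twist[OF dist]]
      set_leaves_twist set
    by (auto simp: order_on_def tree_perm_def set position_def)
  ultimately show ?thesis by (simp add: perm_orders_def)
qed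

text \<open>Averaging over the labellings of \<open>J\<close> trades the permutation sampled from the permuton for
  the two orders of the sampled points.\<close>
lemma brownian_separable_orders:
  fixes h :: "_ \<Rightarrow> real" and J :: "nat set"
  assumes p: "0 < p" "p < 1" and P: "brownian_separable_law p P"
    and J: "finite J" "J \<noteq> {}"
  shows "(\<integral>z. h (sample_orders J z) \<partial>sample_law J P) =
    (\<Sum>t\<in>labelled_trees J. sign_weight p t * h (tree_orders t)) / tree_mass p J"
proof -
  interpret random_measure_law P
    using P by (intro random_measure_law.intro)
      (simp_all add: brownian_separable_law_def random_permuton_law_def)
  have permutons: "AE \<mu> in P. permuton \<mu>"
    using P by (simp add: brownian_separable_law_def random_permuton_law_def)
  define k where "k = card J"
  let ?I = "{1..k}" and ?L = "labellings k J"
  have k: "k \<ge> 1" using J by (simp add: k_def Suc_le_eq card_gt_0_iff)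
  have law: "distr (sample_law ?I P) (count_space UNIV) (points_perm k) =
    measure_pmf (map_pmf tree_perm (random_tree k p))"
    using P k by (simp add: brownian_separable_law_def subperm_law_def sample_law_def)
  interpret S: prob_space "sample_law ?I P" by (rule prob_space_sample_law) simp
  have sets_S: "sample_law ?I P \<rightarrow>\<^sub>M N = PiM ?I (\<lambda>_. borel) \<rightarrow>\<^sub>M N" for N :: "'x measure"
    by (intro measurable_cong_sets sets_sample_law) simp_all
  have orders_meas: "sample_orders ?I \<in> sample_law ?I P \<rightarrow>\<^sub>M count_space UNIV"
    unfolding sets_S by (rule measurable_sample_orders) simp
  have perm_meas: "points_perm k \<in> sample_law ?I P \<rightarrow>\<^sub>M count_space UNIV"
    unfolding sets_S by (rule points_perm_measurable)
  have distinct: "AE z in sample_law ?I P. inj_on (\<lambda>i. fst (z i)) ?I \<and> inj_on (\<lambda>i. snd (z i)) ?I"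
    unfolding sample_law_def
  proof (subst AE_bind[where B = "PiM ?I (\<lambda>_. borel)"])
    show "(\<lambda>\<mu>. PiM ?I (\<lambda>_. \<mu>)) \<in> P \<rightarrow>\<^sub>M subprob_algebra (PiM ?I (\<lambda>_. borel))"
      by (rule measurable_prob_algebraD[OF kernel]) simp
    show "Measurable.pred (PiM ?I (\<lambda>_. borel))
      (\<lambda>z. inj_on (\<lambda>i. fst (z i :: real \<times> real)) ?I \<and> inj_on (\<lambda>i. snd (z i)) ?I)"
    proof -
      let ?Q = "\<lambda>r. \<forall>i\<in>?I. \<forall>j\<in>?I. i \<noteq> j \<longrightarrow> ((i, j) \<in> fst r \<or> (j, i) \<in> fst r) \<and>
        ((i, j) \<in> snd r \<or> (j, i) \<in> snd r)"
      have *: "(\<lambda>z. inj_on (\<lambda>i. fst (z i :: real \<times> real)) ?I \<and> inj_on (\<lambda>i. snd (z i)) ?I) =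
        (\<lambda>z. ?Q (sample_orders ?I z))"
        unfolding inj_on_iff_order_on sample_orders_def fst_conv snd_conv by blast
      have "sample_orders ?I \<in> PiM ?I (\<lambda>_. borel) \<rightarrow>\<^sub>M count_space UNIV"
        by (rule measurable_sample_orders) simp
      then show ?thesis
        unfolding * by (rule measurable_compose) (rule measurable_count_space)
    qed
    show "AE \<mu> in P. AE z in PiM ?I (\<lambda>_. \<mu>). inj_on (\<lambda>i. fst (z i)) ?I \<and> inj_on (\<lambda>i. snd (z i)) ?I"
      using permutons by eventually_elim (rule permuton_AE_distinct; simp)
  qed
  obtain c where c: "\<And>h :: _ \<Rightarrow> real. measure_pmf.expectation (random_tree k p) h =
    (\<Sum>t\<in>ordered_trees k. sign_weight p t * h t) / c"
    using expectation_random_tree[OF p k] by auto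
  have L: "finite ?L" "?L \<noteq> {}"
    using finite_labellings labellings_nonempty J by (auto simp: k_def)
  have main: "real (card ?L) * (\<integral>z. h (sample_orders J z) \<partial>sample_law J P) =
    (\<Sum>t\<in>labelled_trees J. sign_weight p t * h (tree_orders t)) / c" for h :: "_ \<Rightarrow> real"
  proof -
    let ?G = "\<lambda>\<sigma>. \<Sum>g\<in>?L. h (relabel g (perm_orders k \<sigma>))"
    have "real (card ?L) * (\<integral>z. h (sample_orders J z) \<partial>sample_law J P) =
      (\<Sum>g\<in>?L. \<integral>y. h (relabel g (sample_orders ?I y)) \<partial>sample_law ?I P)"
    proof -
      have "(\<integral>y. h (relabel g (sample_orders ?I y)) \<partial>sample_law ?I P) =
        (\<integral>z. h (sample_orders J z) \<partial>sample_law J P)" if "g \<in> ?L" for g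
        using that by (intro sample_law_reindex[OF _ J(1), symmetric]) (simp add: labellings_def)
      then show ?thesis by simp
    qed
    also have "\<dots> = (\<integral>y. (\<Sum>g\<in>?L. h (relabel g (sample_orders ?I y))) \<partial>sample_law ?I P)"
    proof (rule Bochner_Integration.integral_sum[symmetric])
      show "integrable (sample_law ?I P) (\<lambda>y. h (relabel g (sample_orders ?I y)))" for g
        by (rule S.integrable_finite_range[OF orders_meas finite_order_pairs sample_orders_in]) simp
    qed
    \<comment> \<open>Passing from the points to their permutation requires distinct coordinates and
      therefore holds only almost everywhere.\<close>
    also have "\<dots> = (\<integral>y. ?G (points_perm k y) \<partial>sample_law ?I P)"
    proof (rule integral_cong_AE)
      show "(\<lambda>y. \<Sum>g\<in>?L. h (relabel g (sample_orders ?I y))) \<in> borel_measurable (sample_law ?I P)"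
        by (rule measurable_compose[OF orders_meas]) simp
      show "(\<lambda>y. ?G (points_perm k y)) \<in> borel_measurable (sample_law ?I P)"
        by (rule measurable_compose[OF perm_meas]) simp
      show "AE y in sample_law ?I P. (\<Sum>g\<in>?L. h (relabel g (sample_orders ?I y))) = ?G (points_perm k y)"
        using distinct by eventually_elim (rule sum_labellings; simp)
    qed
    also have "\<dots> = (\<integral>\<sigma>. ?G \<sigma> \<partial>distr (sample_law ?I P) (count_space UNIV) (points_perm k))"
      by (rule integral_distr[symmetric, OF perm_meas]) simp
    also have "\<dots> = measure_pmf.expectation (random_tree k p) (\<lambda>t. ?G (tree_perm t))"
      unfolding law by simp
    also have "\<dots> = (\<Sum>t\<in>ordered_trees k. sign_weight p t * ?G (tree_perm t)) / c" by (rule c)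
    also have "(\<Sum>t\<in>ordered_trees k. sign_weight p t * ?G (tree_perm t)) =
      (\<Sum>t\<in>ordered_trees k. \<Sum>g\<in>?L. sign_weight p t * h (tree_orders (map_btree id g t)))"
      by (intro sum.cong refl) (simp only: perm_orders_tree_perm tree_orders_map sum_distrib_left)
    also have "\<dots> = (\<Sum>t\<in>labelled_trees J. sign_weight p t * h (tree_orders t))"
      by (subst sum.swap) (rule sum_labelled_trees[symmetric, OF J(1)], simp add: k_def)
    finally show ?thesis .
  qed
  interpret SJ: prob_space "sample_law J P" by (rule prob_space_sample_law[OF J(1)])
  \<comment> \<open>A constant \<open>h\<close> evaluates the unknown ratio of the number of
    labellings and \<open>c\<close>, so that the tree mass becomes the only normalisation.\<close>
  have norm: "real (card ?L) = tree_mass p J / c"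
    using main[of "\<lambda>_. 1"] by (simp add: tree_mass_def SJ.prob_space)
  have "real (card ?L) \<noteq> 0" using L by simp
  then have "c \<noteq> 0" "tree_mass p J \<noteq> 0" using norm by auto
  then show ?thesis using main[of h] unfolding norm by (simp add: field_simps)
qed

section \<open>Uniqueness of the law of a random permuton\<close>

text \<open>The mean square deviation of an empirical frequency is at most \<open>1/n\<close>,
  because the centred indicators are orthogonal and bounded by 1. The bound in mean, with its
  explicit rate, does not depend on \<open>\<mu>\<close>, which is what mixing over a random
  permuton requires.\<close>

lemma expectation_empirical_deviation:
  assumes \<mu>: "prob_space \<mu>" and B[measurable]: "B \<in> sets \<mu>" and I: "finite I" "I \<noteq> {}"
  shows "(\<integral>z. \<bar>(\<Sum>i\<in>I. indicator B (z i)) / card I - measure \<mu> B\<bar> \<partial>PiM I (\<lambda>_. \<mu>)) \<le> 1 / sqrt (card I)"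
proof -
  interpret \<mu>: prob_space \<mu> by (rule \<mu>)
  interpret product_sigma_finite "\<lambda>_. \<mu>"
    using \<mu> by (simp add: product_sigma_finite_def prob_space_imp_sigma_finite)
  interpret S: prob_space "PiM I (\<lambda>_. \<mu>)" using \<mu> by (intro prob_space_PiM)
  define n where "n = card I"
  have n: "n > 0" using I by (simp add: n_def card_gt_0_iff)
  define m where "m = measure \<mu> B"
  have m: "0 \<le> m" "m \<le> 1" by (auto simp: m_def)
  define X where "X y = indicator B y - m" for y :: 'a
  have X1: "\<bar>X y\<bar> \<le> 1" for y using m by (auto simp: X_def indicator_def)
  have [measurable]: "X \<in> borel_measurable \<mu>" by (simp add: X_def[abs_def])
  have int_X: "integrable \<mu> X" using X1 by (intro \<mu>.integrable_const_bound[of _ 1]) auto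
  have "integrable \<mu> (indicator B :: 'a \<Rightarrow> real)"
    by (intro \<mu>.integrable_const_bound[of _ 1]) auto
  then have EX: "(\<integral>y. X y \<partial>\<mu>) = 0"
    by (simp add: X_def[abs_def] m_def \<mu>.prob_space)
  have comp[measurable]: "(\<lambda>z. X (z i)) \<in> borel_measurable (PiM I (\<lambda>_. \<mu>))" if "i \<in> I" for i
    using that by measurable
  have int_XX: "integrable (PiM I (\<lambda>_. \<mu>)) (\<lambda>z. X (z i) * X (z j))" if "i \<in> I" "j \<in> I" for i j
    using that mult_mono[OF X1 X1]
    by (intro S.integrable_const_bound[of _ 1]) (auto simp: abs_mult)
  have EXX: "(\<integral>z. X (z i) * X (z j) \<partial>PiM I (\<lambda>_. \<mu>)) \<le> (if i = j then 1 else 0)"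
    if ij: "i \<in> I" "j \<in> I" for i j
  proof (cases "i = j")
    case True
    have "(\<integral>z. X (z i) * X (z j) \<partial>PiM I (\<lambda>_. \<mu>)) \<le> (\<integral>z. 1 \<partial>PiM I (\<lambda>_. \<mu>))"
      using int_XX[OF ij] mult_mono[OF X1 X1]
      by (intro integral_mono) (auto intro: order_trans[OF abs_ge_self] simp: abs_mult)
    then show ?thesis using True by (simp add: S.prob_space)
  next
    case False
    \<comment> \<open>Factors 1 at all other indices turn the mixed moment into an integral of a
      full product, which factorises with two factors of mean 0.\<close>
    define f where "f l = (if l = i \<or> l = j then X else (\<lambda>_. 1))" for l
    have "(\<integral>z. X (z i) * X (z j) \<partial>PiM I (\<lambda>_. \<mu>)) = (\<integral>z. (\<Prod>l\<in>I. f l (z l)) \<partial>PiM I (\<lambda>_. \<mu>))"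
    proof (intro Bochner_Integration.integral_cong refl)
      fix z
      have "(\<Prod>l\<in>I. f l (z l)) = (\<Prod>l\<in>{i, j}. f l (z l))"
        using ij I by (intro prod.mono_neutral_right) (auto simp: f_def)
      then show "X (z i) * X (z j) = (\<Prod>l\<in>I. f l (z l))" using False by (simp add: f_def)
    qed
    also have "\<dots> = (\<Prod>l\<in>I. \<integral>y. f l y \<partial>\<mu>)"
      using I int_X by (intro product_integral_prod) (auto simp: f_def)
    also have "\<dots> = 0"
      using I ij EX by (intro prod_zero) (auto simp: f_def)
    finally show ?thesis using False by simp
  qed
  define D where "D z = (\<Sum>i\<in>I. indicator B (z i)) / n - m" for z :: "'b \<Rightarrow> 'a"
  have D: "D z = (\<Sum>i\<in>I. X (z i)) / n" for z
    using n by (simp add: D_def X_def sum_subtractf n_def[symmetric] field_simps)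
  have D2: "(D z)\<^sup>2 = (\<Sum>i\<in>I. \<Sum>j\<in>I. X (z i) * X (z j)) / n\<^sup>2" for z
    by (simp add: D power2_eq_square sum_product)
  have int_D2: "integrable (PiM I (\<lambda>_. \<mu>)) (\<lambda>z. (D z)\<^sup>2)"
    unfolding D2 by (intro Bochner_Integration.integrable_divide Bochner_Integration.integrable_sum int_XX) auto
  have "(\<integral>z. (D z)\<^sup>2 \<partial>PiM I (\<lambda>_. \<mu>)) =
    (\<Sum>i\<in>I. \<Sum>j\<in>I. \<integral>z. X (z i) * X (z j) \<partial>PiM I (\<lambda>_. \<mu>)) / n\<^sup>2"
    unfolding D2 using int_XX by simp
  also have "\<dots> \<le> (\<Sum>i\<in>I. \<Sum>j\<in>I. if i = j then 1 else 0) / n\<^sup>2"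
    using EXX by (intro divide_right_mono sum_mono) auto
  also have "\<dots> = 1 / n"
    using I n by (simp add: n_def[symmetric] power2_eq_square)
  finally have ED2: "(\<integral>z. (D z)\<^sup>2 \<partial>PiM I (\<lambda>_. \<mu>)) \<le> 1 / n" .
  have s: "sqrt n > 0" using n by simp
  \<comment> \<open>The inequality of means bounds \<open>\<bar>D z\<bar>\<close> by its square; the
    scaling by \<open>sqrt n\<close> balances the two terms, since the square has mean at most
    \<open>1/n\<close>.\<close>
  have "(\<integral>z. \<bar>D z\<bar> \<partial>PiM I (\<lambda>_. \<mu>)) \<le> (\<integral>z. (sqrt n * (D z)\<^sup>2 + 1 / sqrt n) / 2 \<partial>PiM I (\<lambda>_. \<mu>))"
  proof (rule integral_mono')
    show "integrable (PiM I (\<lambda>_. \<mu>)) (\<lambda>z. (sqrt n * (D z)\<^sup>2 + 1 / sqrt n) / 2)"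
      using int_D2 by simp
    fix z
    have "0 \<le> (sqrt n * \<bar>D z\<bar> - 1)\<^sup>2 / sqrt n" using s by simp
    also have "\<dots> = sqrt n * (D z)\<^sup>2 + 1 / sqrt n - 2 * \<bar>D z\<bar>"
      using s by (simp add: power2_eq_square field_simps)
    finally show "\<bar>D z\<bar> \<le> (sqrt n * (D z)\<^sup>2 + 1 / sqrt n) / 2" by simp
  qed simp
  also have "\<dots> = (sqrt n * (\<integral>z. (D z)\<^sup>2 \<partial>PiM I (\<lambda>_. \<mu>)) + 1 / sqrt n) / 2"
    using int_D2 by (simp add: S.prob_space)
  also have "\<dots> \<le> (sqrt n * (1 / n) + 1 / sqrt n) / 2"
    using ED2 s by (intro divide_right_mono add_right_mono mult_left_mono) auto
  also have "\<dots> = 1 / sqrt n"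
    using n by (simp add: real_div_sqrt field_simps)
  finally show ?thesis by (simp add: D_def n_def m_def)
qed

section \<open>Distribution functions estimated from ranks\<close>

text \<open>Nested sets differ in exactly as many elements as their cardinalities do, and
  intersecting with \<open>B\<close> cannot increase this difference.\<close>

lemma card_Int_nested:
  assumes "finite A" "finite L" "A \<subseteq> L \<or> L \<subseteq> A"
  shows "\<bar>real (card (A \<inter> B)) - real (card (L \<inter> B))\<bar> \<le> \<bar>real (card A) - real (card L)\<bar>"
proof -
  have *: "\<bar>real (card (A \<inter> B)) - real (card (L \<inter> B))\<bar> \<le> \<bar>real (card A) - real (card L)\<bar>"
    if "finite L" "A \<subseteq> L" for A L
  proof -
    have fin: "finite A" using that finite_subset by auto
    have "card (L \<inter> B) - card (A \<inter> B) = card (L \<inter> B - A \<inter> B)"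
      using that fin by (intro card_Diff_subset[symmetric]) auto
    also have "\<dots> \<le> card (L - A)" using that by (intro card_mono) auto
    also have "\<dots> = card L - card A" using that fin by (intro card_Diff_subset) auto
    finally have "card (L \<inter> B) - card (A \<inter> B) \<le> card L - card A" .
    moreover have "card (A \<inter> B) \<le> card (L \<inter> B)" "card A \<le> card L"
      using that by (auto intro!: card_mono)
    ultimately show ?thesis by simp
  qed
  show ?thesis
    using assms *[of L A] *[of A L] by (auto simp: abs_minus_commute)
qed

text \<open>The substitute, computable from an order alone, for the points with coordinate at most
  \<open>t\<close>: the marginals are uniform, so rank divided by sample size approximates the
  coordinate.\<close>

definition low_ranks :: "'i set \<Rightarrow> real \<Rightarrow> ('i \<times> 'i) set \<Rightarrow> 'i set" where
  "low_ranks I t r = {i \<in> I. real (card {j \<in> I. (j, i) \<in> r}) < t * real (card I)}"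

text \<open>The distribution function of the uniform law on the unit interval.\<close>

definition clamp01 :: "real \<Rightarrow> real" where
  "clamp01 t = max 0 (min 1 t)"

text \<open>Distinct values have the ranks \<open>0, ..., n - 1\<close>, each once, so the count is
  \<open>t * n\<close> rounded up and cut off at 0 and \<open>n\<close>; the error 1 is the
  rounding.\<close>

lemma card_low_ranks:
  assumes "finite I" "inj_on x I"
  shows "\<bar>card (low_ranks I t (order_on I x)) - card I * clamp01 t\<bar> \<le> 1"
proof -
  let ?n = "card I"
  let ?\<rho> = "\<lambda>i. card {l \<in> I. x l < x i}"
  have eq: "low_ranks I t (order_on I x) = {i \<in> I. ?\<rho> i < t * ?n}"
    by (auto simp: low_ranks_def order_on_def intro!: arg_cong[where f = card] elim!: back_subst[of "\<lambda>k. real k < t * ?n"])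
  have bij: "bij_betw ?\<rho> I {..<?n}" by (rule bij_betw_card_less[OF assms])
  have "?\<rho> ` {i \<in> I. real (?\<rho> i) < t * ?n} = {m \<in> ?\<rho> ` I. real m < t * ?n}" by auto
  also have "?\<rho> ` I = {..<?n}" using bij by (simp add: bij_betw_def)
  finally have img: "?\<rho> ` {i \<in> I. real (?\<rho> i) < t * ?n} = {m \<in> {..<?n}. real m < t * ?n}" .
  have "inj_on ?\<rho> {i \<in> I. real (?\<rho> i) < t * ?n}"
    using bij_betw_imp_inj_on[OF bij] by (rule inj_on_subset) auto
  from card_image[OF this] have card: "card (low_ranks I t (order_on I x)) = card {m \<in> {..<?n}. real m < t * ?n}"
    unfolding eq img by simp
  consider "t \<le> 0" | "t \<ge> 1" | "0 < t" "t < 1" by linarith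
  then show ?thesis
  proof cases
    case 1
    then have "t * ?n \<le> 0" by (simp add: mult_nonpos_nonneg)
    then have "{m \<in> {..<?n}. real m < t * ?n} = {}"
      by (auto simp: not_less intro: order_trans)
    then have "card (low_ranks I t (order_on I x)) = 0" unfolding card by (simp only: card.empty)
    then show ?thesis using 1 by (simp add: clamp01_def)
  next
    case 2
    have "{m \<in> {..<?n}. real m < t * ?n} = {..<?n}"
    proof -
      have "real m < t * ?n" if "m < ?n" for m
      proof -
        have "real m < 1 * real ?n" using that by simp
        also have "\<dots> \<le> t * ?n" using 2 by (intro mult_right_mono) auto
        finally show ?thesis .
      qed
      then show ?thesis by auto
    qed
    then have "card (low_ranks I t (order_on I x)) = ?n" unfolding card by (simp only: card_lessThan)
    then show ?thesis using 2 by (simp add: clamp01_def)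
  next
    case 3
    have le: "t * ?n \<le> ?n" using 3 mult_right_mono[of t 1 "real ?n"] by simp
    have "{m \<in> {..<?n}. real m < t * ?n} = {..<nat \<lceil>t * ?n\<rceil>}"
    proof (intro set_eqI iffI)
      fix m assume "m \<in> {m \<in> {..<?n}. real m < t * ?n}"
      then show "m \<in> {..<nat \<lceil>t * ?n\<rceil>}" by (simp add: zless_nat_eq_int_zless less_ceiling_iff)
    next
      fix m assume "m \<in> {..<nat \<lceil>t * ?n\<rceil>}"
      then have "real m < t * ?n" by (simp add: zless_nat_eq_int_zless less_ceiling_iff)
      then show "m \<in> {m \<in> {..<?n}. real m < t * ?n}" using le by simp
    qed
    then have "card (low_ranks I t (order_on I x)) = nat \<lceil>t * ?n\<rceil>"
      unfolding card by (simp only: card_lessThan)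
    moreover have "0 \<le> t * ?n" using 3 by simp
    ultimately show ?thesis using 3 by (simp add: clamp01_def mult.commute) linarith
  qed
qed

text \<open>Both sets are initial segments of the order by \<open>x\<close>, and initial segments
  are comparable.\<close>

lemma low_ranks_nested:
  assumes "finite I"
  shows "low_ranks I t (order_on I x) \<subseteq> {i \<in> I. x i \<le> s} \<or> {i \<in> I. x i \<le> s} \<subseteq> low_ranks I t (order_on I x)"
proof (rule ccontr)
  assume "\<not> ?thesis"
  then obtain i j where i: "i \<in> low_ranks I t (order_on I x)" "i \<in> I" "\<not> x i \<le> s"
    and j: "j \<in> I" "x j \<le> s" "j \<notin> low_ranks I t (order_on I x)"
    by (auto simp: low_ranks_def)
  have "card {l \<in> I. (l, j) \<in> order_on I x} \<le> card {l \<in> I. (l, i) \<in> order_on I x}"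
    using assms i j by (intro card_mono) (auto simp: order_on_def)
  then show False using i j by (simp add: low_ranks_def)
qed

text \<open>An estimator of the mass of \<open>{..q}\<close>, the quadrant below and to the left of
  \<open>q\<close> in the componentwise order, that uses only the two orders of the sample.\<close>

definition order_cdf :: "'i set \<Rightarrow> real \<times> real \<Rightarrow> ('i \<times> 'i) set \<times> ('i \<times> 'i) set \<Rightarrow> real" where
  "order_cdf I q r = real (card (low_ranks I (fst q) (fst r) \<inter> low_ranks I (snd q) (snd r))) / real (card I)"

text \<open>The two rank segments are exchanged for the two value segments one at a time. By
  nestedness each exchange costs at most the deviation of an empirical marginal from the uniform
  law, plus \<open>1/n\<close> for rounding.\<close>

lemma order_cdf_approx:
  fixes z :: "'i \<Rightarrow> real \<times> real"
  assumes I: "finite I" "I \<noteq> {}" and x: "inj_on (\<lambda>i. fst (z i)) I" and y: "inj_on (\<lambda>i. snd (z i)) I"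
  shows "\<bar>order_cdf I q (sample_orders I z) - (\<Sum>i\<in>I. indicator {..q} (z i)) / card I\<bar> \<le>
    \<bar>(\<Sum>i\<in>I. indicator {z. fst z \<le> fst q} (z i)) / card I - clamp01 (fst q)\<bar> +
    \<bar>(\<Sum>i\<in>I. indicator {z. snd z \<le> snd q} (z i)) / card I - clamp01 (snd q)\<bar> + 2 / card I"
proof -
  let ?n = "real (card I)"
  have n: "?n > 0" using I by (simp add: card_gt_0_iff)
  let ?A = "low_ranks I (fst q) (order_on I (\<lambda>i. fst (z i)))"
    and ?B = "low_ranks I (snd q) (order_on I (\<lambda>i. snd (z i)))"
  let ?L = "{i \<in> I. fst (z i) \<le> fst q}" and ?M = "{i \<in> I. snd (z i) \<le> snd q}"
  have sums: "(\<Sum>i\<in>I. indicator {z. fst z \<le> fst q} (z i)) = real (card ?L)"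
    "(\<Sum>i\<in>I. indicator {z. snd z \<le> snd q} (z i)) = real (card ?M)"
    "(\<Sum>i\<in>I. indicator {..q} (z i)) = real (card (?L \<inter> ?M))"
    using I(1) by (auto simp: indicator_def sum.If_cases less_eq_prod_def Int_def intro!: arg_cong[where f = card])
  have fin: "finite ?A" "finite ?B" "finite ?L" "finite ?M"
    using I by (auto simp: low_ranks_def)
  have "\<bar>real (card (?A \<inter> ?B)) - real (card (?L \<inter> ?M))\<bar> \<le>
    \<bar>real (card (?A \<inter> ?B)) - real (card (?L \<inter> ?B))\<bar> + \<bar>real (card (?B \<inter> ?L)) - real (card (?M \<inter> ?L))\<bar>"
    by (simp add: Int_commute)
  also have "\<dots> \<le> \<bar>real (card ?A) - real (card ?L)\<bar> + \<bar>real (card ?B) - real (card ?M)\<bar>"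
    using fin by (intro add_mono card_Int_nested low_ranks_nested I)
  also have "\<dots> \<le> (1 + \<bar>card ?L - ?n * clamp01 (fst q)\<bar>) + (1 + \<bar>card ?M - ?n * clamp01 (snd q)\<bar>)"
    using card_low_ranks[OF I(1) x, of "fst q"] card_low_ranks[OF I(1) y, of "snd q"] by linarith
  finally have "\<bar>real (card (?A \<inter> ?B)) - real (card (?L \<inter> ?M))\<bar> / ?n \<le>
    (\<bar>card ?L - ?n * clamp01 (fst q)\<bar> + \<bar>card ?M - ?n * clamp01 (snd q)\<bar> + 2) / ?n"
    using n by (intro divide_right_mono) auto
  also have "\<dots> = \<bar>card ?L / ?n - clamp01 (fst q)\<bar> + \<bar>card ?M / ?n - clamp01 (snd q)\<bar> + 2 / ?n"
  proof -
    have "\<bar>a - ?n * b\<bar> / ?n = \<bar>a / ?n - b\<bar>" for a b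
    proof -
      have "a / ?n - b = (a - ?n * b) / ?n" using n by (simp add: field_simps)
      then show ?thesis using n by (simp add: abs_divide)
    qed
    then show ?thesis by (simp add: add_divide_distrib)
  qed
  also have "\<bar>real (card (?A \<inter> ?B)) - real (card (?L \<inter> ?M))\<bar> / ?n =
    \<bar>card (?A \<inter> ?B) / ?n - card (?L \<inter> ?M) / ?n\<bar>"
    using n by (simp add: diff_divide_distrib[symmetric])
  finally show ?thesis
    unfolding sums by (simp add: order_cdf_def sample_orders_def)
qed

lemma measure_permuton_half_planes:
  assumes "permuton \<mu>"
  shows "measure \<mu> {z. fst z \<le> t} = clamp01 t" "measure \<mu> {z. snd z \<le> t} = clamp01 t"
proof -
  have "emeasure lborel ({0..1} \<inter> {..t}) = ennreal (clamp01 t)"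
  proof (cases "t < 0")
    case True
    then have "{0..1} \<inter> {..t} = {}" by auto
    then show ?thesis using True by (simp add: clamp01_def)
  next
    case False
    then have "{0..1} \<inter> {..t} = {0..min 1 t}" by auto
    then show ?thesis using False by (simp add: clamp01_def)
  qed
  then have "emeasure \<mu> {z. fst z \<le> t} = ennreal (clamp01 t)" "emeasure \<mu> {z. snd z \<le> t} = ennreal (clamp01 t)"
    using emeasure_permuton_strips[OF assms, of "{..t}"] by simp_all
  then show "measure \<mu> {z. fst z \<le> t} = clamp01 t" "measure \<mu> {z. snd z \<le> t} = clamp01 t"
    using max.cobounded1[of 0 "min 1 t"] by (simp_all add: measure_def clamp01_def[symmetric])
qed

text \<open>The constant 5 collects three empirical deviations of \<open>1 / sqrt n\<close> each
  (two half-planes and the quadrant) and the rounding term \<open>2/n\<close>, which is at most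
  \<open>2 / sqrt n\<close>.\<close>

lemma expectation_order_cdf:
  fixes I :: "'i set"
  assumes \<mu>: "permuton \<mu>" and I: "finite I" "I \<noteq> {}"
  shows "(\<integral>z. \<bar>order_cdf I q (sample_orders I z) - measure \<mu> {..q}\<bar> \<partial>PiM I (\<lambda>_. \<mu>)) \<le> 5 / sqrt (card I)"
proof -
  note \<mu>' = permuton_marginals[OF \<mu>]
  interpret S: prob_space "PiM I (\<lambda>_. \<mu>)" using \<mu>' by (intro prob_space_PiM)
  let ?S = "PiM I (\<lambda>_. \<mu>)" and ?n = "real (card I)"
  have n: "?n \<ge> 1" using I by (simp add: Suc_le_eq card_gt_0_iff)
  let ?E = "\<lambda>B z. (\<Sum>i\<in>I. indicator B (z i)) / ?n"
  have sets[measurable]: "{z. fst z \<le> fst q} \<in> sets \<mu>" "{z. snd z \<le> snd q} \<in> sets \<mu>" "{..q} \<in> sets \<mu>"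
    unfolding \<mu>'(2) by measurable
  have orders: "sample_orders I \<in> ?S \<rightarrow>\<^sub>M count_space UNIV"
    using measurable_sample_orders[OF I(1)] \<mu>'
    by (simp add: measurable_cong_sets[OF sets_PiM_cong[OF refl] refl, of I "\<lambda>_. \<mu>" "\<lambda>_. borel"])
  have [measurable]: "(\<lambda>z. order_cdf I q (sample_orders I z)) \<in> borel_measurable ?S"
    by (rule measurable_compose[OF orders]) simp
  have int_cdf: "integrable ?S (\<lambda>z. order_cdf I q (sample_orders I z))"
    by (rule S.integrable_finite_range[OF orders finite_order_pairs[OF I(1)] sample_orders_in])
  have meas_E[measurable]: "?E B \<in> borel_measurable ?S" if [measurable]: "B \<in> sets \<mu>" for B
    by measurable
  have int_E: "integrable ?S (?E B)" if [measurable]: "B \<in> sets \<mu>" for B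
  proof (rule S.integrable_const_bound[of _ 1])
    have "(\<Sum>i\<in>I. indicator B (z i)) \<le> (\<Sum>i\<in>I. 1 :: real)" for z
      by (intro sum_mono) (simp add: indicator_def)
    then show "AE z in ?S. norm (?E B z) \<le> 1"
      using n by (intro AE_I2) (simp add: sum_nonneg)
  qed measurable
  have dev: "(\<integral>z. \<bar>?E B z - measure \<mu> B\<bar> \<partial>?S) \<le> 1 / sqrt ?n" if "B \<in> sets \<mu>" for B
    by (rule expectation_empirical_deviation[OF \<mu>'(1) that I])
  note half = measure_permuton_half_planes[OF \<mu>]
  let ?R = "\<lambda>z. \<bar>?E {z. fst z \<le> fst q} z - measure \<mu> {z. fst z \<le> fst q}\<bar> +
    \<bar>?E {z. snd z \<le> snd q} z - measure \<mu> {z. snd z \<le> snd q}\<bar> + \<bar>?E {..q} z - measure \<mu> {..q}\<bar> + 2 / ?n"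
  have "(\<integral>z. \<bar>order_cdf I q (sample_orders I z) - measure \<mu> {..q}\<bar> \<partial>?S) \<le> (\<integral>z. ?R z \<partial>?S)"
  proof (rule integral_mono_AE)
    show "integrable ?S (\<lambda>z. \<bar>order_cdf I q (sample_orders I z) - measure \<mu> {..q}\<bar>)"
      using int_cdf by simp
    show "integrable ?S ?R" using int_E sets by simp
    show "AE z in ?S. \<bar>order_cdf I q (sample_orders I z) - measure \<mu> {..q}\<bar> \<le> ?R z"
      using permuton_AE_distinct[OF \<mu> I(1)]
    proof eventually_elim
      case (elim z)
      then show ?case
        unfolding half using order_cdf_approx[OF I conjunct1[OF elim] conjunct2[OF elim], of q]
        by linarith
    qed
  qed
  also have "\<dots> = (\<integral>z. \<bar>?E {z. fst z \<le> fst q} z - measure \<mu> {z. fst z \<le> fst q}\<bar> \<partial>?S) +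
    (\<integral>z. \<bar>?E {z. snd z \<le> snd q} z - measure \<mu> {z. snd z \<le> snd q}\<bar> \<partial>?S) +
    (\<integral>z. \<bar>?E {..q} z - measure \<mu> {..q}\<bar> \<partial>?S) + 2 / ?n"
    using int_E sets by (simp add: S.prob_space)
  also have "\<dots> \<le> 1 / sqrt ?n + 1 / sqrt ?n + 1 / sqrt ?n + 2 / sqrt ?n"
  proof (intro add_mono dev sets)
    have "sqrt ?n \<le> ?n" using n by (simp add: real_sqrt_le_iff sqrt_le_D real_le_lsqrt power2_eq_square)
    then show "2 / ?n \<le> 2 / sqrt ?n" using n by (intro divide_left_mono) auto
  qed
  finally show ?thesis by simp
qed

section \<open>Uniqueness of the law through ramp functions\<close>

text \<open>\<open>S\<close> is a list of constraints \<open>F q \<le> c\<close>, and this is their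
  total violation. Unlike the indicator of the constraints it depends continuously on
  \<open>F\<close>, so it tolerates the error of the rank estimate.\<close>

definition cdf_excess :: "((real \<times> real) \<times> real) set \<Rightarrow> (real \<times> real \<Rightarrow> real) \<Rightarrow> real" where
  "cdf_excess S F = (\<Sum>(q, c)\<in>S. max 0 (F q - c))"

lemma cdf_excess_nonneg: "0 \<le> cdf_excess S F"
  by (auto simp: cdf_excess_def intro!: sum_nonneg)

lemma cdf_excess_eq_0_iff:
  "finite S \<Longrightarrow> cdf_excess S F = 0 \<longleftrightarrow> (\<forall>(q, c)\<in>S. F q \<le> c)"
  unfolding cdf_excess_def case_prod_unfold
  by (subst sum_nonneg_eq_0_iff) (auto simp: max_def split: if_splits)

lemma cdf_excess_diff: "\<bar>cdf_excess S F - cdf_excess S F'\<bar> \<le> (\<Sum>(q, c)\<in>S. \<bar>F q - F' q\<bar>)"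
  unfolding cdf_excess_def sum_subtractf[symmetric]
  by (rule order_trans[OF sum_abs]) (auto intro!: sum_mono)

lemma ramp_lipschitz:
  fixes s t m :: real
  assumes "0 \<le> m"
  shows "\<bar>max 0 (1 - m * s) - max 0 (1 - m * t)\<bar> \<le> m * \<bar>s - t\<bar>"
proof -
  have "\<bar>max 0 (1 - m * s) - max 0 (1 - m * t)\<bar> \<le> \<bar>m * s - m * t\<bar>" by linarith
  also have "\<dots> = m * \<bar>s - t\<bar>" using assms by (simp add: right_diff_distrib[symmetric] abs_mult)
  finally show ?thesis .
qed

locale random_permuton = random_measure_law +
  assumes permutons: "AE \<mu> in P. permuton \<mu>"
begin

lemma cdf_measurable [measurable]: "(\<lambda>\<mu>. measure \<mu> {..q}) \<in> borel_measurable P"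
  unfolding measurable_cong_sets[OF sets_P refl] by (rule measurable_measure_prob_algebra) simp

lemma cdf_excess_measurable [measurable]:
  "(\<lambda>\<mu>. cdf_excess S (\<lambda>q. measure \<mu> {..q})) \<in> borel_measurable P"
  unfolding cdf_excess_def case_prod_unfold by measurable

text \<open>The ramp is a Lipschitz function, with constant \<open>m\<close>, of the values of the
  distribution function at the finitely many points of \<open>S\<close>. Each of these is estimated
  by the orders with mean error \<open>5 / sqrt n\<close>, whatever the permuton.\<close>

lemma expectation_ramp_approx:
  fixes m :: real
  assumes S: "finite S" and m: "0 \<le> m" and I: "finite I" "I \<noteq> {}"
  shows "\<bar>(\<integral>\<mu>. max 0 (1 - m * cdf_excess S (\<lambda>q. measure \<mu> {..q})) \<partial>P) -
    (\<integral>z. max 0 (1 - m * cdf_excess S (\<lambda>q. order_cdf I q (sample_orders I z))) \<partial>sample_law I P)\<bar>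
    \<le> m * (card S * (5 / sqrt (card I)))"
proof -
  let ?\<phi> = "\<lambda>F. max 0 (1 - m * cdf_excess S F)"
  let ?h = "\<lambda>r. ?\<phi> (\<lambda>q. order_cdf I q r)"
  let ?G = "\<lambda>\<mu>. ?\<phi> (\<lambda>q. measure \<mu> {..q})"
  have \<phi>: "0 \<le> ?\<phi> F" "?\<phi> F \<le> 1" for F
    using m cdf_excess_nonneg[of S F] by auto
  have int_G: "integrable P ?G"
    using \<phi> by (intro P.integrable_const_bound[of _ 1]) (auto simp del: max.bounded_iff)
  have meas_H: "(\<lambda>\<mu>. \<integral>z. ?h (sample_orders I z) \<partial>PiM I (\<lambda>_. \<mu>)) \<in> borel_measurable P"
  proof -
    have "(\<lambda>z. ?h (sample_orders I z)) \<in> borel_measurable (PiM I (\<lambda>_. borel))"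
      by (rule measurable_compose[OF measurable_sample_orders[OF I(1)]]) simp
    from measurable_compose[OF measurable_prob_algebraD[OF kernel[OF I(1)]]
        integral_measurable_subprob_algebra[OF this]]
    show ?thesis .
  qed
  have close: "\<bar>?G \<mu> - (\<integral>z. ?h (sample_orders I z) \<partial>PiM I (\<lambda>_. \<mu>))\<bar> \<le> m * (card S * (5 / sqrt (card I)))"
    if \<mu>: "permuton \<mu>" for \<mu>
  proof -
    note \<mu>' = permuton_marginals[OF \<mu>]
    interpret N: prob_space "PiM I (\<lambda>_. \<mu>)" using \<mu>' by (intro prob_space_PiM)
    have orders: "sample_orders I \<in> PiM I (\<lambda>_. \<mu>) \<rightarrow>\<^sub>M count_space UNIV"
      using measurable_sample_orders[OF I(1)] \<mu>'
      by (simp add: measurable_cong_sets[OF sets_PiM_cong[OF refl] refl, of I "\<lambda>_. \<mu>" "\<lambda>_. borel"])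
    have int: "integrable (PiM I (\<lambda>_. \<mu>)) (\<lambda>z. k (sample_orders I z))" for k :: "_ \<Rightarrow> real"
      by (rule N.integrable_finite_range[OF orders finite_order_pairs[OF I(1)] sample_orders_in])
    have "\<bar>?G \<mu> - (\<integral>z. ?h (sample_orders I z) \<partial>PiM I (\<lambda>_. \<mu>))\<bar> =
      \<bar>\<integral>z. (?G \<mu> - ?h (sample_orders I z)) \<partial>PiM I (\<lambda>_. \<mu>)\<bar>"
      using int[of ?h] by (simp add: N.prob_space)
    also have "\<dots> \<le> (\<integral>z. \<bar>?G \<mu> - ?h (sample_orders I z)\<bar> \<partial>PiM I (\<lambda>_. \<mu>))"
      by (rule integral_abs_bound)
    also have "\<dots> \<le> (\<integral>z. m * (\<Sum>(q, c)\<in>S. \<bar>order_cdf I q (sample_orders I z) - measure \<mu> {..q}\<bar>)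
      \<partial>PiM I (\<lambda>_. \<mu>))"
    proof (rule integral_mono)
      show "integrable (PiM I (\<lambda>_. \<mu>)) (\<lambda>z. \<bar>?G \<mu> - ?h (sample_orders I z)\<bar>)"
        by (rule int[of "\<lambda>r. \<bar>?G \<mu> - ?h r\<bar>"])
      show "integrable (PiM I (\<lambda>_. \<mu>))
        (\<lambda>z. m * (\<Sum>(q, c)\<in>S. \<bar>order_cdf I q (sample_orders I z) - measure \<mu> {..q}\<bar>))"
        by (rule int[of "\<lambda>r. m * (\<Sum>(q, c)\<in>S. \<bar>order_cdf I q r - measure \<mu> {..q}\<bar>)"])
      fix z
      show "\<bar>?G \<mu> - ?h (sample_orders I z)\<bar> \<le>
        m * (\<Sum>(q, c)\<in>S. \<bar>order_cdf I q (sample_orders I z) - measure \<mu> {..q}\<bar>)"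
        using cdf_excess_diff[of S "\<lambda>q. measure \<mu> {..q}" "\<lambda>q. order_cdf I q (sample_orders I z)"]
        by (intro order_trans[OF ramp_lipschitz[OF m]] mult_left_mono m)
          (simp add: abs_minus_commute)
    qed
    also have "\<dots> = m * (\<Sum>(q, c)\<in>S. \<integral>z. \<bar>order_cdf I q (sample_orders I z) - measure \<mu> {..q}\<bar> \<partial>PiM I (\<lambda>_. \<mu>))"
      using int[of "\<lambda>r. \<bar>order_cdf I _ r - measure \<mu> {.._}\<bar>"] by (simp add: case_prod_unfold)
    also have "\<dots> \<le> m * (\<Sum>(q, c)\<in>S. 5 / sqrt (card I))"
      using expectation_order_cdf[OF \<mu> I] by (intro mult_left_mono sum_mono m) auto
    finally show ?thesis by (simp add: case_prod_unfold)
  qed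
  have int_H: "integrable P (\<lambda>\<mu>. \<integral>z. ?h (sample_orders I z) \<partial>PiM I (\<lambda>_. \<mu>))"
  proof (rule P.integrable_const_bound[of _ 1])
    show "AE \<mu> in P. norm (\<integral>z. ?h (sample_orders I z) \<partial>PiM I (\<lambda>_. \<mu>)) \<le> 1"
      using permutons
    proof eventually_elim
      case (elim \<mu>)
      interpret N: prob_space "PiM I (\<lambda>_. \<mu>)" using permuton_marginals[OF elim] by (intro prob_space_PiM)
      have "\<bar>\<integral>z. ?h (sample_orders I z) \<partial>PiM I (\<lambda>_. \<mu>)\<bar> \<le> (\<integral>z. \<bar>?h (sample_orders I z)\<bar> \<partial>PiM I (\<lambda>_. \<mu>))"
        by (rule integral_abs_bound)
      also have "\<dots> \<le> (\<integral>z. 1 \<partial>PiM I (\<lambda>_. \<mu>))"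
        using \<phi> by (intro integral_mono') (simp_all del: max.bounded_iff)
      finally show ?case by (simp add: N.prob_space)
    qed
  qed (rule meas_H)
  have "\<bar>(\<integral>\<mu>. ?G \<mu> \<partial>P) - (\<integral>z. ?h (sample_orders I z) \<partial>sample_law I P)\<bar> =
    \<bar>\<integral>\<mu>. (?G \<mu> - (\<integral>z. ?h (sample_orders I z) \<partial>PiM I (\<lambda>_. \<mu>))) \<partial>P\<bar>"
    using integral_sample_law[OF I(1), of ?h] int_G int_H by simp
  also have "\<dots> \<le> (\<integral>\<mu>. \<bar>?G \<mu> - (\<integral>z. ?h (sample_orders I z) \<partial>PiM I (\<lambda>_. \<mu>))\<bar> \<partial>P)"
    by (rule integral_abs_bound)
  also have "\<dots> \<le> (\<integral>\<mu>. m * (card S * (5 / sqrt (card I))) \<partial>P)"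
  proof (rule integral_mono_AE)
    show "AE \<mu> in P. \<bar>?G \<mu> - (\<integral>z. ?h (sample_orders I z) \<partial>PiM I (\<lambda>_. \<mu>))\<bar> \<le> m * (card S * (5 / sqrt (card I)))"
      using permutons by eventually_elim (rule close)
  qed (use int_G int_H in simp_all)
  finally show ?thesis by (simp add: P.prob_space)
qed

text \<open>As the slope grows, the ramps decrease to the indicator of zero excess, that is, of all
  constraints being met; they are dominated by 1.\<close>

lemma ramp_tendsto_prob:
  assumes S: "finite S"
  shows "(\<lambda>m. \<integral>\<mu>. max 0 (1 - real m * cdf_excess S (\<lambda>q. measure \<mu> {..q})) \<partial>P) \<longlonglongrightarrow>
    measure P {\<mu> \<in> space P. \<forall>(q, c)\<in>S. measure \<mu> {..q} \<le> c}"
proof -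
  let ?B = "{\<mu> \<in> space P. cdf_excess S (\<lambda>q. measure \<mu> {..q}) = 0}"
  have B: "?B \<in> sets P" by measurable
  have "(\<lambda>m. \<integral>\<mu>. max 0 (1 - real m * cdf_excess S (\<lambda>q. measure \<mu> {..q})) \<partial>P) \<longlonglongrightarrow> (\<integral>\<mu>. indicator ?B \<mu> \<partial>P)"
  proof (rule integral_dominated_convergence[where w = "\<lambda>_. 1"])
    show "AE \<mu> in P. (\<lambda>m. max 0 (1 - real m * cdf_excess S (\<lambda>q. measure \<mu> {..q}))) \<longlonglongrightarrow> indicator ?B \<mu>"
    proof (rule AE_I2)
      fix \<mu> assume \<mu>: "\<mu> \<in> space P"
      let ?e = "cdf_excess S (\<lambda>q. measure \<mu> {..q})"
      show "(\<lambda>m. max 0 (1 - real m * ?e)) \<longlonglongrightarrow> indicator ?B \<mu>"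
      proof (cases "?e = 0")
        case True
        then show ?thesis using \<mu> by simp
      next
        case False
        then have e: "?e > 0" using cdf_excess_nonneg[of S] by (simp add: less_le)
        have "eventually (\<lambda>m. max 0 (1 - real m * ?e) = 0) sequentially"
          using eventually_ge_at_top[of "nat \<lceil>1 / ?e\<rceil>"]
        proof eventually_elim
          case (elim m)
          then have "1 / ?e \<le> real m" by linarith
          then show ?case using e by (simp add: pos_divide_le_eq)
        qed
        then show ?thesis using False by (simp add: tendsto_eventually)
      qed
    qed
    show "AE \<mu> in P. norm (max 0 (1 - real m * cdf_excess S (\<lambda>q. measure \<mu> {..q}))) \<le> 1" for m
      using cdf_excess_nonneg[of S] by (intro AE_I2) auto
    show "indicator ?B \<in> borel_measurable P" using B by simp
    show "(\<lambda>\<mu>. max 0 (1 - real m * cdf_excess S (\<lambda>q. measure \<mu> {..q}))) \<in> borel_measurable P" for m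
      by measurable
  qed simp
  moreover have "?B = {\<mu> \<in> space P. \<forall>(q, c)\<in>S. measure \<mu> {..q} \<le> c}"
    using cdf_excess_eq_0_iff[OF S] by auto
  moreover have "(\<integral>\<mu>. indicator ?B \<mu> \<partial>P) = measure P ?B"
    unfolding Bochner_Integration.integral_indicator by (intro arg_cong[where f = "measure P"]) auto
  ultimately show ?thesis by (simp only:)
qed

end

text \<open>Quadrants are stable under intersection and generate the Borel sets of the plane, so
  evaluations at quadrants suffice for measurability. Allowing finitely many constraints at a time
  makes the generator itself stable under intersection, as the uniqueness of measures
  demands.\<close>

lemma sets_prob_algebra_cdf:
  fixes E
  defines "E \<equiv> {{\<mu> \<in> space (prob_algebra borel). \<forall>(q, c)\<in>S. measure \<mu> {..q} \<le> c} | S ::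
    ((real \<times> real) \<times> real) set. finite S}"
  shows "sets (prob_algebra borel) = sigma_sets (space (prob_algebra borel)) E"
proof
  let ?\<Omega> = "space (prob_algebra (borel :: (real \<times> real) measure))"
  have E: "E \<subseteq> Pow ?\<Omega>" by (auto simp: E_def)
  have "E \<subseteq> sets (prob_algebra borel)"
  proof
    fix A assume "A \<in> E"
    then obtain S where S: "finite S" "A = {\<mu> \<in> ?\<Omega>. \<forall>(q, c)\<in>S. measure \<mu> {..q} \<le> c}"
      by (auto simp: E_def)
    have [measurable]: "(\<lambda>\<mu>. measure \<mu> {..q}) \<in> borel_measurable (prob_algebra borel)" for q :: "real \<times> real"
      by (rule measurable_measure_prob_algebra) simp
    show "A \<in> sets (prob_algebra borel)"
      unfolding S(2) case_prod_unfold using S(1) by measurable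
  qed
  then show "sigma_sets ?\<Omega> E \<subseteq> sets (prob_algebra borel)" by (rule sets.sigma_sets_subset)
  have "(\<lambda>\<mu>. \<mu>) \<in> sigma ?\<Omega> E \<rightarrow>\<^sub>M prob_algebra borel"
  proof (rule measurable_prob_algebra_generated)
    show "sets borel = sigma_sets UNIV (range (\<lambda>q :: real \<times> real. {..q}))"
      by (subst borel_eq_atMost) simp
    show "Int_stable (range (\<lambda>q :: real \<times> real. {..q}))"
    proof (rule Int_stableI)
      fix A B :: "(real \<times> real) set" assume "A \<in> range atMost" "B \<in> range atMost"
      then obtain a b where "A = {..a}" "B = {..b}" by auto
      then have "A \<inter> B = {..inf a b}" by (intro set_eqI) simp
      then show "A \<inter> B \<in> range atMost" by simp
    qed
    fix \<mu> assume "\<mu> \<in> space (sigma ?\<Omega> E)"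
    then show "prob_space \<mu>" "sets \<mu> = sets borel"
      using E by (auto simp: space_measure_of_conv space_prob_algebra)
  next
    fix A assume "A \<in> range (\<lambda>q :: real \<times> real. {..q})"
    then obtain q where A: "A = {..q}" by auto
    have "(\<lambda>\<mu>. measure \<mu> {..q}) \<in> borel_measurable (sigma ?\<Omega> E)"
      unfolding borel_measurable_iff_le
    proof
      fix c
      have "{\<mu> \<in> ?\<Omega>. \<forall>(q, c)\<in>{(q, c)}. measure \<mu> {..q} \<le> c} \<in> E"
        unfolding E_def by blast
      then show "{\<mu> \<in> space (sigma ?\<Omega> E). measure \<mu> {..q} \<le> c} \<in> sets (sigma ?\<Omega> E)"
        using E by (auto simp: space_measure_of_conv intro!: sigma_sets.Basic)
    qed
    then have "(\<lambda>\<mu>. ennreal (measure \<mu> {..q})) \<in> borel_measurable (sigma ?\<Omega> E)" by measurable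
    then show "(\<lambda>\<mu>. emeasure \<mu> A) \<in> borel_measurable (sigma ?\<Omega> E)"
      by (rule measurable_cong[THEN iffD1, rotated])
        (use E in \<open>auto simp: A space_measure_of_conv space_prob_algebra
          intro!: finite_measure.emeasure_eq_measure[symmetric] prob_space.finite_measure\<close>)
  qed simp
  note id_measurable = this
  show "sets (prob_algebra borel) \<subseteq> sigma_sets ?\<Omega> E"
  proof
    fix A :: "(real \<times> real) measure set" assume A: "A \<in> sets (prob_algebra borel)"
    have "(\<lambda>\<mu>. \<mu>) -` A \<inter> space (sigma ?\<Omega> E) \<in> sets (sigma ?\<Omega> E)"
      by (rule measurable_sets[OF id_measurable A])
    moreover have "(\<lambda>\<mu>. \<mu>) -` A \<inter> space (sigma ?\<Omega> E) = A"
      using sets.sets_into_space[OF A] by (auto simp: space_measure_of_conv)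
    ultimately show "A \<in> sigma_sets ?\<Omega> E" using E by simp
  qed
qed

text \<open>For a fixed slope \<open>m\<close> the ramp expectations under \<open>P\<close> and
  \<open>Q\<close> are both close to the same functional of the orders of \<open>n\<close> points,
  so letting \<open>n\<close> grow makes them equal. Only then does \<open>m\<close> tend to
  infinity, which identifies the probabilities of a generator.\<close>

theorem random_permuton_eqI:
  fixes P Q :: "(real \<times> real) measure measure"
  assumes P: "random_permuton P" and Q: "random_permuton Q"
    and eq: "\<And>(k :: nat) (h :: _ \<Rightarrow> real). k \<ge> 1 \<Longrightarrow> (\<integral>z. h (sample_orders {1..k} z) \<partial>sample_law {1..k} P) =
      (\<integral>z. h (sample_orders {1..k} z) \<partial>sample_law {1..k} Q)"
  shows "P = Q"
proof -
  interpret P: random_permuton P by (rule P)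
  interpret Q: random_permuton Q by (rule Q)
  let ?\<Omega> = "space (prob_algebra (borel :: (real \<times> real) measure))"
  define E where "E = {{\<mu> \<in> ?\<Omega>. \<forall>(q, c)\<in>S. measure \<mu> {..q} \<le> c} | S ::
    ((real \<times> real) \<times> real) set. finite S}"
  have ramp: "(\<integral>\<mu>. max 0 (1 - m * cdf_excess S (\<lambda>q. measure \<mu> {..q})) \<partial>P) =
    (\<integral>\<mu>. max 0 (1 - m * cdf_excess S (\<lambda>q. measure \<mu> {..q})) \<partial>Q)" (is "?a = ?b")
    if S: "finite S" and m: "0 \<le> m" for S and m :: real
  proof -
    \<comment> \<open>Twice the estimation error, once for each law; \<open>Suc n\<close> keeps the
      sample nonempty.\<close>
    have lim: "(\<lambda>n. 2 * (m * (card S * (5 * inverse (sqrt (real (Suc n))))))) \<longlonglongrightarrow> 2 * (m * (real (card S) * (5 * 0)))"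
      by (intro tendsto_mult_left tendsto_inverse_0_at_top filterlim_compose[OF sqrt_at_top]
          filterlim_compose[OF filterlim_real_sequentially] filterlim_Suc)
    have bound: "\<bar>?a - ?b\<bar> \<le> 2 * (m * (card S * (5 * inverse (sqrt (real (Suc n))))))" for n
      using P.expectation_ramp_approx[OF S m, of "{1..Suc n}"] Q.expectation_ramp_approx[OF S m, of "{1..Suc n}"]
        eq[of "Suc n" "\<lambda>r. max 0 (1 - m * cdf_excess S (\<lambda>q. order_cdf {1..Suc n} q r))"]
      by (simp add: divide_inverse)
    have "\<bar>?a - ?b\<bar> \<le> 2 * (m * (real (card S) * (5 * 0)))"
      by (rule LIMSEQ_le_const[OF lim]) (use bound in blast)
    then show ?thesis by simp
  qed
  show ?thesis
  proof (rule measure_eqI_generator_eq[where \<Omega> = ?\<Omega> and E = E and A = "\<lambda>_. ?\<Omega>"])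
    show "Int_stable E"
    proof (rule Int_stableI)
      fix A B assume "A \<in> E" "B \<in> E"
      then obtain S T where "finite S" "A = {\<mu> \<in> ?\<Omega>. \<forall>(q, c)\<in>S. measure \<mu> {..q} \<le> c}"
        "finite T" "B = {\<mu> \<in> ?\<Omega>. \<forall>(q, c)\<in>T. measure \<mu> {..q} \<le> c}" by (auto simp: E_def)
      then have "finite (S \<union> T)" "A \<inter> B = {\<mu> \<in> ?\<Omega>. \<forall>(q, c)\<in>S \<union> T. measure \<mu> {..q} \<le> c}" by auto
      then show "A \<inter> B \<in> E" unfolding E_def by blast
    qed
    show "E \<subseteq> Pow ?\<Omega>" by (auto simp: E_def)
    show "sets P = sigma_sets ?\<Omega> E" "sets Q = sigma_sets ?\<Omega> E"
      using P.sets_P Q.sets_P sets_prob_algebra_cdf by (simp_all add: E_def)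
    \<comment> \<open>The empty set of constraints puts the whole space into the generator.\<close>
    have "?\<Omega> = {\<mu> \<in> ?\<Omega>. \<forall>(q, c)\<in>{}. measure \<mu> {..q} \<le> c}" by simp
    then show "range (\<lambda>_ :: nat. ?\<Omega>) \<subseteq> E" unfolding E_def by blast
    show "emeasure P ?\<Omega> \<noteq> \<infinity>" by simp
    fix A assume "A \<in> E"
    then obtain S where S: "finite S" "A = {\<mu> \<in> ?\<Omega>. \<forall>(q, c)\<in>S. measure \<mu> {..q} \<le> c}"
      by (auto simp: E_def)
    have "measure P A = measure Q A"
    proof (rule LIMSEQ_unique)
      show "(\<lambda>m. \<integral>\<mu>. max 0 (1 - real m * cdf_excess S (\<lambda>q. measure \<mu> {..q})) \<partial>P) \<longlonglongrightarrow> measure P A"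
        using P.ramp_tendsto_prob[OF S(1)] by (simp add: S(2) P.space_P)
      show "(\<lambda>m. \<integral>\<mu>. max 0 (1 - real m * cdf_excess S (\<lambda>q. measure \<mu> {..q})) \<partial>P) \<longlonglongrightarrow> measure Q A"
        using Q.ramp_tendsto_prob[OF S(1)] ramp[OF S(1)] by (simp add: S(2) Q.space_P)
    qed
    then show "emeasure P A = emeasure Q A"
      by (simp add: P.P.emeasure_eq_measure Q.P.emeasure_eq_measure)
  qed simp
qed

section \<open>Moments of the Dirichlet law\<close>

text \<open>Substituting \<open>y = L * u\<close> in the Beta integral produces the exponent
  \<open>(a - 1) + (b - 1) + 1\<close> of \<open>L\<close>. With \<open>L = 1 - x\<close> it is the
  inner integral over the simplex.\<close>

lemma nn_integral_Beta_scaled: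
  fixes a b L :: real
  assumes a: "a > 0" and b: "b > 0" and L: "L > 0"
  shows "(\<integral>\<^sup>+y. ennreal (if 0 < y \<and> y < L then y powr (a - 1) * (L - y) powr (b - 1) else 0) \<partial>lborel) =
    ennreal (L powr (a + b - 1) * Beta a b)"
proof -
  let ?f = "\<lambda>y. y powr (a - 1) * (L - y) powr (b - 1)"
  have beta: "(\<integral>\<^sup>+u. ennreal (u powr (a - 1) * (1 - u) powr (b - 1)) * indicator {0<..<1} u \<partial>lborel) =
    ennreal (Beta a b)"
    using has_integral_Beta_real[OF a b]
    by (intro nn_integral_has_integral_lebesgue') (auto simp: has_integral_Icc_iff_Ioo)
  have "(\<integral>\<^sup>+y. ennreal (if 0 < y \<and> y < L then ?f y else 0) \<partial>lborel) =
    ennreal \<bar>L\<bar> * (\<integral>\<^sup>+u. ennreal (if 0 < 0 + L * u \<and> 0 + L * u < L then ?f (0 + L * u) else 0) \<partial>lborel)"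
    using L by (intro nn_integral_real_affine) auto
  also have "(\<integral>\<^sup>+u. ennreal (if 0 < 0 + L * u \<and> 0 + L * u < L then ?f (0 + L * u) else 0) \<partial>lborel) =
    (\<integral>\<^sup>+u. ennreal (L powr (a + b - 2)) * (ennreal (u powr (a - 1) * (1 - u) powr (b - 1)) * indicator {0<..<1} u) \<partial>lborel)"
  proof (intro nn_integral_cong)
    fix u :: real
    show "ennreal (if 0 < 0 + L * u \<and> 0 + L * u < L then ?f (0 + L * u) else 0) =
      ennreal (L powr (a + b - 2)) * (ennreal (u powr (a - 1) * (1 - u) powr (b - 1)) * indicator {0<..<1} u)"
    proof (cases "0 < u \<and> u < 1")
      case True
      have "L - L * u = L * (1 - u)" by (simp add: algebra_simps)
      then have "?f (L * u) = L powr (a - 1) * L powr (b - 1) * (u powr (a - 1) * (1 - u) powr (b - 1))"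
        using True L by (simp add: powr_mult)
      also have "L powr (a - 1) * L powr (b - 1) = L powr (a + b - 2)"
        by (simp add: powr_add[symmetric] algebra_simps)
      finally show ?thesis
        using True L by (simp add: ennreal_mult'[symmetric])
    next
      case False
      then have "\<not> (0 < L * u \<and> L * u < L)" using L by (simp add: zero_less_mult_iff)
      then show ?thesis using False by auto
    qed
  qed
  also have "\<dots> = ennreal (L powr (a + b - 2)) * ennreal (Beta a b)"
    by (subst nn_integral_cmult) (simp_all add: beta)
  also have "ennreal \<bar>L\<bar> * \<dots> = ennreal (L * L powr (a + b - 2) * Beta a b)"
    using L by (simp add: ennreal_mult'[symmetric] mult.assoc)
  also have "L * L powr (a + b - 2) = L powr (a + b - 1)"
    using L powr_add[of L 1 "a + b - 2"] by (simp add: algebra_simps)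
  finally show ?thesis .
qed

text \<open>Kept without its normalising constant, so that multiplication by a monomial merely
  shifts the parameters.\<close>

definition dirichlet_density :: "real \<Rightarrow> real \<Rightarrow> real \<Rightarrow> real \<times> real \<Rightarrow> real" where
  "dirichlet_density a b c = (\<lambda>(x, y). if 0 < x \<and> 0 < y \<and> x + y < 1
     then x powr (a - 1) * y powr (b - 1) * (1 - x - y) powr (c - 1) else 0)"

lemma dirichlet_density_measurable [measurable]: "dirichlet_density a b c \<in> borel_measurable borel"
proof -
  have "dirichlet_density a b c = (\<lambda>z. if 0 < fst z \<and> 0 < snd z \<and> fst z + snd z < 1
     then fst z powr (a - 1) * snd z powr (b - 1) * (1 - fst z - snd z) powr (c - 1) else 0)"
    by (auto simp: dirichlet_density_def)
  then show ?thesis by simp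
qed

text \<open>The inner integral is a scaled Beta integral, the outer one an ordinary one, and
  \<open>Gamma (b + c)\<close> cancels in \<open>Beta a (b + c) * Beta b c\<close>.\<close>

lemma nn_integral_Dirichlet:
  assumes a: "a > 0" and b: "b > 0" and c: "c > 0"
  shows "(\<integral>\<^sup>+z. ennreal (dirichlet_density a b c z) \<partial>lborel) =
    ennreal (Gamma a * Gamma b * Gamma c / Gamma (a + b + c))"
proof -
  have "(\<integral>\<^sup>+z. ennreal (dirichlet_density a b c z) \<partial>lborel) =
    (\<integral>\<^sup>+x. \<integral>\<^sup>+y. ennreal (dirichlet_density a b c (x, y)) \<partial>lborel \<partial>lborel)"
    unfolding lborel_prod[symmetric]
    by (rule lborel.nn_integral_fst[symmetric]) (simp add: lborel_prod)
  also have "\<dots> = (\<integral>\<^sup>+x. ennreal (if 0 < x \<and> x < 1 then x powr (a - 1) * (1 - x) powr (b + c - 1) else 0) *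
      ennreal (Beta b c) \<partial>lborel)"
  proof (intro nn_integral_cong)
    fix x :: real
    show "(\<integral>\<^sup>+y. ennreal (dirichlet_density a b c (x, y)) \<partial>lborel) =
      ennreal (if 0 < x \<and> x < 1 then x powr (a - 1) * (1 - x) powr (b + c - 1) else 0) * ennreal (Beta b c)"
    proof (cases "0 < x \<and> x < 1")
      case True
      have "(\<integral>\<^sup>+y. ennreal (dirichlet_density a b c (x, y)) \<partial>lborel) =
        (\<integral>\<^sup>+y. ennreal (x powr (a - 1)) *
          ennreal (if 0 < y \<and> y < 1 - x then y powr (b - 1) * ((1 - x) - y) powr (c - 1) else 0) \<partial>lborel)"
        using True by (intro nn_integral_cong)
          (auto simp: dirichlet_density_def ennreal_mult'[symmetric] mult.assoc)
      also have "\<dots> = ennreal (x powr (a - 1)) * ennreal ((1 - x) powr (b + c - 1) * Beta b c)"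
        using True by (subst nn_integral_cmult) (simp_all add: nn_integral_Beta_scaled[OF b c])
      finally show ?thesis using True by (simp add: ennreal_mult'[symmetric] mult.assoc)
    next
      case False
      then have "dirichlet_density a b c (x, y) = 0" for y by (auto simp: dirichlet_density_def)
      then show ?thesis using False by auto
    qed
  qed
  also have "\<dots> = ennreal (Beta a (b + c)) * ennreal (Beta b c)"
    using nn_integral_Beta_scaled[of a "b + c" 1] a b c by (subst nn_integral_multc) simp_all
  also have "\<dots> = ennreal (Beta a (b + c) * Beta b c)"
    using a b c by (subst ennreal_mult'') (simp_all add: Beta_def Gamma_real_pos less_imp_le)
  also have "Beta a (b + c) * Beta b c = Gamma a * Gamma b * Gamma c / Gamma (a + b + c)"
  proof -
    have "Gamma (b + c) > 0" using b c by (intro Gamma_real_pos) simp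
    then show ?thesis by (simp add: Beta_def add.assoc)
  qed
  finally show ?thesis .
qed

lemma Gamma_add_nat: "a > 0 \<Longrightarrow> Gamma (a + real n) = pochhammer a n * Gamma (a :: real)"
  using pochhammer_Gamma[of a n] Gamma_real_pos[of a]
  by (simp add: field_simps nonpos_Ints_def) (metis Gamma_real_pos less_numeral_extra(3) nonzero_eq_divide_eq)

lemma nn_integral_dirichlet3:
  assumes a: "a > 0" and b: "b > 0" and c: "c > 0"
    and [measurable]: "f \<in> borel_measurable borel"
  shows "(\<integral>\<^sup>+w. f w \<partial>dirichlet3 a b c) =
    (\<integral>\<^sup>+z. ennreal (Gamma (a + b + c) / (Gamma a * Gamma b * Gamma c)) *
      ennreal (dirichlet_density a b c z) * f (fst z, snd z, 1 - fst z - snd z) \<partial>lborel)"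
proof -
  let ?C = "Gamma (a + b + c) / (Gamma a * Gamma b * Gamma c)"
  have C: "?C \<ge> 0" using a b c by (simp add: Gamma_real_pos less_imp_le)
  have "(\<lambda>(x, y). ennreal (if 0 < x \<and> 0 < y \<and> x + y < 1
      then ?C * (x powr (a - 1) * y powr (b - 1) * (1 - x - y) powr (c - 1)) else 0)) =
    (\<lambda>z. ennreal (?C * dirichlet_density a b c z))"
    by (auto simp: dirichlet_density_def)
  then have "dirichlet3 a b c = distr (density lborel (\<lambda>z. ennreal (?C * dirichlet_density a b c z))) borel
    (\<lambda>(x, y). (x, y, 1 - x - y))"
    by (simp add: dirichlet3_def)
  also have "(\<lambda>(x, y). (x, y, 1 - x - y)) = (\<lambda>z :: real \<times> real. (fst z, snd z, 1 - fst z - snd z))"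
    by auto
  finally have eq: "dirichlet3 a b c = distr (density lborel (\<lambda>z. ennreal (?C * dirichlet_density a b c z))) borel
    (\<lambda>z :: real \<times> real. (fst z, snd z, 1 - fst z - snd z))" .
  have [measurable]: "(\<lambda>z :: real \<times> real. (fst z, snd z, 1 - fst z - snd z)) \<in> borel \<rightarrow>\<^sub>M borel"
    by (intro borel_measurable_continuous_onI continuous_intros)
  have "ennreal (?C * dirichlet_density a b c z) = ennreal ?C * ennreal (dirichlet_density a b c z)" for z
    by (rule ennreal_mult'[OF C])
  then show ?thesis
    unfolding eq by (simp only:) (simp add: nn_integral_distr nn_integral_density)
qed

text \<open>The monomial raises the parameters by \<open>k\<close>, \<open>l\<close> and
  \<open>m\<close>, and the quotient of the two normalising constants consists of Gamma quotients,
  which are rising factorials.\<close>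

lemma nn_integral_dirichlet3_moment:
  assumes a: "a > 0" and b: "b > 0" and c: "c > 0"
  shows "(\<integral>\<^sup>+(x, y, z). ennreal (x ^ k * y ^ l * z ^ m) \<partial>dirichlet3 a b c) =
    ennreal (pochhammer a k * pochhammer b l * pochhammer c m / pochhammer (a + b + c) (k + l + m))"
proof -
  let ?C = "Gamma (a + b + c) / (Gamma a * Gamma b * Gamma c)"
  have C: "?C \<ge> 0" using a b c by (simp add: Gamma_real_pos less_imp_le)
  have meas: "(\<lambda>(x, y, z). ennreal (x ^ k * y ^ l * z ^ m)) \<in> borel_measurable borel"
    unfolding case_prod_unfold
    by (intro measurable_compose[OF _ measurable_ennreal] borel_measurable_continuous_onI continuous_intros)
  have "(\<integral>\<^sup>+(x, y, z). ennreal (x ^ k * y ^ l * z ^ m) \<partial>dirichlet3 a b c) =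
    (\<integral>\<^sup>+z. ennreal ?C * ennreal (dirichlet_density (a + k) (b + l) (c + m) z) \<partial>lborel)"
    unfolding nn_integral_dirichlet3[OF a b c meas]
  proof (intro nn_integral_cong)
    fix z :: "real \<times> real"
    obtain x y where z: "z = (x, y)" by (cases z)
    have "dirichlet_density a b c z * (x ^ k * y ^ l * (1 - x - y) ^ m) =
      dirichlet_density (a + k) (b + l) (c + m) z"
    proof (cases "0 < x \<and> 0 < y \<and> x + y < 1")
      case True
      have "u powr (d - 1) * u ^ n = u powr (d + real n - 1)" if "0 < u" for u d :: real and n
        using that by (simp add: powr_realpow[symmetric] powr_add[symmetric] algebra_simps)
      from this[of x a k] this[of y b l] this[of "1 - x - y" c m]
      have "x powr (a + k - 1) * y powr (b + l - 1) * (1 - x - y) powr (c + m - 1) =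
        (x powr (a - 1) * x ^ k) * (y powr (b - 1) * y ^ l) * ((1 - x - y) powr (c - 1) * (1 - x - y) ^ m)"
        using True by simp
      then show ?thesis using True by (simp add: dirichlet_density_def z mult_ac)
    qed (auto simp: dirichlet_density_def z)
    moreover have "dirichlet_density a b c z \<ge> 0" by (auto simp: dirichlet_density_def z)
    ultimately show "ennreal ?C * ennreal (dirichlet_density a b c z) *
        (case (fst z, snd z, 1 - fst z - snd z) of (x, y, z) \<Rightarrow> ennreal (x ^ k * y ^ l * z ^ m)) =
      ennreal ?C * ennreal (dirichlet_density (a + k) (b + l) (c + m) z)"
      by (simp add: z mult.assoc ennreal_mult'[symmetric])
  qed
  also have "\<dots> = ennreal ?C * ennreal (Gamma (a + k) * Gamma (b + l) * Gamma (c + m) / Gamma (a + k + (b + l) + (c + m)))"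
    using a b c by (subst nn_integral_cmult) (simp_all add: nn_integral_Dirichlet)
  also have "\<dots> = ennreal (?C * (Gamma (a + k) * Gamma (b + l) * Gamma (c + m) / Gamma (a + k + (b + l) + (c + m))))"
    using C by (simp add: ennreal_mult'[symmetric])
  also have "?C * (Gamma (a + k) * Gamma (b + l) * Gamma (c + m) / Gamma (a + k + (b + l) + (c + m))) =
    pochhammer a k * pochhammer b l * pochhammer c m / pochhammer (a + b + c) (k + l + m)"
  proof -
    have "a + k + (b + l) + (c + m) = a + b + c + real (k + l + m)" by simp
    then have G: "Gamma (a + k + (b + l) + (c + m)) = pochhammer (a + b + c) (k + l + m) * Gamma (a + b + c)"
      using Gamma_add_nat[of "a + b + c" "k + l + m"] a b c by (simp only:)
    have "Gamma a > 0" "Gamma b > 0" "Gamma c > 0" "Gamma (a + b + c) > 0"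
      using a b c by (auto intro!: Gamma_real_pos)
    then show ?thesis
      unfolding G Gamma_add_nat[OF a] Gamma_add_nat[OF b] Gamma_add_nat[OF c] by (simp add: field_simps)
  qed
  finally show ?thesis .
qed

text \<open>The density vanishes outside the open simplex. Strict positivity is what
  \<open>block_weights\<close> asks for, while the closed simplex still allows empty blocks.\<close>

lemma AE_dirichlet3_positive:
  assumes a: "a > 0" and b: "b > 0" and c: "c > 0"
  shows "AE (x, y, z) in dirichlet3 a b c. 0 < x \<and> 0 < y \<and> 0 < z"
proof -
  let ?N = "{w :: real \<times> real \<times> real. \<not> (0 < fst w \<and> 0 < fst (snd w) \<and> 0 < snd (snd w))}"
  have N: "?N \<in> sets borel"
  proof -
    have "open {w :: real \<times> real \<times> real. 0 < fst w \<and> 0 < fst (snd w) \<and> 0 < snd (snd w)}"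
      by (intro open_Collect_conj open_Collect_less continuous_intros)
    then have "- {w :: real \<times> real \<times> real. 0 < fst w \<and> 0 < fst (snd w) \<and> 0 < snd (snd w)} \<in> sets borel"
      by auto
    then show ?thesis by (simp add: Collect_neg_eq[symmetric])
  qed
  have "emeasure (dirichlet3 a b c) ?N = (\<integral>\<^sup>+w. indicator ?N w \<partial>dirichlet3 a b c)"
    using N by (simp add: dirichlet3_def)
  also have "\<dots> = (\<integral>\<^sup>+z. ennreal (Gamma (a + b + c) / (Gamma a * Gamma b * Gamma c)) *
      ennreal (dirichlet_density a b c z) * indicator ?N (fst z, snd z, 1 - fst z - snd z) \<partial>lborel)"
    using N by (intro nn_integral_dirichlet3[OF a b c]) simp
  also have "\<dots> = (\<integral>\<^sup>+z. 0 \<partial>(lborel :: (real \<times> real) measure))"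
    by (intro nn_integral_cong) (auto simp: dirichlet_density_def)
  finally have "emeasure (dirichlet3 a b c) ?N = 0" by simp
  then show ?thesis
    using N by (intro AE_I[of _ _ ?N]) (auto simp: dirichlet3_def)
qed

section \<open>The mixture of three rescaled permutons\<close>

text \<open>The common form of the coordinates of the three maps; \<open>s\<close> tells whether block 1 lies below
  block 2, which is always the case for the first coordinate.\<close>
definition line_map :: "(nat \<Rightarrow> real) \<Rightarrow> real \<Rightarrow> bool \<Rightarrow> nat \<Rightarrow> real \<Rightarrow> real" where
  "line_map d X s k x =
    (if k = 0 then d 0 * x + (1 - d 0) * of_bool (x > X)
     else if k = 1 then d 1 * x + d 0 * X + d 2 * of_bool (\<not> s)
     else d 2 * x + d 0 * X + d 1 * of_bool s)"

lemma line_map_measurable [measurable]: "line_map d X s k \<in> borel_measurable borel"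
  unfolding line_map_def[abs_def] by (cases "k = 0"; cases "k = 1") simp_all

locale block_weights =
  fixes d :: "nat \<Rightarrow> real"
  assumes d_pos: "d 0 > 0" "d 1 > 0" "d 2 > 0" and d_sum: "d 0 + d 1 + d 2 = 1"
begin

text \<open>Block 0 is mapped below \<open>d 0 * X\<close> or above
  \<open>d 0 * X + d 1 + d 2\<close>, according to the side of \<open>X\<close>, and blocks 1 and 2
  fill the gap in the order given by \<open>s\<close>. As all coordinates are strictly inside the
  unit interval and those of block 0 avoid \<open>X\<close>, images from different pieces never
  touch, so comparing blocks decides every mixed pair.\<close>

lemma order_on_line_map:
  fixes x :: "'i \<Rightarrow> real"
  assumes c: "c \<in> I \<rightarrow>\<^sub>E {0, 1, 2}" and e: "e \<notin> I" and X: "0 \<le> X" "X \<le> 1"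
    and x: "\<And>i. i \<in> I \<Longrightarrow> 0 < x i \<and> x i < 1" and ne: "\<And>i. i \<in> I \<Longrightarrow> c i = 0 \<Longrightarrow> x i \<noteq> X"
  shows "order_on I (\<lambda>i. line_map d X s (c i) (x i)) =
    splice_order I c e s (order_on (insert e (fiber I c 0)) (x(e := X)))
      (order_on (fiber I c 1) x) (order_on (fiber I c 2) x)"
proof -
  have d0: "1 - d 0 = d 1 + d 2" using d_sum by simp
  have "line_map d X s (c i) (x i) < line_map d X s (c j) (x j) \<longleftrightarrow>
      (c i = 0 \<and> c j = 0 \<and> x i < x j) \<or> (c i = 0 \<and> c j \<noteq> 0 \<and> x i < X) \<or>
      (c i \<noteq> 0 \<and> c j = 0 \<and> X < x j) \<or> (c i = 1 \<and> c j = 1 \<and> x i < x j) \<or>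
      (c i = 2 \<and> c j = 2 \<and> x i < x j) \<or> (if s then c i = 1 \<and> c j = 2 else c i = 2 \<and> c j = 1)"
    if i: "i \<in> I" and j: "j \<in> I" for i j
  proof -
    have ci: "c i = 0 \<or> c i = 1 \<or> c i = 2" and cj: "c j = 0 \<or> c j = 1 \<or> c j = 2"
      using PiE_mem[OF c i] PiE_mem[OF c j] by auto
    have B: "0 < d k * x l" "d k * x l < d k" if "l \<in> I" "k \<in> {0, 1, 2}" for k l
      using x[OF that(1)] that(2) d_pos by auto
    have L: "d k * u < d k * v \<longleftrightarrow> u < v" if "k \<in> {0, 1, 2}" for k u v
      using that d_pos by auto
    have B1: "0 < d 1 * x l" "d 1 * x l < d 1" if "l \<in> I" for l
      by (rule B[OF that]; simp)+
    have B2: "0 < d 2 * x l" "d 2 * x l < d 2" if "l \<in> I" for l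
      by (rule B[OF that]; simp)+
    have L0: "d 0 * u < d 0 * v \<longleftrightarrow> u < v" and L1: "d 1 * u < d 1 * v \<longleftrightarrow> u < v"
      and L2: "d 2 * u < d 2 * v \<longleftrightarrow> u < v" for u v
      by (rule L; simp)+
    have case0: "line_map d X s 0 (x l) = d 0 * x l + (if x l > X then d 1 + d 2 else 0)" for l
      by (simp add: line_map_def d0)
    have case1: "line_map d X s 1 u = d 1 * u + d 0 * X + (if s then 0 else d 2)" for u
      by (simp add: line_map_def)
    have case2: "line_map d X s 2 u = d 2 * u + d 0 * X + (if s then d 1 else 0)" for u
      by (simp add: line_map_def)
    show ?thesis
      using ci cj
    proof (elim disjE)
      assume ck: "c i = 0" "c j = 0"
      have "line_map d X s 0 (x i) < line_map d X s 0 (x j) \<longleftrightarrow> x i < x j"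
        unfolding case0 case1 case2 using L0[of "x i" "x j"] L0[of "x j" "x i"] d_pos by (smt (verit))
      then show ?thesis unfolding ck by simp
    next
      assume ck: "c i = 0" "c j = 1"
      have "line_map d X s 0 (x i) < line_map d X s 1 (x j) \<longleftrightarrow> x i < X"
        unfolding case0 case1 case2 using L0[of "x i" X] L0[of X "x i"] ne[OF i ck(1)] B1[OF j] d_pos by (smt (verit))
      then show ?thesis unfolding ck by simp
    next
      assume ck: "c i = 0" "c j = 2"
      have "line_map d X s 0 (x i) < line_map d X s 2 (x j) \<longleftrightarrow> x i < X"
        unfolding case0 case1 case2 using L0[of "x i" X] L0[of X "x i"] ne[OF i ck(1)] B2[OF j] d_pos by (smt (verit))
      then show ?thesis unfolding ck by simp
    next
      assume ck: "c i = 1" "c j = 0"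
      have "line_map d X s 1 (x i) < line_map d X s 0 (x j) \<longleftrightarrow> X < x j"
        unfolding case0 case1 case2 using L0[of "x j" X] L0[of X "x j"] ne[OF j ck(2)] B1[OF i] d_pos by (smt (verit))
      then show ?thesis unfolding ck by simp
    next
      assume ck: "c i = 2" "c j = 0"
      have "line_map d X s 2 (x i) < line_map d X s 0 (x j) \<longleftrightarrow> X < x j"
        unfolding case0 case1 case2 using L0[of "x j" X] L0[of X "x j"] ne[OF j ck(2)] B2[OF i] d_pos by (smt (verit))
      then show ?thesis unfolding ck by simp
    next
      assume ck: "c i = 1" "c j = 1"
      have "line_map d X s 1 (x i) < line_map d X s 1 (x j) \<longleftrightarrow> x i < x j"
        unfolding case0 case1 case2 using L1[of "x i" "x j"] d_pos by (smt (verit))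
      then show ?thesis unfolding ck by simp
    next
      assume ck: "c i = 2" "c j = 2"
      have "line_map d X s 2 (x i) < line_map d X s 2 (x j) \<longleftrightarrow> x i < x j"
        unfolding case0 case1 case2 using L2[of "x i" "x j"] d_pos by (smt (verit))
      then show ?thesis unfolding ck by simp
    next
      assume ck: "c i = 1" "c j = 2"
      have "line_map d X s 1 (x i) < line_map d X s 2 (x j) \<longleftrightarrow> s"
        unfolding case0 case1 case2 using B1[OF i] B2[OF j] d_pos by (smt (verit))
      then show ?thesis unfolding ck by simp
    next
      assume ck: "c i = 2" "c j = 1"
      have "line_map d X s 2 (x i) < line_map d X s 1 (x j) \<longleftrightarrow> \<not> s"
        unfolding case0 case1 case2 using B2[OF i] B1[OF j] d_pos by (smt (verit))
      then show ?thesis unfolding ck by simp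
    qed
  qed
  then have iff: "i \<in> I \<and> j \<in> I \<and> line_map d X s (c i) (x i) < line_map d X s (c j) (x j) \<longleftrightarrow>
      i \<in> I \<and> j \<in> I \<and> ((c i = 0 \<and> c j = 0 \<and> x i < x j) \<or> (c i = 0 \<and> c j \<noteq> 0 \<and> x i < X) \<or>
      (c i \<noteq> 0 \<and> c j = 0 \<and> X < x j) \<or> (c i = 1 \<and> c j = 1 \<and> x i < x j) \<or>
      (c i = 2 \<and> c j = 2 \<and> x i < x j) \<or> (if s then c i = 1 \<and> c j = 2 else c i = 2 \<and> c j = 1))" for i j
    by blast
  have e': "i \<in> I \<Longrightarrow> i \<noteq> e" for i using e by auto
  have splice: "(i, j) \<in> splice_order I c e s (order_on (insert e (fiber I c 0)) (x(e := X)))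
      (order_on (fiber I c 1) x) (order_on (fiber I c 2) x) \<longleftrightarrow>
      i \<in> I \<and> j \<in> I \<and> ((c i = 0 \<and> c j = 0 \<and> x i < x j) \<or> (c i = 0 \<and> c j \<noteq> 0 \<and> x i < X) \<or>
      (c i \<noteq> 0 \<and> c j = 0 \<and> X < x j) \<or> (c i = 1 \<and> c j = 1 \<and> x i < x j) \<or>
      (c i = 2 \<and> c j = 2 \<and> x i < x j) \<or> (if s then c i = 1 \<and> c j = 2 else c i = 2 \<and> c j = 1))" for i j
  proof (cases "i \<in> I \<and> j \<in> I")
    case True
    then have *: "i \<in> I" "j \<in> I" "i \<noteq> e" "j \<noteq> e" using e' by auto
    have "(i, j) \<in> order_on (insert e (fiber I c 0)) (x(e := X)) \<longleftrightarrow> c i = 0 \<and> c j = 0 \<and> x i < x j"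
      "(i, e) \<in> order_on (insert e (fiber I c 0)) (x(e := X)) \<longleftrightarrow> c i = 0 \<and> x i < X"
      "(e, j) \<in> order_on (insert e (fiber I c 0)) (x(e := X)) \<longleftrightarrow> c j = 0 \<and> X < x j"
      "(i, j) \<in> order_on (fiber I c k) x \<longleftrightarrow> c i = k \<and> c j = k \<and> x i < x j" for k
      using * by (auto simp: order_on_def fiber_def)
    then show ?thesis
      unfolding splice_order_def mem_Collect_eq prod.case using * by blast
  next
    case False
    then show ?thesis by (auto simp: splice_order_def)
  qed
  show ?thesis
  proof (rule set_eqI, clarify)
    fix i j
    show "(i, j) \<in> order_on I (\<lambda>i. line_map d X s (c i) (x i)) \<longleftrightarrow>
      (i, j) \<in> splice_order I c e s (order_on (insert e (fiber I c 0)) (x(e := X)))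
        (order_on (fiber I c 1) x) (order_on (fiber I c 2) x)"
      unfolding splice iff[symmetric] by (simp add: order_on_def)
  qed
qed

end

text \<open>The weight of a block equals the scaling factor of its map, so it cancels the Jacobian.
  Half-open intervals let neighbouring images fit together without overlap.\<close>

lemma emeasure_lborel_affine_piece:
  fixes d l u v :: real
  assumes d: "d > 0" and A [measurable]: "A \<in> sets borel"
  shows "ennreal d * emeasure lborel ({u<..v} \<inter> {x. d * x + l \<in> A}) =
    emeasure lborel ({d * u + l<..d * v + l} \<inter> A)"
proof -
  have [measurable]: "{x. d * x + l \<in> A} \<in> sets borel"
    using measurable_sets[of "\<lambda>x. d * x + l" borel borel A] A by (simp add: vimage_def)
  have "emeasure lborel ({d * u + l<..d * v + l} \<inter> A) =
    (\<integral>\<^sup>+y. indicator ({d * u + l<..d * v + l} \<inter> A) y \<partial>lborel)"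
    by simp
  also have "\<dots> = ennreal \<bar>d\<bar> * (\<integral>\<^sup>+x. indicator ({d * u + l<..d * v + l} \<inter> A) (l + d * x) \<partial>lborel)"
    using d by (intro nn_integral_real_affine) auto
  also have "(\<integral>\<^sup>+x. indicator ({d * u + l<..d * v + l} \<inter> A) (l + d * x) \<partial>lborel) =
    (\<integral>\<^sup>+x. indicator ({u<..v} \<inter> {x. d * x + l \<in> A}) x \<partial>lborel)"
    using d by (intro nn_integral_cong) (auto simp: indicator_def add.commute)
  also have "\<dots> = emeasure lborel ({u<..v} \<inter> {x. d * x + l \<in> A})" by simp
  finally show ?thesis using d by simp
qed

lemma emeasure_lborel_adjacent:
  fixes u v w :: real
  assumes "u \<le> v" "v \<le> w" and A [measurable]: "A \<in> sets borel"
  shows "emeasure lborel ({u<..v} \<inter> A) + emeasure lborel ({v<..w} \<inter> A) = emeasure lborel ({u<..w} \<inter> A)"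
proof -
  have "{u<..w} \<inter> A = ({u<..v} \<inter> A) \<union> ({v<..w} \<inter> A)" using assms by auto
  moreover have "({u<..v} \<inter> A) \<inter> ({v<..w} \<inter> A) = {}" by auto
  ultimately show ?thesis by (simp add: plus_emeasure)
qed

lemma emeasure_lborel_half_open:
  assumes [measurable]: "A \<in> sets borel"
  shows "emeasure lborel ({0..1} \<inter> A) = emeasure lborel ({0<..1::real} \<inter> A)"
proof (rule emeasure_eq_AE)
  show "AE x in lborel. (x \<in> {0..1} \<inter> A) = (x \<in> {0<..1} \<inter> A)"
    using AE_lborel_singleton[of "0::real"] by eventually_elim auto
qed simp_all

context block_weights
begin

text \<open>The images of the four pieces are adjacent intervals that fill the unit interval.\<close>
lemma line_map_preserves_uniform:
  assumes X: "0 \<le> X" "X \<le> 1" and A [measurable]: "A \<in> sets borel"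
  shows "(\<Sum>k\<in>{0, 1, 2}. ennreal (d k) * emeasure lborel ({0..1} \<inter> {x. line_map d X s k x \<in> A})) =
    emeasure lborel ({0..1} \<inter> A)"
proof -
  let ?L = "\<lambda>u v. emeasure lborel ({u<..v} \<inter> A)"
  have [measurable]: "{x. line_map d X s k x \<in> A} \<in> sets borel" for k
    using measurable_sets[OF line_map_measurable A] by (simp add: vimage_def)
  have [measurable]: "{x. m * x + l \<in> A} \<in> sets borel" for m l :: real
    using measurable_sets[of "\<lambda>x. m * x + l" borel borel A] A by (simp add: vimage_def)
  have ends: "1 - d 0 = d 1 + d 2" "d 0 * 1 + (d 1 + d 2) = 1" using d_sum by simp_all
  have "ennreal (d 0) * emeasure lborel ({0..1} \<inter> {x. line_map d X s 0 x \<in> A}) =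
    ennreal (d 0) * (emeasure lborel ({0<..X} \<inter> {x. line_map d X s 0 x \<in> A}) +
      emeasure lborel ({X<..1} \<inter> {x. line_map d X s 0 x \<in> A}))"
    using X by (simp add: emeasure_lborel_half_open emeasure_lborel_adjacent)
  also have "{0<..X} \<inter> {x. line_map d X s 0 x \<in> A} = {0<..X} \<inter> {x. d 0 * x + 0 \<in> A}"
    by (auto simp: line_map_def)
  also have "{X<..1} \<inter> {x. line_map d X s 0 x \<in> A} = {X<..1} \<inter> {x. d 0 * x + (d 1 + d 2) \<in> A}"
    unfolding ends(1)[symmetric] by (auto simp: line_map_def)
  finally have 0: "ennreal (d 0) * emeasure lborel ({0..1} \<inter> {x. line_map d X s 0 x \<in> A}) =
    ?L 0 (d 0 * X) + ?L (d 0 * X + (d 1 + d 2)) 1"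
    unfolding distrib_left emeasure_lborel_affine_piece[OF d_pos(1) A]
    unfolding ends(2) by simp
  have 1: "ennreal (d 1) * emeasure lborel ({0..1} \<inter> {x. line_map d X s 1 x \<in> A}) =
    ?L (d 0 * X + d 2 * of_bool (\<not> s)) (d 1 + (d 0 * X + d 2 * of_bool (\<not> s)))"
    using emeasure_lborel_affine_piece[OF d_pos(2) A, of 0 1 "d 0 * X + d 2 * of_bool (\<not> s)"]
    by (simp add: emeasure_lborel_half_open line_map_def add.assoc)
  have 2: "ennreal (d 2) * emeasure lborel ({0..1} \<inter> {x. line_map d X s 2 x \<in> A}) =
    ?L (d 0 * X + d 1 * of_bool s) (d 2 + (d 0 * X + d 1 * of_bool s))"
    using emeasure_lborel_affine_piece[OF d_pos(3) A, of 0 1 "d 0 * X + d 1 * of_bool s"]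
    by (simp add: emeasure_lborel_half_open line_map_def add.assoc)
  have mid: "ennreal (d 1) * emeasure lborel ({0..1} \<inter> {x. line_map d X s 1 x \<in> A}) +
    ennreal (d 2) * emeasure lborel ({0..1} \<inter> {x. line_map d X s 2 x \<in> A}) =
    ?L (d 0 * X) (d 0 * X + (d 1 + d 2))"
  proof (cases s)
    case True
    then show ?thesis
      unfolding 1 2 using emeasure_lborel_adjacent[OF _ _ A, of "d 0 * X" "d 0 * X + d 1" "d 0 * X + (d 1 + d 2)"] d_pos
      by (simp add: ac_simps)
  next
    case False
    then show ?thesis
      unfolding 1 2 using emeasure_lborel_adjacent[OF _ _ A, of "d 0 * X" "d 0 * X + d 2" "d 0 * X + (d 1 + d 2)"] d_pos
      by (simp add: ac_simps)
  qed
  have "d 0 * X \<le> d 0 * 1" using X d_pos by (intro mult_left_mono) auto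
  then have le: "d 0 * X + (d 1 + d 2) \<le> 1" "d 0 * X \<le> d 0 * X + (d 1 + d 2)" "0 \<le> d 0 * X"
    using d_pos d_sum mult_nonneg_nonneg[OF less_imp_le[OF d_pos(1)] X(1)] by linarith+
  have "(\<Sum>k\<in>{0, 1, 2}. ennreal (d k) * emeasure lborel ({0..1} \<inter> {x. line_map d X s k x \<in> A})) =
    (?L 0 (d 0 * X) + ?L (d 0 * X) (d 0 * X + (d 1 + d 2))) + ?L (d 0 * X + (d 1 + d 2)) 1"
    using 0 mid by (simp add: ac_simps)
  also have "\<dots> = emeasure lborel ({0..1} \<inter> A)"
    using le by (simp add: emeasure_lborel_adjacent[OF _ _ A] emeasure_lborel_half_open)
  finally show ?thesis .
qed

end

section \<open>Sampling from a mixture\<close>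

lemma emeasure_point_measure_bind:
  fixes \<nu> :: "'k \<Rightarrow> 'a measure"
  assumes S: "finite S" "S \<noteq> {}" and \<nu>: "\<And>k. k \<in> S \<Longrightarrow> \<nu> k \<in> space (prob_algebra N)" and A: "A \<in> sets N"
  shows "emeasure (point_measure S w \<bind> \<nu>) A = (\<Sum>k\<in>S. w k * emeasure (\<nu> k) A)"
proof -
  have "emeasure (point_measure S w \<bind> \<nu>) A = (\<integral>\<^sup>+k. emeasure (\<nu> k) A \<partial>point_measure S w)"
    using S \<nu> A by (intro emeasure_bind[where N = N])
      (auto simp: space_point_measure space_prob_algebra space_subprob_algebra prob_space_imp_subprob_space)
  also have "\<dots> = (\<Sum>k\<in>S. w k * emeasure (\<nu> k) A)"
    using S by (subst nn_integral_point_measure_finite) (auto simp: mult.commute)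
  finally show ?thesis .
qed

lemma sets_point_measure_bind:
  assumes "S \<noteq> {}" "\<And>k. k \<in> S \<Longrightarrow> \<nu> k \<in> space (prob_algebra N)"
  shows "sets (point_measure S w \<bind> \<nu>) = sets N"
  using assms by (intro sets_bind) (auto simp: space_point_measure space_prob_algebra)

lemma prob_space_point_measure_bind:
  assumes S: "finite S" "S \<noteq> {}" and \<nu>: "\<And>k. k \<in> S \<Longrightarrow> \<nu> k \<in> space (prob_algebra N)"
    and w: "(\<Sum>k\<in>S. w k) = 1"
  shows "prob_space (point_measure S w \<bind> \<nu>)"
proof
  have sp: "space (point_measure S w \<bind> \<nu>) = space N"
    using sets_point_measure_bind[OF S(2) \<nu>] by (rule sets_eq_imp_space_eq)
  have "emeasure (point_measure S w \<bind> \<nu>) (space N) = (\<Sum>k\<in>S. w k * emeasure (\<nu> k) (space N))"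
    by (rule emeasure_point_measure_bind[OF S \<nu>]) auto
  also have "\<dots> = (\<Sum>k\<in>S. w k * 1)"
    using \<nu> by (intro sum.cong refl arg_cong2[where f = times] in_space_prob_algebra)
  finally show "emeasure (point_measure S w \<bind> \<nu>) (space (point_measure S w \<bind> \<nu>)) = 1"
    using w by (simp add: sp)
qed

text \<open>Independent sampling from a mixture means choosing the components \<open>c\<close>
  independently and then sampling each point from its own component. On a rectangle this is the
  expansion of a product of sums.\<close>

lemma PiM_mixture:
  fixes \<mu> :: "'k \<Rightarrow> 'a measure" and \<theta> :: "'k \<Rightarrow> 'a \<Rightarrow> 'b" and w :: "'k \<Rightarrow> ennreal"
  assumes S: "finite S" "S \<noteq> {}" and w: "(\<Sum>k\<in>S. w k) = 1" and I: "finite I"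
    and \<mu>: "\<And>k. k \<in> S \<Longrightarrow> prob_space (\<mu> k)" and \<theta>: "\<And>k. k \<in> S \<Longrightarrow> \<theta> k \<in> \<mu> k \<rightarrow>\<^sub>M N"
  shows "PiM I (\<lambda>_. point_measure S w \<bind> (\<lambda>k. distr (\<mu> k) N (\<theta> k))) =
    point_measure (I \<rightarrow>\<^sub>E S) (\<lambda>c. \<Prod>i\<in>I. w (c i)) \<bind>
      (\<lambda>c. distr (PiM I (\<lambda>i. \<mu> (c i))) (PiM I (\<lambda>_. N)) (\<lambda>z. \<lambda>i\<in>I. \<theta> (c i) (z i)))"
    (is "PiM I (\<lambda>_. ?mix) = ?R")
proof -
  let ?K = "\<lambda>c. distr (PiM I (\<lambda>i. \<mu> (c i))) (PiM I (\<lambda>_. N)) (\<lambda>z. \<lambda>i\<in>I. \<theta> (c i) (z i))"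
  have \<nu>: "distr (\<mu> k) N (\<theta> k) \<in> space (prob_algebra N)" if "k \<in> S" for k
    using that \<mu> \<theta> by (auto simp: space_prob_algebra prob_space.prob_space_distr)
  have mix: "prob_space ?mix" "sets ?mix = sets N"
    using prob_space_point_measure_bind[OF S \<nu> w] sets_point_measure_bind[OF S(2) \<nu>] by auto
  have meas: "(\<lambda>z. \<lambda>i\<in>I. \<theta> (c i) (z i)) \<in> PiM I (\<lambda>i. \<mu> (c i)) \<rightarrow>\<^sub>M PiM I (\<lambda>_. N)"
    if c: "c \<in> I \<rightarrow>\<^sub>E S" for c
    using c \<theta> by (intro measurable_restrict measurable_compose[OF measurable_component_singleton]) auto
  have K: "?K c \<in> space (prob_algebra (PiM I (\<lambda>_. N)))" if c: "c \<in> I \<rightarrow>\<^sub>E S" for c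
    using meas[OF c] c \<mu>
    by (auto simp: space_prob_algebra intro!: prob_space.prob_space_distr prob_space_PiM)
  have fin: "finite (I \<rightarrow>\<^sub>E S)" "I \<rightarrow>\<^sub>E S \<noteq> {}" using I S by (auto simp: finite_PiE PiE_eq_empty_iff)
  interpret product_sigma_finite "\<lambda>_. ?mix"
    using mix(1) by (simp add: product_sigma_finite_def prob_space_imp_sigma_finite)
  have "?R = PiM I (\<lambda>_. ?mix)"
  proof (rule PiM_eqI[OF I])
    show "sets ?R = sets (PiM I (\<lambda>_. ?mix))"
    proof -
      have "sets ?R = sets (PiM I (\<lambda>_. N))" by (rule sets_point_measure_bind[OF fin(2) K])
      also have "\<dots> = sets (PiM I (\<lambda>_. ?mix))" by (intro sets_PiM_cong refl mix(2)[symmetric])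
      finally show ?thesis .
    qed
    fix A assume "\<And>i. i \<in> I \<Longrightarrow> A i \<in> sets ?mix"
    then have A: "\<And>i. i \<in> I \<Longrightarrow> A i \<in> sets N" using mix(2) by simp
    have rect: "Pi\<^sub>E I A \<in> sets (PiM I (\<lambda>_. N))" using A I by (intro sets_PiM_I_finite) auto
    have emK: "emeasure (?K c) (Pi\<^sub>E I A) = (\<Prod>i\<in>I. emeasure (distr (\<mu> (c i)) N (\<theta> (c i))) (A i))"
      if c: "c \<in> I \<rightarrow>\<^sub>E S" for c
    proof -
      \<comment> \<open>Outside \<open>I\<close> the value of \<open>c\<close> is unspecified, so
        \<open>\<mu> (c i)\<close> need not be a probability measure there; a Dirac measure makes
        the family admissible at every index.\<close>
      define \<mu>' where "\<mu>' i = (if i \<in> I then \<mu> (c i) else return (count_space UNIV) undefined)" for i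
      have p: "prob_space (\<mu>' i)" for i
        using c \<mu> by (auto simp: \<mu>'_def prob_space_return)
      interpret M': product_sigma_finite \<mu>'
        using p by (simp add: product_sigma_finite_def prob_space_imp_sigma_finite)
      have eq: "PiM I (\<lambda>i. \<mu> (c i)) = PiM I \<mu>'" by (intro PiM_cong) (auto simp: \<mu>'_def)
      have th: "\<theta> (c i) \<in> \<mu>' i \<rightarrow>\<^sub>M N" if "i \<in> I" for i using c \<theta> that by (auto simp: \<mu>'_def)
      have "emeasure (?K c) (Pi\<^sub>E I A) =
        emeasure (PiM I \<mu>') ((\<lambda>z. \<lambda>i\<in>I. \<theta> (c i) (z i)) -` Pi\<^sub>E I A \<inter> space (PiM I \<mu>'))"
        using meas[OF c] rect unfolding eq by (rule emeasure_distr)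
      also have "(\<lambda>z. \<lambda>i\<in>I. \<theta> (c i) (z i)) -` Pi\<^sub>E I A \<inter> space (PiM I \<mu>') =
        (\<Pi>\<^sub>E i\<in>I. \<theta> (c i) -` A i \<inter> space (\<mu>' i))"
        by (auto simp: space_PiM PiE_iff extensional_def)
      also have "emeasure (PiM I \<mu>') \<dots> = (\<Prod>i\<in>I. emeasure (\<mu>' i) (\<theta> (c i) -` A i \<inter> space (\<mu>' i)))"
        using I A th by (intro M'.emeasure_PiM measurable_sets) auto
      also have "\<dots> = (\<Prod>i\<in>I. emeasure (distr (\<mu> (c i)) N (\<theta> (c i))) (A i))"
        using A th by (intro prod.cong refl) (simp add: emeasure_distr \<mu>'_def)
      finally show ?thesis .
    qed
    have "emeasure ?R (Pi\<^sub>E I A) = (\<Sum>c\<in>I \<rightarrow>\<^sub>E S. (\<Prod>i\<in>I. w (c i)) * emeasure (?K c) (Pi\<^sub>E I A))"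
      by (rule emeasure_point_measure_bind[OF fin K rect])
    also have "\<dots> = (\<Sum>c\<in>I \<rightarrow>\<^sub>E S. \<Prod>i\<in>I. w (c i) * emeasure (distr (\<mu> (c i)) N (\<theta> (c i))) (A i))"
      by (intro sum.cong refl) (simp add: emK prod.distrib)
    also have "\<dots> = (\<Prod>i\<in>I. \<Sum>k\<in>S. w k * emeasure (distr (\<mu> k) N (\<theta> k)) (A i))"
      using I S by (intro prod_sum_PiE[symmetric]) auto
    also have "\<dots> = (\<Prod>i\<in>I. emeasure ?mix (A i))"
      using A by (intro prod.cong refl) (simp add: emeasure_point_measure_bind[OF S \<nu>])
    finally show "emeasure ?R (Pi\<^sub>E I A) = (\<Prod>i\<in>I. emeasure ?mix (A i))" .
  qed
  then show ?thesis by simp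
qed

text \<open>Reduces integrals of functions of the orders to probabilities of single orders, for
  which mixtures and product measures have explicit formulas.\<close>

lemma (in prob_space) integral_finite_range:
  fixes h :: "_ \<Rightarrow> real"
  assumes f: "f \<in> M \<rightarrow>\<^sub>M count_space UNIV" and S: "finite S" "\<And>x. x \<in> space M \<Longrightarrow> f x \<in> S"
  shows "(\<integral>x. h (f x) \<partial>M) = (\<Sum>r\<in>S. h r * measure M {x \<in> space M. f x = r})"
proof -
  have sets: "{x \<in> space M. f x = r} \<in> sets M" for r
    using measurable_sets[OF f, of "{r}"] by (auto simp: vimage_def Int_def conj_commute)
  have "(\<integral>x. h (f x) \<partial>M) = (\<integral>x. (\<Sum>r\<in>S. h r * indicator {x \<in> space M. f x = r} x) \<partial>M)"
  proof (intro Bochner_Integration.integral_cong refl)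
    fix x assume x: "x \<in> space M"
    have "(\<Sum>r\<in>S. h r * indicator {x \<in> space M. f x = r} x) = (\<Sum>r\<in>S. if r = f x then h r else 0)"
      using x by (intro sum.cong) (auto simp: indicator_def)
    then show "h (f x) = (\<Sum>r\<in>S. h r * indicator {x \<in> space M. f x = r} x)"
      using S x by simp
  qed
  also have "\<dots> = (\<Sum>r\<in>S. h r * measure M {x \<in> space M. f x = r})"
    using sets by (subst Bochner_Integration.integral_sum)
      (auto simp: Int_def emeasure_eq_measure intro!: sum.cong arg_cong[where f = prob])
  finally show ?thesis .
qed

lemma integral_PiM_mixture:
  fixes h :: "_ \<Rightarrow> real" and \<mu> :: "'k \<Rightarrow> (real \<times> real) measure" and w :: "'k \<Rightarrow> real"
  assumes S: "finite S" "S \<noteq> {}" and w: "(\<Sum>k\<in>S. w k) = 1" "\<And>k. k \<in> S \<Longrightarrow> 0 \<le> w k" and I: "finite I"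
    and \<mu>: "\<And>k. k \<in> S \<Longrightarrow> prob_space (\<mu> k)" "\<And>k. k \<in> S \<Longrightarrow> sets (\<mu> k) = sets borel"
    and \<theta>: "\<And>k. k \<in> S \<Longrightarrow> \<theta> k \<in> borel \<rightarrow>\<^sub>M borel"
  shows "(\<integral>z. h (sample_orders I z) \<partial>PiM I (\<lambda>_. point_measure S (\<lambda>k. ennreal (w k)) \<bind> (\<lambda>k. distr (\<mu> k) borel (\<theta> k)))) =
    (\<Sum>c\<in>I \<rightarrow>\<^sub>E S. (\<Prod>i\<in>I. w (c i)) *
      (\<integral>z. h (sample_orders I (\<lambda>i. \<theta> (c i) (z i))) \<partial>PiM I (\<lambda>i. \<mu> (c i))))"
proof -
  let ?W = "point_measure (I \<rightarrow>\<^sub>E S) (\<lambda>c. \<Prod>i\<in>I. ennreal (w (c i)))"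
  let ?K = "\<lambda>c. distr (PiM I (\<lambda>i. \<mu> (c i))) (PiM I (\<lambda>_. borel)) (\<lambda>z. \<lambda>i\<in>I. \<theta> (c i) (z i))"
  let ?O = "\<lambda>r. {z \<in> space (PiM I (\<lambda>_. borel :: (real \<times> real) measure)). sample_orders I z = r}"
  have \<theta>': "\<theta> k \<in> \<mu> k \<rightarrow>\<^sub>M borel" if "k \<in> S" for k
    using \<theta>[OF that] unfolding measurable_cong_sets[OF \<mu>(2)[OF that] refl] .
  have w': "(\<Sum>k\<in>S. ennreal (w k)) = 1"
    using w by (simp add: sum_ennreal)
  have fin: "finite (I \<rightarrow>\<^sub>E S)" "I \<rightarrow>\<^sub>E S \<noteq> {}" using I S by (auto simp: finite_PiE PiE_eq_empty_iff)
  have meas: "(\<lambda>z. \<lambda>i\<in>I. \<theta> (c i) (z i)) \<in> PiM I (\<lambda>i. \<mu> (c i)) \<rightarrow>\<^sub>M PiM I (\<lambda>_. borel)"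
    if c: "c \<in> I \<rightarrow>\<^sub>E S" for c
    using c \<theta>' by (intro measurable_restrict measurable_compose[OF measurable_component_singleton]) auto
  have K: "?K c \<in> space (prob_algebra (PiM I (\<lambda>_. borel)))" if c: "c \<in> I \<rightarrow>\<^sub>E S" for c
    using meas[OF c] c \<mu>
    by (auto simp: space_prob_algebra intro!: prob_space.prob_space_distr prob_space_PiM)
  have orders: "sample_orders I \<in> PiM I (\<lambda>_. borel) \<rightarrow>\<^sub>M count_space UNIV"
    by (rule measurable_sample_orders[OF I])
  have sets: "?O r \<in> sets (PiM I (\<lambda>_. borel))" for r
    using measurable_sets[OF orders, of "{r}"] by (auto simp: vimage_def Int_def conj_commute)
  have R: "PiM I (\<lambda>_. point_measure S (\<lambda>k. ennreal (w k)) \<bind> (\<lambda>k. distr (\<mu> k) borel (\<theta> k))) = ?W \<bind> ?K"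
    by (rule PiM_mixture[OF S w' I \<mu>(1) \<theta>'])
  have pW: "(\<Sum>c\<in>I \<rightarrow>\<^sub>E S. \<Prod>i\<in>I. ennreal (w (c i))) = 1"
    using prod_sum_PiE[of I "\<lambda>_. S" "\<lambda>_ k. ennreal (w k)"] I S w' by simp
  interpret R: prob_space "?W \<bind> ?K" by (rule prob_space_point_measure_bind[OF fin K pW])
  have setsR: "sets (?W \<bind> ?K) = sets (PiM I (\<lambda>_. borel))" by (rule sets_point_measure_bind[OF fin(2) K])
  have spR: "space (?W \<bind> ?K) = space (PiM I (\<lambda>_. borel))" by (rule sets_eq_imp_space_eq[OF setsR])
  have ordersR: "sample_orders I \<in> (?W \<bind> ?K) \<rightarrow>\<^sub>M count_space UNIV"
    using orders by (simp add: measurable_cong_sets[OF setsR refl])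
  have nonneg: "0 \<le> (\<Prod>i\<in>I. w (c i))" if "c \<in> I \<rightarrow>\<^sub>E S" for c
    using that w(2) by (intro prod_nonneg) auto
  have mR: "measure (?W \<bind> ?K) (?O r) = (\<Sum>c\<in>I \<rightarrow>\<^sub>E S. (\<Prod>i\<in>I. w (c i)) * measure (?K c) (?O r))" for r
  proof -
    have "emeasure (?W \<bind> ?K) (?O r) = (\<Sum>c\<in>I \<rightarrow>\<^sub>E S. (\<Prod>i\<in>I. ennreal (w (c i))) * emeasure (?K c) (?O r))"
      by (rule emeasure_point_measure_bind[OF fin K sets])
    also have "\<dots> = (\<Sum>c\<in>I \<rightarrow>\<^sub>E S. ennreal ((\<Prod>i\<in>I. w (c i)) * measure (?K c) (?O r)))"
    proof (intro sum.cong refl)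
      fix c assume c: "c \<in> I \<rightarrow>\<^sub>E S"
      have "prob_space (?K c)" using K[OF c] by (simp add: space_prob_algebra)
      then have "emeasure (?K c) (?O r) = ennreal (measure (?K c) (?O r))"
        by (intro finite_measure.emeasure_eq_measure prob_space.finite_measure)
      moreover have "(\<Prod>i\<in>I. ennreal (w (c i))) = ennreal (\<Prod>i\<in>I. w (c i))"
        using c w(2) by (intro prod_ennreal) auto
      ultimately show "(\<Prod>i\<in>I. ennreal (w (c i))) * emeasure (?K c) (?O r) =
        ennreal ((\<Prod>i\<in>I. w (c i)) * measure (?K c) (?O r))"
        using nonneg[OF c] by (simp add: ennreal_mult'')
    qed
    also have "\<dots> = ennreal (\<Sum>c\<in>I \<rightarrow>\<^sub>E S. (\<Prod>i\<in>I. w (c i)) * measure (?K c) (?O r))"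
      using nonneg by (intro sum_ennreal) auto
    finally show ?thesis
      using nonneg by (simp add: measure_def sum_nonneg)
  qed
  have "(\<integral>z. h (sample_orders I z) \<partial>(?W \<bind> ?K)) = (\<Sum>r\<in>order_pairs I. h r * measure (?W \<bind> ?K) (?O r))"
    by (subst R.integral_finite_range[OF ordersR finite_order_pairs[OF I] sample_orders_in]) (simp add: spR)
  also have "\<dots> = (\<Sum>c\<in>I \<rightarrow>\<^sub>E S. (\<Prod>i\<in>I. w (c i)) * (\<Sum>r\<in>order_pairs I. h r * measure (?K c) (?O r)))"
    unfolding mR sum_distrib_left by (subst sum.swap) (intro sum.cong refl, simp add: mult_ac)
  also have "\<dots> = (\<Sum>c\<in>I \<rightarrow>\<^sub>E S. (\<Prod>i\<in>I. w (c i)) *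
      (\<integral>z. h (sample_orders I (\<lambda>i. \<theta> (c i) (z i))) \<partial>PiM I (\<lambda>i. \<mu> (c i))))"
  proof (intro sum.cong refl arg_cong2[where f = times])
    fix c assume c: "c \<in> I \<rightarrow>\<^sub>E S"
    interpret K: prob_space "?K c" using K[OF c] by (simp add: space_prob_algebra)
    have ordersK: "sample_orders I \<in> ?K c \<rightarrow>\<^sub>M count_space UNIV" using orders by simp
    have "(\<Sum>r\<in>order_pairs I. h r * measure (?K c) (?O r)) = (\<integral>z. h (sample_orders I z) \<partial>?K c)"
      by (subst K.integral_finite_range[OF ordersK finite_order_pairs[OF I] sample_orders_in]) simp
    also have "\<dots> = (\<integral>z. h (sample_orders I (\<lambda>i\<in>I. \<theta> (c i) (z i))) \<partial>PiM I (\<lambda>i. \<mu> (c i)))"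
      by (rule integral_distr[OF meas[OF c]]) (rule measurable_compose[OF orders], simp)
    also have "\<dots> = (\<integral>z. h (sample_orders I (\<lambda>i. \<theta> (c i) (z i))) \<partial>PiM I (\<lambda>i. \<mu> (c i)))"
      by (intro Bochner_Integration.integral_cong refl arg_cong[where f = h] sample_orders_cong) simp
    finally show "(\<Sum>r\<in>order_pairs I. h r * measure (?K c) (?O r)) =
      (\<integral>z. h (sample_orders I (\<lambda>i. \<theta> (c i) (z i))) \<partial>PiM I (\<lambda>i. \<mu> (c i)))" .
  qed
  finally show ?thesis unfolding R .
qed

section \<open>Independence of the three blocks and their images\<close>

text \<open>The product over the union is the image of a product of two measures under
  \<open>merge\<close>, and the event pulls back to the rectangle
  \<open>A \<times> B\<close>.\<close>

lemma emeasure_PiM_disjoint: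
  assumes M: "\<And>i. i \<in> F \<union> G \<Longrightarrow> prob_space (M i)" and fin: "finite F" "finite G" and disj: "F \<inter> G = {}"
    and A: "A \<in> sets (PiM F M)" and B: "B \<in> sets (PiM G M)"
  shows "emeasure (PiM (F \<union> G) M) {z \<in> space (PiM (F \<union> G) M). restrict z F \<in> A \<and> restrict z G \<in> B} =
    emeasure (PiM F M) A * emeasure (PiM G M) B"
proof -
  define M' where "M' i = (if i \<in> F \<union> G then M i else return (count_space UNIV) undefined)" for i
  have p: "prob_space (M' i)" for i using M by (auto simp: M'_def prob_space_return)
  interpret product_sigma_finite M'
    using p by (simp add: product_sigma_finite_def prob_space_imp_sigma_finite)
  have eq: "PiM (F \<union> G) M = PiM (F \<union> G) M'" "PiM F M = PiM F M'" "PiM G M = PiM G M'"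
    by (intro PiM_cong; simp add: M'_def)+
  interpret G: prob_space "PiM G M'" using p by (intro prob_space_PiM)
  let ?E = "{z \<in> space (PiM (F \<union> G) M'). restrict z F \<in> A \<and> restrict z G \<in> B}"
  have r: "(\<lambda>z. restrict z F) \<in> PiM (F \<union> G) M' \<rightarrow>\<^sub>M PiM F M'" "(\<lambda>z. restrict z G) \<in> PiM (F \<union> G) M' \<rightarrow>\<^sub>M PiM G M'"
    by (intro measurable_restrict_subset; simp)+
  have E: "?E \<in> sets (PiM (F \<union> G) M')"
  proof -
    have "?E = ((\<lambda>z. restrict z F) -` A \<inter> space (PiM (F \<union> G) M')) \<inter>
      ((\<lambda>z. restrict z G) -` B \<inter> space (PiM (F \<union> G) M'))" by auto
    then show ?thesis
      using measurable_sets[OF r(1)] measurable_sets[OF r(2)] A B eq by auto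
  qed
  have "emeasure (PiM (F \<union> G) M') ?E = emeasure (PiM F M' \<Otimes>\<^sub>M PiM G M')
      (merge F G -` ?E \<inter> space (PiM F M' \<Otimes>\<^sub>M PiM G M'))"
    using E by (subst distr_merge[OF disj fin, symmetric]) (simp add: emeasure_distr)
  also have "merge F G -` ?E \<inter> space (PiM F M' \<Otimes>\<^sub>M PiM G M') = A \<times> B"
  proof -
    have AB: "A \<subseteq> space (PiM F M')" "B \<subseteq> space (PiM G M')"
      using A B eq sets.sets_into_space by auto
    have rs: "restrict (merge F G (x, y)) F = x" "restrict (merge F G (x, y)) G = y"
      if "x \<in> space (PiM F M')" "y \<in> space (PiM G M')" for x y
      using that disj by (auto simp: space_PiM PiE_def extensional_restrict restrict_merge)
    have "merge F G (x, y) \<in> space (PiM (F \<union> G) M')"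
      if "x \<in> space (PiM F M')" "y \<in> space (PiM G M')" for x y
      using that measurable_space[OF measurable_merge, of "(x, y)" F M' G] by (simp add: space_pair_measure)
    then show ?thesis
      by (auto simp: space_pair_measure rs subsetD[OF AB(1)] subsetD[OF AB(2)])
  qed
  also have "emeasure (PiM F M' \<Otimes>\<^sub>M PiM G M') (A \<times> B) = emeasure (PiM F M') A * emeasure (PiM G M') B"
    using A B eq by (intro G.emeasure_pair_measure_Times) auto
  finally show ?thesis unfolding eq .
qed

definition orders_prob :: "'i set \<Rightarrow> (real \<times> real) measure \<Rightarrow> ('i \<times> 'i) set \<times> ('i \<times> 'i) set \<Rightarrow> real" where
  "orders_prob J \<mu> r =
    measure (PiM J (\<lambda>_. \<mu>)) {z \<in> space (PiM J (\<lambda>_. borel)). sample_orders J z = r}"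

text \<open>Here \<open>Z\<close> is a fixed point added under the label \<open>e\<close>; averaging
  over a random \<open>Z\<close> of law \<open>\<mu>\<close> turns it into one more sampled
  point.\<close>

definition orders_prob_with ::
  "'i set \<Rightarrow> 'i \<Rightarrow> (real \<times> real) measure \<Rightarrow> real \<times> real \<Rightarrow> ('i \<times> 'i) set \<times> ('i \<times> 'i) set \<Rightarrow> real" where
  "orders_prob_with J e \<mu> Z r =
    measure (PiM J (\<lambda>_. \<mu>)) {z \<in> space (PiM J (\<lambda>_. borel)). sample_orders (insert e J) (z(e := Z)) = r}"

definition splice_orders where
  "splice_orders I c e s = (\<lambda>(r0, r1, r2). (splice_order I c e True (fst r0) (fst r1) (fst r2),
     splice_order I c e s (snd r0) (snd r1) (snd r2)))"

text \<open>The horizontal coordinate always uses \<open>True\<close>: block 1 lies to the left of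
  block 2 whatever the sign.\<close>

definition theta_map ::
  "(nat \<Rightarrow> real) \<Rightarrow> real \<times> real \<Rightarrow> bool \<Rightarrow> nat \<Rightarrow> real \<times> real \<Rightarrow> real \<times> real" where
  "theta_map d Z s k z = (line_map d (fst Z) True k (fst z), line_map d (snd Z) s k (snd z))"

text \<open>The translation number is the negated sign: the value 1 lifts block 1 above block 2,
  which is what a negative node does.\<close>

lemma theta_map_eq:
  "theta0 (d 0) Z = theta_map d Z s 0"
  "theta1 (d 0) (d 1) (d 2) Z (of_bool (\<not> s)) = theta_map d Z s 1"
  "theta2 (d 0) (d 1) (d 2) Z (of_bool (\<not> s)) = theta_map d Z s 2"
  by (auto simp: theta0_def theta1_def theta2_def theta_map_def line_map_def fun_eq_iff prod_eq_iff)

lemma borel_measurable_theta_map: "theta_map d Z s k \<in> borel \<rightarrow>\<^sub>M borel"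
  unfolding theta_map_def[abs_def] by (intro borel_measurable_Pair) measurable

lemma measurable_add_point:
  fixes Z :: "real \<times> real"
  assumes "finite J"
  shows "(\<lambda>z. sample_orders (insert e J) (z(e := Z))) \<in> PiM J (\<lambda>_. borel) \<rightarrow>\<^sub>M count_space UNIV"
proof (rule measurable_compose[OF _ measurable_sample_orders])
  show "(\<lambda>z. z(e := Z)) \<in> PiM J (\<lambda>_. borel) \<rightarrow>\<^sub>M PiM (insert e J) (\<lambda>_. borel)"
    by (rule measurable_fun_upd[where J = J]) auto
qed (use assms in simp)

lemma PiM_cong_sets: "(\<And>i. i \<in> I \<Longrightarrow> sets (M i) = sets N) \<Longrightarrow> sets (PiM I M) = sets (PiM I (\<lambda>_. N))"
  by (rule sets_PiM_cong) auto

lemma prod_fibers: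
  fixes d :: "nat \<Rightarrow> real"
  assumes I: "finite I" and c: "c \<in> I \<rightarrow>\<^sub>E {0, 1, 2}"
  shows "(\<Prod>i\<in>I. d (c i)) = d 0 ^ card (fiber I c 0) * d 1 ^ card (fiber I c 1) * d 2 ^ card (fiber I c 2)"
proof -
  have "(\<Prod>i\<in>I. d (c i)) = (\<Prod>k\<in>{0, 1, 2}. \<Prod>i\<in>{i \<in> I. c i = k}. d (c i))"
    using I c by (intro prod.group[symmetric]) (auto dest: PiE_mem)
  also have "\<dots> = (\<Prod>k\<in>{0, 1, 2}. d k ^ card (fiber I c k))"
    by (intro prod.cong refl) (simp add: fiber_def)
  finally show ?thesis by (simp add: mult.assoc)
qed

lemma measure_PiM_three_blocks:
  fixes \<mu> :: "nat \<Rightarrow> (real \<times> real) measure" and I :: "'i set"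
  assumes I: "finite I" and c: "c \<in> I \<rightarrow>\<^sub>E {0, 1, 2}"
    and \<mu>: "\<And>k. k \<in> {0, 1, 2} \<Longrightarrow> prob_space (\<mu> k)" "\<And>k. k \<in> {0, 1, 2} \<Longrightarrow> sets (\<mu> k) = sets borel"
    and A: "\<And>k. k \<in> {0, 1, 2} \<Longrightarrow> A k \<in> sets (PiM (fiber I c k) (\<lambda>_. borel))"
  shows "measure (PiM I (\<lambda>i. \<mu> (c i))) {z \<in> space (PiM I (\<lambda>_. borel)).
      restrict z (fiber I c 0) \<in> A 0 \<and> restrict z (fiber I c 1) \<in> A 1 \<and> restrict z (fiber I c 2) \<in> A 2} =
    measure (PiM (fiber I c 0) (\<lambda>_. \<mu> 0)) (A 0) * measure (PiM (fiber I c 1) (\<lambda>_. \<mu> 1)) (A 1) *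
      measure (PiM (fiber I c 2) (\<lambda>_. \<mu> 2)) (A 2)"
proof -
  let ?F = "fiber I c" and ?M = "\<lambda>i. \<mu> (c i)"
  have c3: "c i \<in> {0, 1, 2}" if "i \<in> I" for i using PiE_mem[OF c that] .
  have part: "I = ?F 0 \<union> (?F 1 \<union> ?F 2)"
    using c by (auto simp: fiber_def dest: PiE_mem)
  have disj: "?F 0 \<inter> (?F 1 \<union> ?F 2) = {}" "?F 1 \<inter> ?F 2 = {}" by (auto simp: fiber_def)
  have eq: "PiM (?F k) ?M = PiM (?F k) (\<lambda>_. \<mu> k)" for k
    by (rule PiM_cong) (auto simp: fiber_def)
  have setsM: "sets (PiM J ?M) = sets (PiM J (\<lambda>_. borel))" if "J \<subseteq> I" for J
    using that \<mu>(2) c3 by (intro PiM_cong_sets) auto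
  have spM: "space (PiM J ?M) = space (PiM J (\<lambda>_. borel :: (real \<times> real) measure))" if "J \<subseteq> I" for J
    by (rule sets_eq_imp_space_eq[OF setsM[OF that]])
  have sub: "?F k \<subseteq> I" "?F 1 \<union> ?F 2 \<subseteq> I" for k by (auto simp: fiber_def)
  have A': "A k \<in> sets (PiM (?F k) ?M)" if "k \<in> {0, 1, 2}" for k
    using A[OF that] setsM[OF sub(1)] by simp
  let ?B = "{z \<in> space (PiM (?F 1 \<union> ?F 2) ?M). restrict z (?F 1) \<in> A 1 \<and> restrict z (?F 2) \<in> A 2}"
  have B: "?B \<in> sets (PiM (?F 1 \<union> ?F 2) ?M)"
  proof -
    have restr: "(\<lambda>z. restrict z (?F k)) \<in> PiM (?F 1 \<union> ?F 2) ?M \<rightarrow>\<^sub>M PiM (?F k) ?M" if "k \<in> {1, 2}" for k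
      using that by (intro measurable_restrict_subset) auto
    have pre: "(\<lambda>z. restrict z (?F k)) -` A k \<inter> space (PiM (?F 1 \<union> ?F 2) ?M) \<in> sets (PiM (?F 1 \<union> ?F 2) ?M)"
      if "k \<in> {1, 2}" for k
      by (rule measurable_sets[OF restr[OF that] A']) (use that in auto)
    have "?B = ((\<lambda>z. restrict z (?F 1)) -` A 1 \<inter> space (PiM (?F 1 \<union> ?F 2) ?M)) \<inter>
      ((\<lambda>z. restrict z (?F 2)) -` A 2 \<inter> space (PiM (?F 1 \<union> ?F 2) ?M))" by auto
    then show ?thesis by (simp only:) (rule sets.Int[OF pre pre]; simp)
  qed
  have set_eq: "{z \<in> space (PiM I (\<lambda>_. borel)).
      restrict z (?F 0) \<in> A 0 \<and> restrict z (?F 1) \<in> A 1 \<and> restrict z (?F 2) \<in> A 2} =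
    {z \<in> space (PiM (?F 0 \<union> (?F 1 \<union> ?F 2)) ?M). restrict z (?F 0) \<in> A 0 \<and> restrict z (?F 1 \<union> ?F 2) \<in> ?B}"
  proof -
    have "restrict z (?F 1 \<union> ?F 2) \<in> space (PiM (?F 1 \<union> ?F 2) ?M)" if "z \<in> space (PiM I ?M)" for z
      using measurable_space[OF measurable_restrict_subset[OF sub(2)] that] .
    moreover have "restrict (restrict z (?F 1 \<union> ?F 2)) (?F 1) = restrict z (?F 1)"
      "restrict (restrict z (?F 1 \<union> ?F 2)) (?F 2) = restrict z (?F 2)" for z :: "'i \<Rightarrow> real \<times> real"
      by (auto simp: restrict_def)
    ultimately show ?thesis
      unfolding part[symmetric] spM[OF subset_refl, symmetric] by auto
  qed
  have "emeasure (PiM I ?M) {z \<in> space (PiM I (\<lambda>_. borel)).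
      restrict z (?F 0) \<in> A 0 \<and> restrict z (?F 1) \<in> A 1 \<and> restrict z (?F 2) \<in> A 2} =
    emeasure (PiM (?F 0 \<union> (?F 1 \<union> ?F 2)) ?M)
      {z \<in> space (PiM (?F 0 \<union> (?F 1 \<union> ?F 2)) ?M). restrict z (?F 0) \<in> A 0 \<and> restrict z (?F 1 \<union> ?F 2) \<in> ?B}"
    unfolding set_eq part[symmetric] ..
  also have "\<dots> = emeasure (PiM (?F 0) ?M) (A 0) * emeasure (PiM (?F 1 \<union> ?F 2) ?M) ?B"
    using I c3 \<mu>(1) sub disj A' B by (intro emeasure_PiM_disjoint) (auto simp: fiber_def)
  also have "emeasure (PiM (?F 1 \<union> ?F 2) ?M) ?B = emeasure (PiM (?F 1) ?M) (A 1) * emeasure (PiM (?F 2) ?M) (A 2)"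
    using I c3 \<mu>(1) sub disj A' by (intro emeasure_PiM_disjoint) (auto simp: fiber_def)
  finally show ?thesis
    unfolding measure_def by (simp only: eq enn2real_mult mult.assoc)
qed

text \<open>The marginals are uniform, so they charge neither the complement of the open unit
  interval nor single points; \<open>a\<close> and \<open>b\<close> will be the coordinates of
  \<open>Z\<close>.\<close>

lemma permuton_AE_component:
  assumes "permuton \<mu>"
  shows "AE z in \<mu>. 0 < fst z \<and> fst z < 1 \<and> 0 < snd z \<and> snd z < 1 \<and> fst z \<noteq> a \<and> snd z \<noteq> b"
proof -
  note \<mu> = permuton_marginals[OF assms]
  have null: "AE z in \<mu>. f z \<notin> A"
    if f: "f = fst \<or> f = snd" and A: "A \<in> sets borel" "emeasure lborel ({0..1} \<inter> A) = 0" for f and A :: "real set"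
  proof (rule AE_I)
    have "f \<in> borel \<rightarrow>\<^sub>M borel" using f borel_measurable_fst_snd by auto
    from measurable_sets[OF this A(1)] show "{z. f z \<in> A} \<in> sets \<mu>"
      using \<mu> by (simp add: vimage_def)
    show "emeasure \<mu> {z. f z \<in> A} = 0"
      using emeasure_permuton_strips[OF assms A(1)] A(2) f by auto
    show "{z \<in> space \<mu>. \<not> f z \<notin> A} \<subseteq> {z. f z \<in> A}" by auto
  qed
  have pt: "emeasure lborel ({0..1} \<inter> {t}) = 0" for t :: real
    by (cases "t \<in> {0..1}") auto
  have out: "emeasure lborel ({0..1} \<inter> - {0<..<1::real}) = 0"
  proof -
    have "{0..1} \<inter> - {0<..<1} = {0, 1::real}" by auto
    then show ?thesis by (simp add: emeasure_lborel_countable)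
  qed
  have "AE z in \<mu>. fst z \<notin> - {0<..<1}" "AE z in \<mu>. snd z \<notin> - {0<..<1}"
    "AE z in \<mu>. fst z \<notin> {a}" "AE z in \<mu>. snd z \<notin> {b}"
    by (rule null, simp, simp, simp only: pt out)+
  then show ?thesis by eventually_elim auto
qed

context block_weights
begin

text \<open>Almost surely the sampled points avoid the boundary of the square and both coordinates
  of \<open>Z\<close>, so the orders of the images are spliced from those of the three blocks. The
  blocks are independent, hence the probabilities of their orders multiply.\<close>

lemma integral_orders_block_maps:
  fixes h :: "_ \<Rightarrow> real" and \<mu> :: "nat \<Rightarrow> (real \<times> real) measure" and I :: "'i set"
  assumes I: "finite I" and c: "c \<in> I \<rightarrow>\<^sub>E {0, 1, 2}" and e: "e \<notin> I"
    and \<mu>: "\<And>k. k \<in> {0, 1, 2} \<Longrightarrow> permuton (\<mu> k)"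
    and Z: "0 \<le> fst Z" "fst Z \<le> 1" "0 \<le> snd Z" "snd Z \<le> 1"
  shows "(\<integral>z. h (sample_orders I (\<lambda>i. theta_map d Z s (c i) (z i))) \<partial>PiM I (\<lambda>i. \<mu> (c i))) =
    (\<Sum>(r0, r1, r2)\<in>order_pairs (insert e (fiber I c 0)) \<times> order_pairs (fiber I c 1) \<times> order_pairs (fiber I c 2).
      h (splice_orders I c e s (r0, r1, r2)) * (orders_prob_with (fiber I c 0) e (\<mu> 0) Z r0 *
        orders_prob (fiber I c 1) (\<mu> 1) r1 * orders_prob (fiber I c 2) (\<mu> 2) r2))"
proof -
  let ?F = "fiber I c" and ?M = "\<lambda>i. \<mu> (c i)"
  let ?f = "\<lambda>z. (sample_orders (insert e (?F 0)) (z(e := Z)), sample_orders (?F 1) z, sample_orders (?F 2) z)"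
  let ?S = "order_pairs (insert e (?F 0)) \<times> order_pairs (?F 1) \<times> order_pairs (?F 2)"
  have c3: "c i \<in> {0, 1, 2}" if "i \<in> I" for i using PiE_mem[OF c that] .
  note \<mu>' = permuton_marginals[OF \<mu>]
  have setsM: "sets (PiM I ?M) = sets (PiM I (\<lambda>_. borel))"
    using \<mu>'(2) c3 by (intro PiM_cong_sets) auto
  have spM: "space (PiM I ?M) = space (PiM I (\<lambda>_. borel :: (real \<times> real) measure))"
    by (rule sets_eq_imp_space_eq[OF setsM])
  interpret M: prob_space "PiM I ?M" using c3 \<mu>'(1) by (intro prob_space_PiM) auto
  have sub: "?F k \<subseteq> I" for k by (auto simp: fiber_def)
  have finF: "finite (?F k)" for k using I by simp
  define A where "A r k = {z \<in> space (PiM (?F k) (\<lambda>_. borel :: (real \<times> real) measure)).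
    if k = 0 then sample_orders (insert e (?F 0)) (z(e := Z)) = fst r
    else if k = 1 then sample_orders (?F 1) z = fst (snd r) else sample_orders (?F 2) z = snd (snd r)}" for r k
  have A: "A r k \<in> sets (PiM (?F k) (\<lambda>_. borel))" if "k \<in> {0, 1, 2}" for r k
    using that measurable_sets[OF measurable_add_point[OF finF[of 0], of e Z], of "{fst r}"]
      measurable_sets[OF measurable_sample_orders[OF finF[of 1]], of "{fst (snd r)}"]
      measurable_sets[OF measurable_sample_orders[OF finF[of 2]], of "{snd (snd r)}"]
    by (auto simp: A_def vimage_def Int_def conj_commute)
  have f_iff: "{z \<in> space (PiM I (\<lambda>_. borel)). ?f z = r} = {z \<in> space (PiM I (\<lambda>_. borel)).
      restrict z (?F 0) \<in> A r 0 \<and> restrict z (?F 1) \<in> A r 1 \<and> restrict z (?F 2) \<in> A r 2}" for r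
  proof -
    have "restrict z (?F k) \<in> space (PiM (?F k) (\<lambda>_. borel))" for z :: "'i \<Rightarrow> real \<times> real" and k
      by (auto simp: space_PiM)
    moreover have "sample_orders (insert e (?F 0)) ((restrict z (?F 0))(e := Z)) = sample_orders (insert e (?F 0)) (z(e := Z))"
      "sample_orders (?F k) (restrict z (?F k)) = sample_orders (?F k) z" for z :: "'i \<Rightarrow> real \<times> real" and k
      by (rule sample_orders_cong; auto)+
    ultimately show ?thesis by (auto simp: A_def prod_eq_iff)
  qed
  have prob_f: "measure (PiM I ?M) {z \<in> space (PiM I (\<lambda>_. borel)). ?f z = r} =
    orders_prob_with (?F 0) e (\<mu> 0) Z (fst r) * orders_prob (?F 1) (\<mu> 1) (fst (snd r)) *
      orders_prob (?F 2) (\<mu> 2) (snd (snd r))" for r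
    unfolding f_iff
    by (subst measure_PiM_three_blocks[OF I c \<mu>'(1,2) A])
      (simp_all add: A_def orders_prob_def orders_prob_with_def)
  have finS: "finite ?S" using I by (intro finite_cartesian_product finite_order_pairs) auto
  have f_meas: "?f \<in> PiM I ?M \<rightarrow>\<^sub>M count_space UNIV"
  proof (rule measurable_finite_range[OF finS])
    show "?f z \<in> ?S" for z by (simp add: sample_orders_in)
    fix r
    have "(\<lambda>z. restrict z (?F k)) \<in> PiM I (\<lambda>_. borel) \<rightarrow>\<^sub>M PiM (?F k) (\<lambda>_. borel :: (real \<times> real) measure)" for k
      by (rule measurable_restrict_subset[OF sub])
    then have pre: "(\<lambda>z. restrict z (?F k)) -` A r k \<inter> space (PiM I (\<lambda>_. borel)) \<in> sets (PiM I (\<lambda>_. borel))"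
      if "k \<in> {0, 1, 2}" for k using A[OF that] by (rule measurable_sets)
    have "((\<lambda>z. restrict z (?F 0)) -` A r 0 \<inter> space (PiM I (\<lambda>_. borel))) \<inter>
      (((\<lambda>z. restrict z (?F 1)) -` A r 1 \<inter> space (PiM I (\<lambda>_. borel))) \<inter>
      ((\<lambda>z. restrict z (?F 2)) -` A r 2 \<inter> space (PiM I (\<lambda>_. borel)))) \<in> sets (PiM I (\<lambda>_. borel))"
      by (rule sets.Int[OF pre sets.Int[OF pre pre]]; simp)
    also have "((\<lambda>z. restrict z (?F 0)) -` A r 0 \<inter> space (PiM I (\<lambda>_. borel))) \<inter>
      (((\<lambda>z. restrict z (?F 1)) -` A r 1 \<inter> space (PiM I (\<lambda>_. borel))) \<inter>
      ((\<lambda>z. restrict z (?F 2)) -` A r 2 \<inter> space (PiM I (\<lambda>_. borel)))) =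
      {z \<in> space (PiM I (\<lambda>_. borel)). ?f z = r}"
      unfolding f_iff by auto
    finally show "{z \<in> space (PiM I ?M). ?f z = r} \<in> sets (PiM I ?M)"
      unfolding setsM spM .
  qed
  have "AE z in PiM I ?M. \<forall>i\<in>I. 0 < fst (z i) \<and> fst (z i) < 1 \<and> 0 < snd (z i) \<and> snd (z i) < 1 \<and>
      fst (z i) \<noteq> fst Z \<and> snd (z i) \<noteq> snd Z"
    unfolding AE_finite_all[OF I]
  proof
    fix i assume i: "i \<in> I"
    show "AE z in PiM I ?M. 0 < fst (z i) \<and> fst (z i) < 1 \<and> 0 < snd (z i) \<and> snd (z i) < 1 \<and>
      fst (z i) \<noteq> fst Z \<and> snd (z i) \<noteq> snd Z"
      by (rule AE_PiM_component[where M = ?M and i = i, OF \<mu>'(1)[OF c3] i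
          permuton_AE_component[OF \<mu>[OF c3[OF i]]]])
  qed
  then have AE: "AE z in PiM I ?M. h (sample_orders I (\<lambda>i. theta_map d Z s (c i) (z i))) = h (splice_orders I c e s (?f z))"
  proof eventually_elim
    case (elim z)
    have upd: "(\<lambda>i. fst ((z(e := Z)) i)) = (\<lambda>i. fst (z i))(e := fst Z)"
      "(\<lambda>i. snd ((z(e := Z)) i)) = (\<lambda>i. snd (z i))(e := snd Z)" by auto
    show ?case
      using order_on_line_map[OF c e Z(1,2), of "\<lambda>i. fst (z i)" True]
        order_on_line_map[OF c e Z(3,4), of "\<lambda>i. snd (z i)" s] elim
      by (simp add: sample_orders_def theta_map_def splice_orders_def upd del: fun_upd_apply)
  qed
  have comp: "(\<lambda>z. theta_map d Z s k (z i)) \<in> PiM I (\<lambda>_. borel) \<rightarrow>\<^sub>M borel" if "i \<in> I" for i k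
    using borel_measurable_theta_map by (rule measurable_compose[rotated]) (rule measurable_component_singleton[OF that])
  have "(\<integral>z. h (sample_orders I (\<lambda>i. theta_map d Z s (c i) (z i))) \<partial>PiM I ?M) =
    (\<integral>z. h (splice_orders I c e s (?f z)) \<partial>PiM I ?M)"
  proof (rule integral_cong_AE[OF _ _ AE])
    have "(\<lambda>z. sample_orders I (\<lambda>i\<in>I. theta_map d Z s (c i) (z i))) \<in> PiM I (\<lambda>_. borel) \<rightarrow>\<^sub>M count_space UNIV"
      by (intro measurable_compose[OF _ measurable_sample_orders[OF I]] measurable_restrict comp)
    then have "(\<lambda>z. sample_orders I (\<lambda>i. theta_map d Z s (c i) (z i))) \<in> PiM I (\<lambda>_. borel) \<rightarrow>\<^sub>M count_space UNIV"
      by (subst measurable_cong[where g = "\<lambda>z. sample_orders I (\<lambda>i\<in>I. theta_map d Z s (c i) (z i))"])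
        (auto intro: sample_orders_cong)
    then show "(\<lambda>z. h (sample_orders I (\<lambda>i. theta_map d Z s (c i) (z i)))) \<in> borel_measurable (PiM I ?M)"
      unfolding measurable_cong_sets[OF setsM refl] by (rule measurable_compose) simp
    show "(\<lambda>z. h (splice_orders I c e s (?f z))) \<in> borel_measurable (PiM I ?M)"
      by (rule measurable_compose[OF f_meas]) simp
  qed
  also have "\<dots> = (\<Sum>r\<in>?S. h (splice_orders I c e s r) * measure (PiM I ?M) {z \<in> space (PiM I ?M). ?f z = r})"
    by (rule M.integral_finite_range[OF f_meas finS]) (simp add: sample_orders_in)
  finally show ?thesis unfolding spM prob_f by (simp add: case_prod_unfold)
qed

end

text \<open>Rewrites the mixture as a random choice of component followed by sampling, the form to
  which \<open>PiM_mixture\<close> applies.\<close>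

lemma mixture3_eq_bind:
  assumes \<nu>: "\<And>k. k \<in> {0, 1, 2} \<Longrightarrow> \<nu> k \<in> space (prob_algebra borel)"
  shows "mixture3 (d 0) (\<nu> 0) (d 1) (\<nu> 1) (d 2) (\<nu> (2 :: nat)) =
    point_measure {0, 1, 2} (\<lambda>k. ennreal (d k)) \<bind> \<nu>"
proof -
  let ?M = "point_measure {0, 1, 2} (\<lambda>k. ennreal (d k)) \<bind> \<nu>"
  have sets: "sets ?M = sets borel" by (rule sets_point_measure_bind[OF _ \<nu>]) auto
  have space: "space ?M = UNIV" using sets_eq_imp_space_eq[OF sets] by simp
  have "mixture3 (d 0) (\<nu> 0) (d 1) (\<nu> 1) (d 2) (\<nu> 2) = measure_of UNIV (sets borel) (emeasure ?M)"
    unfolding mixture3_def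
  proof (rule measure_of_eq)
    fix A :: "(real \<times> real) set" assume "A \<in> sigma_sets UNIV (sets borel)"
    then have A: "A \<in> sets borel" using sets.sigma_sets_eq[of "borel :: (real \<times> real) measure"] by simp
    have "emeasure ?M A = (\<Sum>k\<in>{0, 1, 2}. ennreal (d k) * emeasure (\<nu> k) A)"
      by (rule emeasure_point_measure_bind[OF _ _ \<nu> A]) auto
    then show "ennreal (d 0) * emeasure (\<nu> 0) A + ennreal (d 1) * emeasure (\<nu> 1) A +
        ennreal (d 2) * emeasure (\<nu> 2) A = emeasure ?M A"
      by (simp add: add.assoc)
  qed simp
  also have "\<dots> = ?M" using measure_of_of_measure[of ?M] unfolding sets space .
  finally show ?thesis .
qed

definition block_mixture ::
  "(nat \<Rightarrow> real) \<Rightarrow> (nat \<Rightarrow> (real \<times> real) measure) \<Rightarrow> real \<times> real \<Rightarrow> bool \<Rightarrow> (real \<times> real) measure" where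
  "block_mixture d \<mu> Z s = point_measure {0, 1, 2} (\<lambda>k. ennreal (d k)) \<bind>
     (\<lambda>k. distr (\<mu> k) borel (theta_map d Z s k))"

lemma distr_theta_map_in_prob_algebra:
  assumes "\<mu> \<in> space (prob_algebra borel)"
  shows "distr \<mu> borel (theta_map d Z s k) \<in> space (prob_algebra borel)"
proof -
  have \<mu>: "sets \<mu> = sets borel" "prob_space \<mu>" using assms by (auto simp: space_prob_algebra)
  have "theta_map d Z s k \<in> \<mu> \<rightarrow>\<^sub>M borel"
    unfolding measurable_cong_sets[OF \<mu>(1) refl] by (rule borel_measurable_theta_map)
  then show ?thesis using \<mu>(2) by (auto simp: space_prob_algebra intro: prob_space.prob_space_distr)
qed

lemma mixture3_eq_block_mixture:
  assumes \<mu>: "\<And>k. k \<in> {0, 1, 2} \<Longrightarrow> \<mu> k \<in> space (prob_algebra borel)"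
  shows "mixture3 (d 0) (distr (\<mu> 0) borel (theta0 (d 0) Z))
      (d 1) (distr (\<mu> 1) borel (theta1 (d 0) (d 1) (d 2) Z (of_bool (\<not> s))))
      (d 2) (distr (\<mu> 2) borel (theta2 (d 0) (d 1) (d 2) Z (of_bool (\<not> s)))) = block_mixture d \<mu> Z s"
  unfolding block_mixture_def theta_map_eq[of d Z s] theta_map_eq(1)[of d Z s]
  by (rule mixture3_eq_bind) (use \<mu> distr_theta_map_in_prob_algebra in blast)

lemma block_mixture_in_prob_algebra:
  assumes \<mu>: "\<And>k. k \<in> {0, 1, 2} \<Longrightarrow> \<mu> k \<in> space (prob_algebra borel)"
    and d: "\<And>k. k \<in> {0, 1, 2} \<Longrightarrow> 0 \<le> d k" "d 0 + d 1 + d 2 = 1"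
  shows "block_mixture d \<mu> Z s \<in> space (prob_algebra borel)"
proof -
  have "(\<Sum>k\<in>{0, 1, 2}. ennreal (d k)) = ennreal (\<Sum>k\<in>{0, 1, 2}. d k)"
    using d(1) by (intro sum_ennreal) auto
  then have w: "(\<Sum>k\<in>{0, 1, 2}. ennreal (d k)) = 1" using d(2) by (simp add: add.assoc)
  note \<nu> = distr_theta_map_in_prob_algebra[OF \<mu>]
  have "prob_space (block_mixture d \<mu> Z s)"
    unfolding block_mixture_def by (rule prob_space_point_measure_bind[OF _ _ \<nu> w]) auto
  moreover have "sets (block_mixture d \<mu> Z s) = sets borel"
    unfolding block_mixture_def by (rule sets_point_measure_bind[OF _ \<nu>]) auto
  ultimately show ?thesis by (simp add: space_prob_algebra)
qed

lemma permuton_in_prob_algebra: "permuton \<mu> \<Longrightarrow> \<mu> \<in> space (prob_algebra borel)"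
  by (simp add: permuton_def space_prob_algebra)

context block_weights
begin

text \<open>Each coordinate of an image depends on the same coordinate of the point only, through
  \<open>line_map\<close>, so both marginals reduce to \<open>line_map_preserves_uniform\<close>.
  The orientation \<open>f = fst \<or> s\<close> is \<open>True\<close> for the first coordinate and
  \<open>s\<close> for the second.\<close>

lemma permuton_block_mixture:
  assumes \<mu>: "\<And>k. k \<in> {0, 1, 2} \<Longrightarrow> permuton (\<mu> k)"
    and Z: "0 \<le> fst Z" "fst Z \<le> 1" "0 \<le> snd Z" "snd Z \<le> 1"
  shows "permuton (block_mixture d \<mu> Z s)"
proof -
  let ?M = "block_mixture d \<mu> Z s"
  note \<mu>' = permuton_in_prob_algebra[OF \<mu>]
  have "?M \<in> space (prob_algebra borel)"
    using d_pos d_sum by (intro block_mixture_in_prob_algebra[OF \<mu>']) auto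
  then have M: "prob_space ?M" "sets ?M = sets borel" by (auto simp: space_prob_algebra)
  have sp: "space ?M = UNIV" using sets_eq_imp_space_eq[OF M(2)] by simp
  have em: "emeasure ?M B = (\<Sum>k\<in>{0, 1, 2}. ennreal (d k) * emeasure (\<mu> k) {z. theta_map d Z s k z \<in> B})"
    if B: "B \<in> sets borel" for B
  proof -
    have "emeasure ?M B = (\<Sum>k\<in>{0, 1, 2}. ennreal (d k) * emeasure (distr (\<mu> k) borel (theta_map d Z s k)) B)"
      unfolding block_mixture_def
      by (rule emeasure_point_measure_bind[OF _ _ distr_theta_map_in_prob_algebra[OF \<mu>'] B]) auto
    also have "\<dots> = (\<Sum>k\<in>{0, 1, 2}. ennreal (d k) * emeasure (\<mu> k) {z. theta_map d Z s k z \<in> B})"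
    proof (intro sum.cong refl arg_cong2[where f = times])
      fix k :: nat assume k: "k \<in> {0, 1, 2}"
      note \<mu>k = permuton_marginals[OF \<mu>[OF k]]
      have "theta_map d Z s k \<in> \<mu> k \<rightarrow>\<^sub>M borel"
        unfolding measurable_cong_sets[OF \<mu>k(2) refl] by (rule borel_measurable_theta_map)
      then show "emeasure (distr (\<mu> k) borel (theta_map d Z s k)) B = emeasure (\<mu> k) {z. theta_map d Z s k z \<in> B}"
        using B \<mu>k(3) by (simp add: emeasure_distr vimage_def)
    qed
    finally show ?thesis .
  qed
  have line: "{x. line_map d X s' k x \<in> A} \<in> sets borel" if "A \<in> sets borel" for X s' k and A :: "real set"
    using measurable_sets[OF line_map_measurable that] by (simp add: vimage_def)
  have "distr ?M borel f = uniform_measure lborel {0..1}" if f: "f = fst \<or> f = snd" for f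
  proof (rule measure_eqI)
    fix A :: "real set" assume "A \<in> sets (distr ?M borel f)"
    then have A: "A \<in> sets borel" by simp
    have fm: "f \<in> borel \<rightarrow>\<^sub>M borel" using f borel_measurable_fst_snd by auto
    have fM: "f \<in> ?M \<rightarrow>\<^sub>M borel" unfolding measurable_cong_sets[OF M(2) refl] by (rule fm)
    have fA: "{z. f z \<in> A} \<in> sets borel" using measurable_sets[OF fm A] by (simp add: vimage_def)
    have "emeasure (distr ?M borel f) A = emeasure ?M {z. f z \<in> A}"
      using A fM by (simp add: emeasure_distr sp vimage_def)
    also have "\<dots> = (\<Sum>k\<in>{0, 1, 2}. ennreal (d k) * emeasure (\<mu> k) {z. theta_map d Z s k z \<in> {z. f z \<in> A}})"
      by (rule em[OF fA])
    also have "\<dots> = (\<Sum>k\<in>{0, 1, 2}. ennreal (d k) *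
      emeasure lborel ({0..1} \<inter> {x. line_map d (f Z) (f = fst \<or> s) k x \<in> A}))"
    proof (intro sum.cong refl arg_cong2[where f = times])
      fix k :: nat assume k: "k \<in> {0, 1, 2}"
      have "fst \<noteq> (snd :: real \<times> real \<Rightarrow> real)" by (auto simp: fun_eq_iff)
      then have "{z. theta_map d Z s k z \<in> {z. f z \<in> A}} = {z. f z \<in> {x. line_map d (f Z) (f = fst \<or> s) k x \<in> A}}"
        using f by (auto simp: theta_map_def)
      then show "emeasure (\<mu> k) {z. theta_map d Z s k z \<in> {z. f z \<in> A}} =
        emeasure lborel ({0..1} \<inter> {x. line_map d (f Z) (f = fst \<or> s) k x \<in> A})"
        using emeasure_permuton_strips[OF \<mu>[OF k] line[OF A]] f by auto
    qed
    also have "\<dots> = emeasure lborel ({0..1} \<inter> A)"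
      by (rule line_map_preserves_uniform[OF _ _ A]) (use f Z in auto)
    also have "\<dots> = emeasure (uniform_measure lborel {0..1}) A"
      using A by (simp add: emeasure_uniform_measure divide_ennreal_def)
    finally show "emeasure (distr ?M borel f) A = emeasure (uniform_measure lborel {0..1}) A" .
  qed simp
  then show ?thesis using M by (simp add: permuton_def)
qed

lemma integral_orders_block_mixture:
  fixes h :: "_ \<Rightarrow> real" and \<mu> :: "nat \<Rightarrow> (real \<times> real) measure" and I :: "'i set"
  assumes I: "finite I" and e: "e \<notin> I"
    and \<mu>: "\<And>k. k \<in> {0, 1, 2} \<Longrightarrow> permuton (\<mu> k)"
    and Z: "0 \<le> fst Z" "fst Z \<le> 1" "0 \<le> snd Z" "snd Z \<le> 1"
  shows "(\<integral>z. h (sample_orders I z) \<partial>PiM I (\<lambda>_. block_mixture d \<mu> Z s)) =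
    (\<Sum>c\<in>I \<rightarrow>\<^sub>E {0, 1, 2}.
      (d 0 ^ card (fiber I c 0) * d 1 ^ card (fiber I c 1) * d 2 ^ card (fiber I c 2)) *
      (\<Sum>(r0, r1, r2)\<in>order_pairs (insert e (fiber I c 0)) \<times> order_pairs (fiber I c 1) \<times> order_pairs (fiber I c 2).
        h (splice_orders I c e s (r0, r1, r2)) * (orders_prob_with (fiber I c 0) e (\<mu> 0) Z r0 *
          orders_prob (fiber I c 1) (\<mu> 1) r1 * orders_prob (fiber I c 2) (\<mu> 2) r2)))"
proof -
  have "(\<integral>z. h (sample_orders I z) \<partial>PiM I (\<lambda>_. block_mixture d \<mu> Z s)) =
    (\<Sum>c\<in>I \<rightarrow>\<^sub>E {0, 1, 2}. (\<Prod>i\<in>I. d (c i)) *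
      (\<integral>z. h (sample_orders I (\<lambda>i. theta_map d Z s (c i) (z i))) \<partial>PiM I (\<lambda>i. \<mu> (c i))))"
    unfolding block_mixture_def
  proof (rule integral_PiM_mixture)
    show "(\<Sum>k\<in>{0, 1, 2}. d k) = 1" using d_sum by (simp add: add.assoc)
    show "0 \<le> d k" if "k \<in> {0, 1, 2}" for k using that d_pos by auto
    show "prob_space (\<mu> k)" "sets (\<mu> k) = sets borel" if "k \<in> {0, 1, 2}" for k
      by (rule permuton_marginals[OF \<mu>[OF that]])+
    show "theta_map d Z s k \<in> borel \<rightarrow>\<^sub>M borel" for k by (rule borel_measurable_theta_map)
  qed (use I in auto)
  also have "\<dots> = (\<Sum>c\<in>I \<rightarrow>\<^sub>E {0, 1, 2}.
      (d 0 ^ card (fiber I c 0) * d 1 ^ card (fiber I c 1) * d 2 ^ card (fiber I c 2)) *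
      (\<Sum>(r0, r1, r2)\<in>order_pairs (insert e (fiber I c 0)) \<times> order_pairs (fiber I c 1) \<times> order_pairs (fiber I c 2).
        h (splice_orders I c e s (r0, r1, r2)) * (orders_prob_with (fiber I c 0) e (\<mu> 0) Z r0 *
          orders_prob (fiber I c 1) (\<mu> 1) r1 * orders_prob (fiber I c 2) (\<mu> 2) r2)))"
    by (intro sum.cong refl arg_cong2[where f = times] prod_fibers I integral_orders_block_maps[OF I _ e \<mu> Z])
  finally show ?thesis .
qed

end

section \<open>Laws of the ingredients\<close>

text \<open>Turns the description of \<open>Z\<close> by conditional expectations into a joint law:
  draw a measure, then a point from it. Integrating the conditional probability of \<open>B\<close>
  over the event that \<open>\<mu>\<close> lies in \<open>D\<close> yields the rectangles
  \<open>D \<times> B\<close>, which determine the law.\<close>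

lemma distr_random_point:
  assumes M: "prob_space M" and \<mu> [measurable]: "\<mu> \<in> M \<rightarrow>\<^sub>M prob_algebra borel" and Z: "random_point_of M \<mu> Z"
  shows "distr M (prob_algebra borel \<Otimes>\<^sub>M borel) (\<lambda>\<omega>. (\<mu> \<omega>, Z \<omega>)) =
    distr M (prob_algebra borel) \<mu> \<bind> (\<lambda>m. distr m (prob_algebra borel \<Otimes>\<^sub>M borel) (\<lambda>z. (m, z)))"
    (is "?L = _")
proof -
  interpret prob_space M by (rule M)
  let ?P = "distr M (prob_algebra borel) \<mu>"
    and ?K = "\<lambda>m :: (real \<times> real) measure. distr m (prob_algebra borel \<Otimes>\<^sub>M borel) (\<lambda>z. (m, z))"
  let ?N = "prob_algebra (borel :: (real \<times> real) measure)"
  have [measurable]: "Z \<in> borel_measurable M" using Z by (simp add: random_point_of_def)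
  have K: "?K \<in> ?N \<rightarrow>\<^sub>M prob_algebra (?N \<Otimes>\<^sub>M borel)"
    by (rule measurable_distr_prob_space2[where M = borel]) auto
  have P: "?P \<in> space (prob_algebra ?N)"
    using prob_space_distr[OF \<mu>] by (simp add: space_prob_algebra)
  let ?F = "vimage_algebra (space M) \<mu> ?N"
  have sub: "subalgebra M ?F"
    unfolding subalgebra_def using measurable_space[OF \<mu>]
    by (auto simp: sets_vimage_algebra2 intro!: measurable_sets)
  interpret F: finite_measure_subalgebra M ?F
    by unfold_locales (rule sub)
  show ?thesis
  proof (rule measure_eqI_generator_eq[where E = "{D \<times> B | D B. D \<in> sets ?N \<and> B \<in> sets (borel :: (real \<times> real) measure)}"
        and \<Omega> = "space ?N \<times> UNIV" and A = "\<lambda>_. space ?N \<times> UNIV"])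
    show "(\<Union>i :: nat. space ?N \<times> UNIV) = space ?N \<times> (UNIV :: (real \<times> real) set)" by blast
    show "Int_stable {D \<times> B | D B. D \<in> sets ?N \<and> B \<in> sets (borel :: (real \<times> real) measure)}"
      by (rule Int_stable_pair_measure_generator)
    show "{D \<times> B | D B. D \<in> sets ?N \<and> B \<in> sets (borel :: (real \<times> real) measure)} \<subseteq> Pow (space ?N \<times> UNIV)"
      using sets.sets_into_space by blast
    show "sets ?L = sigma_sets (space ?N \<times> UNIV) {D \<times> B | D B. D \<in> sets ?N \<and> B \<in> sets borel}"
      by (simp add: sets_pair_measure)
    show "sets (?P \<bind> ?K) = sigma_sets (space ?N \<times> UNIV) {D \<times> B | D B. D \<in> sets ?N \<and> B \<in> sets borel}"
      unfolding sets_bind'[OF P K] by (simp add: sets_pair_measure)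
    have top: "space ?N \<times> UNIV \<in> {D \<times> B | D B. D \<in> sets ?N \<and> B \<in> sets (borel :: (real \<times> real) measure)}"
      by (intro CollectI exI[of _ "space ?N"] exI[of _ UNIV]) simp
    show "range (\<lambda>_ :: nat. space ?N \<times> UNIV) \<subseteq>
        {D \<times> B | D B. D \<in> sets ?N \<and> B \<in> sets (borel :: (real \<times> real) measure)}"
      by (rule image_subsetI) (rule top)
    show "emeasure ?L (space ?N \<times> UNIV) \<noteq> \<infinity>"
    proof -
      interpret L: prob_space ?L by (rule prob_space_distr) measurable
      show ?thesis by simp
    qed
    fix X assume "X \<in> {D \<times> B | D B. D \<in> sets ?N \<and> B \<in> sets (borel :: (real \<times> real) measure)}"
    then obtain D B where X: "X = D \<times> B" and [measurable]: "D \<in> sets ?N" "B \<in> sets borel" by auto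
    \<comment> \<open>The event belongs to the sigma-algebra generated by \<open>\<mu>\<close>,
      which allows replacing the indicator by its conditional expectation under the
      integral.\<close>
    have D: "\<mu> -` D \<inter> space M \<in> sets ?F" by (rule in_vimage_algebra) simp
    have int: "integrable M (\<lambda>\<omega>. indicator B (Z \<omega>) :: real)"
      by (intro integrable_const_bound[of _ 1]) auto
    have "measure M (\<mu> -` D \<inter> Z -` B \<inter> space M) = (\<integral>\<omega>\<in>\<mu> -` D \<inter> space M. indicator B (Z \<omega>) \<partial>M)"
      unfolding set_lebesgue_integral_def
    proof -
      have "measure M (\<mu> -` D \<inter> Z -` B \<inter> space M) =
        (\<integral>\<omega>. indicator (\<mu> -` D \<inter> Z -` B \<inter> space M) \<omega> \<partial>M)"
        by (simp add: Int_assoc)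
      also have "\<dots> = (\<integral>\<omega>. indicator (\<mu> -` D \<inter> space M) \<omega> *\<^sub>R indicator B (Z \<omega>) \<partial>M)"
        by (intro Bochner_Integration.integral_cong) (auto simp: indicator_def)
      finally show "measure M (\<mu> -` D \<inter> Z -` B \<inter> space M) =
        (\<integral>\<omega>. indicator (\<mu> -` D \<inter> space M) \<omega> *\<^sub>R indicator B (Z \<omega>) \<partial>M)" .
    qed
    also have "\<dots> = (\<integral>\<omega>\<in>\<mu> -` D \<inter> space M. real_cond_exp M ?F (\<lambda>\<omega>. indicator B (Z \<omega>)) \<omega> \<partial>M)"
      by (rule F.real_cond_exp_intA[OF int D])
    also have "\<dots> = (\<integral>\<omega>. indicator D (\<mu> \<omega>) * measure (\<mu> \<omega>) B \<partial>M)"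
      unfolding set_lebesgue_integral_def
    proof (rule integral_cong_AE)
      have "AE \<omega> in M. real_cond_exp M ?F (\<lambda>\<omega>. indicator B (Z \<omega>)) \<omega> = measure (\<mu> \<omega>) B"
        using Z by (simp add: random_point_of_def)
      then show "AE \<omega> in M. indicat_real (\<mu> -` D \<inter> space M) \<omega> *\<^sub>R real_cond_exp M ?F (\<lambda>\<omega>. indicator B (Z \<omega>)) \<omega> =
          indicator D (\<mu> \<omega>) * measure (\<mu> \<omega>) B"
        by (rule AE_mp) (auto intro!: AE_I2 simp: indicator_def)
      have "(\<lambda>m. measure m B) \<in> borel_measurable ?N" by (rule measurable_measure_prob_algebra) simp
      from measurable_compose[OF \<mu> this]
      show "(\<lambda>\<omega>. indicator D (\<mu> \<omega>) * measure (\<mu> \<omega>) B) \<in> borel_measurable M" by simp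
    qed (use D sub in \<open>auto simp: subalgebra_def\<close>)
    finally have real_eq: "measure M (\<mu> -` D \<inter> Z -` B \<inter> space M) = (\<integral>\<omega>. indicator D (\<mu> \<omega>) * measure (\<mu> \<omega>) B \<partial>M)" .
    have meas_B: "(\<lambda>m. measure m B) \<in> borel_measurable ?N" by (rule measurable_measure_prob_algebra) simp
    have "emeasure ?L X = emeasure M (\<mu> -` D \<inter> Z -` B \<inter> space M)"
      unfolding X by (subst emeasure_distr) (auto intro!: arg_cong[where f = "emeasure M"])
    also have "\<dots> = ennreal (\<integral>\<omega>. indicator D (\<mu> \<omega>) * measure (\<mu> \<omega>) B \<partial>M)"
      by (simp add: emeasure_eq_measure real_eq)
    also have "\<dots> = (\<integral>\<^sup>+\<omega>. ennreal (indicator D (\<mu> \<omega>) * measure (\<mu> \<omega>) B) \<partial>M)"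
    proof (rule nn_integral_eq_integral[symmetric])
      show "integrable M (\<lambda>\<omega>. indicator D (\<mu> \<omega>) * measure (\<mu> \<omega>) B)"
      proof (rule integrable_const_bound[of _ 1])
        show "AE \<omega> in M. norm (indicator D (\<mu> \<omega>) * measure (\<mu> \<omega>) B) \<le> 1"
        proof (rule AE_I2)
          fix \<omega> assume "\<omega> \<in> space M"
          then have "prob_space (\<mu> \<omega>)" using measurable_space[OF \<mu>] by (auto simp: space_prob_algebra)
          from prob_space.prob_le_1[OF this, of B]
          show "norm (indicator D (\<mu> \<omega>) * measure (\<mu> \<omega>) B) \<le> 1" by (simp add: indicator_def)
        qed
      qed (use measurable_compose[OF \<mu> meas_B] in simp)
    qed simp
    also have "\<dots> = (\<integral>\<^sup>+m. ennreal (indicator D m * measure m B) \<partial>?P)"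
      using meas_B by (subst nn_integral_distr) auto
    also have "\<dots> = (\<integral>\<^sup>+m. emeasure (?K m) X \<partial>?P)"
    proof (rule nn_integral_cong)
      fix m assume "m \<in> space ?P"
      then have m: "m \<in> space ?N" by simp
      then have m': "prob_space m" "sets m = sets borel" by (auto simp: space_prob_algebra)
      have "(\<lambda>z. (m, z)) \<in> borel \<rightarrow>\<^sub>M ?N \<Otimes>\<^sub>M borel" using m by simp
      then have "(\<lambda>z. (m, z)) \<in> m \<rightarrow>\<^sub>M ?N \<Otimes>\<^sub>M borel"
        unfolding measurable_cong_sets[OF m'(2) refl] .
      then have "emeasure (?K m) X = emeasure m ((\<lambda>z. (m, z)) -` (D \<times> B) \<inter> space m)"
        unfolding X by (rule emeasure_distr) simp
      also have "(\<lambda>z. (m, z)) -` (D \<times> B) \<inter> space m = (if m \<in> D then B else {})"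
        using sets_eq_imp_space_eq[OF m'(2)] by auto
      also have "emeasure m \<dots> = ennreal (indicator D m * measure m B)"
        using finite_measure.emeasure_eq_measure[OF prob_space.finite_measure[OF m'(1)]]
        by (simp add: indicator_def)
      finally show "ennreal (indicator D m * measure m B) = emeasure (?K m) X" by simp
    qed
    also have "\<dots> = emeasure (?P \<bind> ?K) X"
      by (rule emeasure_bind_prob_algebra[OF P K, symmetric]) (simp add: X)
    finally show "emeasure ?L X = emeasure (?P \<bind> ?K) X" .
  qed
qed

lemma sets_orders_eq:
  assumes "finite J"
  shows "{z \<in> space (PiM J (\<lambda>_. borel)). sample_orders J z = r} \<in> sets (PiM J (\<lambda>_. borel))"
  using measurable_sets[OF measurable_sample_orders[OF assms], of "{r}"]
  by (simp add: vimage_def Int_def conj_commute)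

lemma orders_prob_measurable:
  assumes "finite J"
  shows "(\<lambda>\<mu>. orders_prob J \<mu> r) \<in> borel_measurable (prob_algebra borel)"
  unfolding orders_prob_def
  by (rule measurable_compose[OF measurable_PiM_kernel[OF assms]
        measurable_measure_prob_algebra[OF sets_orders_eq[OF assms]]])

text \<open>The kernel \<open>PiM\<close> varies with the random measure and the event with the
  random point, so measurability comes from an event in the product of all three spaces and its
  sections.\<close>

lemma measurable_emeasure_orders_with:
  fixes r :: "('i \<times> 'i) set \<times> ('i \<times> 'i) set"
  assumes J: "finite J"
  shows "(\<lambda>w. emeasure (PiM J (\<lambda>_. fst w)) {z \<in> space (PiM J (\<lambda>_. borel)).
      sample_orders (insert e J) (z(e := snd w)) = r}) \<in> borel_measurable (prob_algebra borel \<Otimes>\<^sub>M borel)"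
proof (rule emeasure_measurable_subprob_algebra2)
  let ?N = "prob_algebra borel \<Otimes>\<^sub>M borel :: ((real \<times> real) measure \<times> (real \<times> real)) measure"
  show "(\<lambda>w. PiM J (\<lambda>_. fst w)) \<in> ?N \<rightarrow>\<^sub>M subprob_algebra (PiM J (\<lambda>_. borel))"
    by (rule measurable_prob_algebraD[OF measurable_compose[OF measurable_fst measurable_PiM_kernel[OF J]]])
  have "(\<lambda>v. (snd v)(e := snd (fst v))) \<in> ?N \<Otimes>\<^sub>M PiM J (\<lambda>_. borel) \<rightarrow>\<^sub>M PiM (insert e J) (\<lambda>_. borel)"
    by (rule measurable_fun_upd[where J = J]) auto
  then have "(\<lambda>v. sample_orders (insert e J) ((snd v)(e := snd (fst v)))) \<in>
      ?N \<Otimes>\<^sub>M PiM J (\<lambda>_. borel) \<rightarrow>\<^sub>M count_space UNIV"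
    by (rule measurable_compose[OF _ measurable_sample_orders]) (use J in simp)
  from measurable_sets[OF this, of "{r}"]
  show "Sigma (space ?N) (\<lambda>w. {z \<in> space (PiM J (\<lambda>_. borel)). sample_orders (insert e J) (z(e := snd w)) = r})
      \<in> sets (?N \<Otimes>\<^sub>M PiM J (\<lambda>_. borel))"
    by (rule back_subst[of "\<lambda>A. A \<in> sets _"]) (auto simp: space_pair_measure)
qed

lemma orders_prob_with_measurable:
  assumes "finite J"
  shows "(\<lambda>w. orders_prob_with J e (fst w) (snd w) r) \<in> borel_measurable (prob_algebra borel \<Otimes>\<^sub>M borel)"
  using borel_measurable_enn2real[OF measurable_emeasure_orders_with[OF assms]]
  by (simp add: orders_prob_with_def measure_def)

lemma orders_prob_bounds:
  assumes "\<mu> \<in> space (prob_algebra borel)"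
  shows "0 \<le> orders_prob J \<mu> r" "orders_prob J \<mu> r \<le> 1"
    "0 \<le> orders_prob_with J e \<mu> Z r" "orders_prob_with J e \<mu> Z r \<le> 1"
proof -
  have "prob_space (PiM J (\<lambda>_. \<mu>))" using assms by (intro prob_space_PiM) (simp add: space_prob_algebra)
  then show "0 \<le> orders_prob J \<mu> r" "orders_prob J \<mu> r \<le> 1"
    "0 \<le> orders_prob_with J e \<mu> Z r" "orders_prob_with J e \<mu> Z r \<le> 1"
    by (simp_all add: orders_prob_def orders_prob_with_def prob_space.prob_le_1)
qed

context random_measure_law
begin

definition order_law :: "'i set \<Rightarrow> ('i \<times> 'i) set \<times> ('i \<times> 'i) set \<Rightarrow> real" where
  "order_law J r = measure (sample_law J P) {z \<in> space (PiM J (\<lambda>_. borel)). sample_orders J z = r}"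

lemma sum_order_law:
  assumes J: "finite J"
  shows "(\<Sum>r\<in>order_pairs J. h r * order_law J r) = (\<integral>z. h (sample_orders J z) \<partial>sample_law J P)"
proof -
  interpret S: prob_space "sample_law J P" by (rule prob_space_sample_law[OF J])
  have "sample_orders J \<in> sample_law J P \<rightarrow>\<^sub>M count_space UNIV"
    unfolding measurable_cong_sets[OF sets_sample_law[OF J] refl] by (rule measurable_sample_orders[OF J])
  from S.integral_finite_range[OF this finite_order_pairs[OF J] sample_orders_in]
  show ?thesis by (simp add: order_law_def space_sample_law[OF J])
qed

text \<open>A subsample of a sample is again a sample. In this form the points labelled
  \<open>a\<close> and \<open>b\<close> are added and forgotten.\<close>

lemma integral_orders_restrict:
  fixes h :: "_ \<Rightarrow> real"
  assumes K: "finite K" and JK: "J \<subseteq> K"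
  shows "(\<integral>z. h (sample_orders J z) \<partial>sample_law J P) =
    (\<integral>z. h (fst (sample_orders K z) \<inter> J \<times> J, snd (sample_orders K z) \<inter> J \<times> J) \<partial>sample_law K P)"
proof -
  have J: "finite J" using K JK by (rule finite_subset[rotated])
  have "(\<integral>z. h (sample_orders J z) \<partial>sample_law J P) =
    (\<integral>z. h (sample_orders J z) \<partial>distr (sample_law K P) (PiM J (\<lambda>_. borel)) (\<lambda>z. \<lambda>i\<in>J. z i))"
    using distr_sample_law_reindex[of "\<lambda>i. i" J K] JK K by (simp add: subset_eq Pi_iff)
  also have "\<dots> = (\<integral>z. h (sample_orders J (\<lambda>i\<in>J. z i)) \<partial>sample_law K P)"
  proof (rule integral_distr)
    show "(\<lambda>z. \<lambda>i\<in>J. z i) \<in> sample_law K P \<rightarrow>\<^sub>M PiM J (\<lambda>_. borel)"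
      unfolding measurable_cong_sets[OF sets_sample_law[OF K] refl]
      using JK by (intro measurable_restrict measurable_component_singleton) auto
    show "(\<lambda>z. h (sample_orders J z)) \<in> borel_measurable (PiM J (\<lambda>_. borel))"
      by (rule measurable_compose[OF measurable_sample_orders[OF J]]) simp
  qed
  also have "\<dots> = (\<integral>z. h (fst (sample_orders K z) \<inter> J \<times> J, snd (sample_orders K z) \<inter> J \<times> J) \<partial>sample_law K P)"
    using JK by (intro Bochner_Integration.integral_cong refl arg_cong[where f = h])
      (auto simp: sample_orders_def order_on_def)
  finally show ?thesis .
qed

lemma expectation_orders_prob:
  assumes M: "prob_space M" and \<mu>: "\<mu> \<in> M \<rightarrow>\<^sub>M prob_algebra borel" and law: "distr M (prob_algebra borel) \<mu> = P"
    and J: "finite J"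
  shows "(\<integral>\<omega>. orders_prob J (\<mu> \<omega>) r \<partial>M) = order_law J r"
proof -
  let ?O = "{z \<in> space (PiM J (\<lambda>_. borel :: (real \<times> real) measure)). sample_orders J z = r}"
  have "(\<integral>\<omega>. orders_prob J (\<mu> \<omega>) r \<partial>M) = (\<integral>m. orders_prob J m r \<partial>P)"
    unfolding law[symmetric] by (rule integral_distr[OF \<mu> orders_prob_measurable[OF J], symmetric])
  also have "\<dots> = (\<integral>m. measure (PiM J (\<lambda>_. m)) ?O \<partial>P)"
    by (simp add: orders_prob_def)
  also have "\<dots> = measure (sample_law J P) ?O"
    unfolding sample_law_def
    by (rule subprob_space.measure_bind[symmetric, OF prob_space_imp_subprob_space[OF prob_P]
          measurable_prob_algebraD[OF kernel[OF J]] sets_orders_eq[OF J]])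
  finally show ?thesis by (simp add: order_law_def)
qed

text \<open>Given the random measure, \<open>Z\<close> is distributed like a point sampled from it,
  and the remaining points are sampled independently of it. By Fubini the average is the law of a
  sample with one more point, labelled \<open>e\<close>.\<close>

lemma expectation_orders_prob_with:
  fixes J :: "'i set"
  assumes M: "prob_space M" and \<mu>: "\<mu> \<in> M \<rightarrow>\<^sub>M prob_algebra borel" and law: "distr M (prob_algebra borel) \<mu> = P"
    and Z: "random_point_of M \<mu> Z" and J: "finite J" and e: "e \<notin> J"
  shows "(\<integral>\<omega>. orders_prob_with J e (\<mu> \<omega>) (Z \<omega>) r \<partial>M) = order_law (insert e J) r"
proof -
  let ?N = "prob_algebra (borel :: (real \<times> real) measure)"
  let ?B = "\<lambda>Z. {z \<in> space (PiM J (\<lambda>_. borel)). sample_orders (insert e J) (z(e := Z)) = r}"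
  let ?O = "{z \<in> space (PiM (insert e J) (\<lambda>_. borel :: (real \<times> real) measure)). sample_orders (insert e J) z = r}"
  let ?g = "\<lambda>w. emeasure (PiM J (\<lambda>_. fst w)) (?B (snd w))"
  let ?K = "\<lambda>m. distr m (?N \<Otimes>\<^sub>M borel) (\<lambda>z. (m, z))"
  have J': "finite (insert e J)" using J by simp
  have g: "?g \<in> borel_measurable (?N \<Otimes>\<^sub>M borel)" by (rule measurable_emeasure_orders_with[OF J])
  have \<mu>Z: "(\<lambda>\<omega>. (\<mu> \<omega>, Z \<omega>)) \<in> M \<rightarrow>\<^sub>M ?N \<Otimes>\<^sub>M borel"
    using \<mu> Z by (intro measurable_Pair) (auto simp: random_point_of_def)
  have K: "?K \<in> ?N \<rightarrow>\<^sub>M prob_algebra (?N \<Otimes>\<^sub>M borel)"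
    by (rule measurable_distr_prob_space2[where M = borel]) auto
  then have KP: "?K \<in> P \<rightarrow>\<^sub>M subprob_algebra (?N \<Otimes>\<^sub>M borel)"
    unfolding measurable_cong_sets[OF sets_P refl] by (rule measurable_prob_algebraD)
  have inner: "(\<integral>\<^sup>+w. ?g w \<partial>?K m) = emeasure (PiM (insert e J) (\<lambda>_. m)) ?O" if "m \<in> space P" for m
  proof -
    have mN: "m \<in> space ?N" using that by (simp add: space_P)
    then have m: "prob_space m" "sets m = sets borel" by (auto simp: space_prob_algebra)
    interpret product_sigma_finite "\<lambda>_. m"
      using m(1) by (simp add: product_sigma_finite_def prob_space_imp_sigma_finite)
    have sets: "sets (PiM F (\<lambda>_. m)) = sets (PiM F (\<lambda>_. borel))" for F :: "'i set"
      using m(2) by (intro PiM_cong_sets)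
    note space = sets_eq_imp_space_eq[OF sets]
    have Om: "?O \<in> sets (PiM (insert e J) (\<lambda>_. m))" unfolding sets by (rule sets_orders_eq[OF J'])
    have "(\<lambda>z. (m, z)) \<in> borel \<rightarrow>\<^sub>M ?N \<Otimes>\<^sub>M borel" using mN by simp
    then have pair: "(\<lambda>z. (m, z)) \<in> m \<rightarrow>\<^sub>M ?N \<Otimes>\<^sub>M borel" unfolding measurable_cong_sets[OF m(2) refl] .
    have "(\<integral>\<^sup>+w. ?g w \<partial>?K m) = (\<integral>\<^sup>+z. emeasure (PiM J (\<lambda>_. m)) (?B z) \<partial>m)"
      using g by (subst nn_integral_distr[OF pair]) simp_all
    also have "\<dots> = (\<integral>\<^sup>+z. (\<integral>\<^sup>+x. indicator ?O (x(e := z)) \<partial>PiM J (\<lambda>_. m)) \<partial>m)"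
    proof (rule nn_integral_cong)
      fix z
      have "?B z \<in> sets (PiM J (\<lambda>_. m))"
        unfolding sets using measurable_sets[OF measurable_add_point[OF J], of "{r}" e z]
        by (simp add: vimage_def Int_def conj_commute)
      then have "emeasure (PiM J (\<lambda>_. m)) (?B z) = (\<integral>\<^sup>+x. indicator (?B z) x \<partial>PiM J (\<lambda>_. m))" by simp
      also have "\<dots> = (\<integral>\<^sup>+x. indicator ?O (x(e := z)) \<partial>PiM J (\<lambda>_. m))"
        by (intro nn_integral_cong) (auto simp: space indicator_def space_PiM PiE_iff extensional_def)
      finally show "emeasure (PiM J (\<lambda>_. m)) (?B z) = (\<integral>\<^sup>+x. indicator ?O (x(e := z)) \<partial>PiM J (\<lambda>_. m))" .
    qed
    also have "\<dots> = (\<integral>\<^sup>+x. indicator ?O x \<partial>PiM (insert e J) (\<lambda>_. m))"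
      using Om by (intro product_nn_integral_insert_rev[OF J e, symmetric]) simp
    finally show ?thesis using Om by simp
  qed
  have "(\<integral>\<^sup>+\<omega>. ?g (\<mu> \<omega>, Z \<omega>) \<partial>M) = (\<integral>\<^sup>+w. ?g w \<partial>(P \<bind> ?K))"
    unfolding law[symmetric] distr_random_point[OF M \<mu> Z, symmetric]
    by (rule nn_integral_distr[OF \<mu>Z, symmetric]) (use g in simp)
  also have "\<dots> = (\<integral>\<^sup>+m. emeasure (PiM (insert e J) (\<lambda>_. m)) ?O \<partial>P)"
    unfolding nn_integral_bind[OF g KP] by (rule nn_integral_cong) (rule inner)
  also have "\<dots> = emeasure (sample_law (insert e J) P) ?O"
    unfolding sample_law_def
    by (rule emeasure_bind[symmetric, OF P.not_empty measurable_prob_algebraD[OF kernel[OF J']] sets_orders_eq[OF J']])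
  finally have nn: "(\<integral>\<^sup>+\<omega>. ?g (\<mu> \<omega>, Z \<omega>) \<partial>M) = emeasure (sample_law (insert e J) P) ?O" .
  have "(\<integral>\<omega>. orders_prob_with J e (\<mu> \<omega>) (Z \<omega>) r \<partial>M) =
    enn2real (\<integral>\<^sup>+\<omega>. ennreal (orders_prob_with J e (\<mu> \<omega>) (Z \<omega>) r) \<partial>M)"
  proof (rule integral_eq_nn_integral)
    show "(\<lambda>\<omega>. orders_prob_with J e (\<mu> \<omega>) (Z \<omega>) r) \<in> borel_measurable M"
      using measurable_compose[OF \<mu>Z orders_prob_with_measurable[OF J]] by simp
  qed (simp add: orders_prob_with_def)
  also have "(\<integral>\<^sup>+\<omega>. ennreal (orders_prob_with J e (\<mu> \<omega>) (Z \<omega>) r) \<partial>M) = (\<integral>\<^sup>+\<omega>. ?g (\<mu> \<omega>, Z \<omega>) \<partial>M)"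
  proof (rule nn_integral_cong)
    fix \<omega> assume "\<omega> \<in> space M"
    then have "prob_space (PiM J (\<lambda>_. \<mu> \<omega>))"
      using measurable_space[OF \<mu>] by (intro prob_space_PiM) (auto simp: space_prob_algebra)
    then show "ennreal (orders_prob_with J e (\<mu> \<omega>) (Z \<omega>) r) = ?g (\<mu> \<omega>, Z \<omega>)"
      by (simp add: orders_prob_with_def finite_measure.emeasure_eq_measure prob_space.finite_measure)
  qed
  finally show ?thesis unfolding nn by (simp add: order_law_def measure_def)
qed

end

section \<open>The law of the orders for the Brownian separable permuton\<close>

locale brownian_separable = random_permuton +
  fixes p :: real
  assumes p: "0 < p" "p < 1" and brownian: "brownian_separable_law p P"
begin

lemma sum_order_law_trees:
  fixes h :: "_ \<Rightarrow> real" and J :: "nat set"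
  assumes "finite J" "J \<noteq> {}"
  shows "(\<Sum>r\<in>order_pairs J. h r * order_law J r) =
    (\<Sum>t\<in>labelled_trees J. sign_weight p t * h (tree_orders t)) / tree_mass p J"
  unfolding sum_order_law[OF assms(1)] by (rule brownian_separable_orders[OF p brownian assms])

text \<open>Represents the orders by trees with one forgotten leaf. This also covers an empty block,
  to which no tree corresponds without the additional leaf.\<close>

lemma sum_order_law_trees_insert:
  fixes h :: "_ \<Rightarrow> real" and J :: "nat set"
  assumes J: "finite J"
  shows "(\<Sum>r\<in>order_pairs J. h r * order_law J r) =
    (\<Sum>t\<in>labelled_trees (insert a J). sign_weight p t *
      h (tree_order (\<lambda>_. True) t \<inter> J \<times> J, tree_order id t \<inter> J \<times> J)) / tree_mass p (insert a J)"
proof -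
  have J': "finite (insert a J)" "insert a J \<noteq> {}" using J by auto
  have "(\<Sum>r\<in>order_pairs J. h r * order_law J r) =
    (\<integral>z. h (fst (sample_orders (insert a J) z) \<inter> J \<times> J, snd (sample_orders (insert a J) z) \<inter> J \<times> J)
      \<partial>sample_law (insert a J) P)"
    unfolding sum_order_law[OF J] by (rule integral_orders_restrict[OF J'(1) subset_insertI])
  then show ?thesis
    using brownian_separable_orders[OF p brownian J', of "\<lambda>r. h (fst r \<inter> J \<times> J, snd r \<inter> J \<times> J)"]
    by simp
qed

text \<open>Block 0 keeps its additional leaf because splicing uses the position of
  \<open>e\<close>; blocks 1 and 2 forget theirs.\<close>

lemma sum_three_order_laws:
  fixes h :: "_ \<Rightarrow> real" and F0 F1 F2 :: "nat set"
  assumes fin: "finite F0" "finite F1" "finite F2"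
  shows "(\<Sum>(r0, r1, r2)\<in>order_pairs (insert e F0) \<times> order_pairs F1 \<times> order_pairs F2.
      h (r0, r1, r2) * (order_law (insert e F0) r0 * order_law F1 r1 * order_law F2 r2)) =
    (\<Sum>t0\<in>labelled_trees (insert e F0). \<Sum>t1\<in>labelled_trees (insert a F1). \<Sum>t2\<in>labelled_trees (insert b F2).
      sign_weight p t0 * sign_weight p t1 * sign_weight p t2 *
      h (tree_orders t0, (tree_order (\<lambda>_. True) t1 \<inter> F1 \<times> F1, tree_order id t1 \<inter> F1 \<times> F1),
        (tree_order (\<lambda>_. True) t2 \<inter> F2 \<times> F2, tree_order id t2 \<inter> F2 \<times> F2))) /
    (tree_mass p (insert e F0) * tree_mass p (insert a F1) * tree_mass p (insert b F2))"
proof -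
  have "(\<Sum>(r0, r1, r2)\<in>order_pairs (insert e F0) \<times> order_pairs F1 \<times> order_pairs F2.
      h (r0, r1, r2) * (order_law (insert e F0) r0 * order_law F1 r1 * order_law F2 r2)) =
    (\<Sum>r0\<in>order_pairs (insert e F0). (\<Sum>r1\<in>order_pairs F1.
      (\<Sum>r2\<in>order_pairs F2. h (r0, r1, r2) * order_law F2 r2) * order_law F1 r1) * order_law (insert e F0) r0)"
    by (simp add: sum.cartesian_product[symmetric] sum_distrib_left sum_distrib_right mult_ac)
  also have "\<dots> = (\<Sum>t0\<in>labelled_trees (insert e F0). sign_weight p t0 *
      ((\<Sum>t1\<in>labelled_trees (insert a F1). sign_weight p t1 *
        ((\<Sum>t2\<in>labelled_trees (insert b F2). sign_weight p t2 *
          h (tree_orders t0, (tree_order (\<lambda>_. True) t1 \<inter> F1 \<times> F1, tree_order id t1 \<inter> F1 \<times> F1),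
            (tree_order (\<lambda>_. True) t2 \<inter> F2 \<times> F2, tree_order id t2 \<inter> F2 \<times> F2))) /
          tree_mass p (insert b F2))) / tree_mass p (insert a F1))) / tree_mass p (insert e F0)"
    using fin by (subst sum_order_law_trees_insert[of F2 _ b], simp, subst sum_order_law_trees_insert[of F1 _ a], simp,
        subst sum_order_law_trees, simp, simp, simp)
  finally show ?thesis
    by (simp add: sum_distrib_left sum_divide_distrib mult_ac)
qed

text \<open>Read from right to left: add two points to the sample, pass to trees, cut at the branch
  point of the two, and return to orders of three independent samples. The coefficient of a
  partition becomes a Dirichlet moment.\<close>

lemma sum_splice_order_laws:
  fixes h :: "_ \<Rightarrow> real" and I :: "nat set"
  assumes I: "finite I" and e: "e \<notin> I"
  shows "(\<Sum>c\<in>I \<rightarrow>\<^sub>E {0, 1, 2}.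
      pochhammer (1/2) (card (fiber I c 0)) * pochhammer (1/2) (card (fiber I c 1)) *
        pochhammer (1/2) (card (fiber I c 2)) / pochhammer (3/2) (card I) *
      (\<Sum>s\<in>UNIV. (if s then p else 1 - p) *
        (\<Sum>(r0, r1, r2)\<in>order_pairs (insert e (fiber I c 0)) \<times> order_pairs (fiber I c 1) \<times> order_pairs (fiber I c 2).
          h (splice_orders I c e s (r0, r1, r2)) *
          (order_law (insert e (fiber I c 0)) r0 * order_law (fiber I c 1) r1 * order_law (fiber I c 2) r2)))) =
    (\<integral>z. h (sample_orders I z) \<partial>sample_law I P)"
proof -
  obtain a where a: "a \<notin> insert e I" using I by (metis ex_new_if_finite finite_insert infinite_UNIV_nat)
  obtain b where b: "b \<notin> insert a (insert e I)" using I by (metis ex_new_if_finite finite_insert infinite_UNIV_nat)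
  interpret branching I e a b
    by unfold_locales (use I e a b in auto)
  let ?W = "tree_mass p (insert a (insert b I))"
  let ?H = "\<lambda>c s t0 t1 t2. h (splice_orders I c e s (tree_orders t0,
    (tree_order (\<lambda>_. True) t1 \<inter> fiber I c 1 \<times> fiber I c 1, tree_order id t1 \<inter> fiber I c 1 \<times> fiber I c 1),
    (tree_order (\<lambda>_. True) t2 \<inter> fiber I c 2 \<times> fiber I c 2, tree_order id t2 \<inter> fiber I c 2 \<times> fiber I c 2)))"
  have W: "?W = half_mass (Suc (card I))"
    using I fresh by (intro tree_mass_eq) auto
  have mass: "tree_mass p (insert x (fiber I c k)) = half_mass (card (fiber I c k))" if "x \<notin> I" for x c k
    using I that fiber_subset[of I c k] by (intro tree_mass_eq) (auto simp: card_insert_if)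
  have term_c: "pochhammer (1/2) (card (fiber I c 0)) * pochhammer (1/2) (card (fiber I c 1)) *
        pochhammer (1/2) (card (fiber I c 2)) / pochhammer (3/2) (card I) *
      (\<Sum>s\<in>UNIV. (if s then p else 1 - p) *
        (\<Sum>(r0, r1, r2)\<in>order_pairs (insert e (fiber I c 0)) \<times> order_pairs (fiber I c 1) \<times> order_pairs (fiber I c 2).
          h (splice_orders I c e s (r0, r1, r2)) *
          (order_law (insert e (fiber I c 0)) r0 * order_law (fiber I c 1) r1 * order_law (fiber I c 2) r2))) =
      2 / ?W * (\<Sum>(t0, s, t1, t2)\<in>branchings c.
        sign_weight p t0 * (if s then p else 1 - p) * sign_weight p t1 * sign_weight p t2 * ?H c s t0 t1 t2)"
    (is "?D * ?A = _") if c: "c \<in> I \<rightarrow>\<^sub>E {0, 1, 2}" for c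
  proof -
    let ?T = "\<lambda>s. \<Sum>t0\<in>labelled_trees (insert e (fiber I c 0)). \<Sum>t1\<in>labelled_trees (insert a (fiber I c 1)).
      \<Sum>t2\<in>labelled_trees (insert b (fiber I c 2)).
        sign_weight p t0 * sign_weight p t1 * sign_weight p t2 * ?H c s t0 t1 t2"
    let ?V = "half_mass (card (fiber I c 0)) * half_mass (card (fiber I c 1)) * half_mass (card (fiber I c 2))"
    have fin: "finite (fiber I c k)" for k using I by simp
    have A: "?A = (\<Sum>s\<in>UNIV. (if s then p else 1 - p) * (?T s / ?V))"
    proof (intro sum.cong refl arg_cong2[where f = times])
      fix s
      show "(\<Sum>(r0, r1, r2)\<in>order_pairs (insert e (fiber I c 0)) \<times> order_pairs (fiber I c 1) \<times> order_pairs (fiber I c 2).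
          h (splice_orders I c e s (r0, r1, r2)) *
          (order_law (insert e (fiber I c 0)) r0 * order_law (fiber I c 1) r1 * order_law (fiber I c 2) r2)) = ?T s / ?V"
        using sum_three_order_laws[OF fin fin fin, where a = a and b = b and e = e
            and h = "\<lambda>r. h (splice_orders I c e s r)"]
        unfolding mass[OF fresh(1)] mass[OF fresh(2)] mass[OF fresh(3)] .
    qed
    have "(\<Sum>(t0, s, t1, t2)\<in>branchings c.
        sign_weight p t0 * (if s then p else 1 - p) * sign_weight p t1 * sign_weight p t2 * ?H c s t0 t1 t2) =
      (\<Sum>t0\<in>labelled_trees (insert e (fiber I c 0)). \<Sum>s\<in>UNIV. \<Sum>t1\<in>labelled_trees (insert a (fiber I c 1)).
      \<Sum>t2\<in>labelled_trees (insert b (fiber I c 2)).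
        sign_weight p t0 * (if s then p else 1 - p) * sign_weight p t1 * sign_weight p t2 * ?H c s t0 t1 t2)"
      unfolding branchings_def by (simp only: sum.cartesian_product[symmetric] case_prod_conv)
    also have "\<dots> = (\<Sum>s\<in>UNIV. (if s then p else 1 - p) * ?T s)"
      by (subst sum.swap) (simp add: sum_distrib_left mult_ac)
    finally have B: "(\<Sum>(t0, s, t1, t2)\<in>branchings c.
        sign_weight p t0 * (if s then p else 1 - p) * sign_weight p t1 * sign_weight p t2 * ?H c s t0 t1 t2) =
      (\<Sum>s\<in>UNIV. (if s then p else 1 - p) * ?T s)" .
    \<comment> \<open>The powers of 4 cancel because the block sizes add up to
      \<open>card I\<close>, and \<open>half_mass_Suc\<close> supplies both the factor 2 and the
      rising factorial at \<open>3/2\<close>.\<close>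
    have DV: "?D / ?V = 2 / ?W"
    proof -
      have k: "card I = card (fiber I c 0) + card (fiber I c 1) + card (fiber I c 2)"
        using card_fibers[OF I c] by simp
      have "pochhammer (1/2) n > (0::real)" for n by (rule pochhammer_pos) simp
      moreover have "pochhammer (3/2) n > (0::real)" for n by (rule pochhammer_pos) simp
      ultimately have nz: "pochhammer (1/2) n \<noteq> (0::real)" "pochhammer (3/2) n \<noteq> (0::real)" for n
        by (simp_all add: less_imp_neq[symmetric])
      show ?thesis
        unfolding W half_mass_Suc unfolding half_mass_def k
        using nz by (simp add: field_simps power_add)
    qed
    have scale: "D * (\<Sum>s\<in>UNIV. q s * (T s / V)) = K * (\<Sum>s\<in>UNIV. q s * T s)"
      if "D / V = K" for D V K :: real and q T :: "bool \<Rightarrow> real"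
      unfolding that[symmetric] by (simp add: sum_divide_distrib[symmetric])
    show ?thesis unfolding A B by (rule scale[OF DV])
  qed
  have Iab: "finite (insert a (insert b I))" "insert a (insert b I) \<noteq> {}" using I by auto
  have "(\<integral>z. h (sample_orders I z) \<partial>sample_law I P) =
    (\<integral>z. h (fst (sample_orders (insert a (insert b I)) z) \<inter> I \<times> I, snd (sample_orders (insert a (insert b I)) z) \<inter> I \<times> I)
      \<partial>sample_law (insert a (insert b I)) P)"
    by (rule integral_orders_restrict[OF Iab(1)]) auto
  also have "\<dots> = (\<Sum>t\<in>labelled_trees (insert a (insert b I)). sign_weight p t * h (restrict_orders I (tree_orders t))) / ?W"
    using brownian_separable_orders[OF p brownian Iab, of "\<lambda>r. h (fst r \<inter> I \<times> I, snd r \<inter> I \<times> I)"]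
    by (simp add: restrict_orders_def)
  also have "\<dots> = (\<Sum>c\<in>I \<rightarrow>\<^sub>E {0, 1, 2}. 2 / ?W * (\<Sum>(t0, s, t1, t2)\<in>branchings c.
        sign_weight p t0 * (if s then p else 1 - p) * sign_weight p t1 * sign_weight p t2 * ?H c s t0 t1 t2))"
    unfolding sum_trees_branching
    by (simp add: sum_distrib_left sum_divide_distrib splice_orders_def case_prod_unfold)
  finally have rhs: "(\<integral>z. h (sample_orders I z) \<partial>sample_law I P) = \<dots>" .
  show ?thesis
    unfolding rhs by (intro sum.cong refl term_c)
qed

end

section \<open>Measurability of the set of permutons and the recursive identity\<close>

lemma vimage_comp_in_vimage_algebra:
  assumes Y: "Y \<in> space M \<rightarrow> space N" and g: "g \<in> borel_measurable N" and A: "A \<in> sets borel"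
  shows "(\<lambda>\<omega>. g (Y \<omega>)) -` A \<inter> space M \<in> sets (vimage_algebra (space M) Y N)"
proof -
  have "(\<lambda>\<omega>. g (Y \<omega>)) -` A \<inter> space M = Y -` (g -` A \<inter> space N) \<inter> space M"
    using Y by auto
  then show ?thesis
    using in_vimage_algebra[OF measurable_sets[OF g A], of Y "space M"] by simp
qed

text \<open>Distribution functions are continuous from the right, so rational levels determine them.
  Having countably many conditions is what makes equality of marginals a measurable event.\<close>

lemma real_prob_eqI_rat:
  fixes \<nu> \<nu>' :: "real measure"
  assumes \<nu>: "prob_space \<nu>" "sets \<nu> = sets borel" and \<nu>': "prob_space \<nu>'" "sets \<nu>' = sets borel"
    and eq: "\<And>q. q \<in> \<rat> \<Longrightarrow> measure \<nu> {..q} = measure \<nu>' {..q}"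
  shows "\<nu> = \<nu>'"
proof -
  have D: "real_distribution \<nu>" "real_distribution \<nu>'"
    using \<nu> \<nu>' sets_eq_imp_space_eq[OF \<nu>(2)] sets_eq_imp_space_eq[OF \<nu>'(2)]
    by (auto simp: real_distribution_def real_distribution_axioms_def)
  have "cdf \<nu> x = cdf \<nu>' x" for x
  proof -
    \<comment> \<open>The rationals have to approach \<open>x\<close> strictly from above, the side
      on which distribution functions are continuous.\<close>
    have "\<exists>q\<in>\<rat>. x < q \<and> q < x + 1 / real (Suc n)" for n by (rule Rats_dense_in_real) simp
    then obtain y where y: "\<And>n. y n \<in> \<rat>" "\<And>n. x < y n" "\<And>n. y n < x + 1 / real (Suc n)" by metis
    have "(\<lambda>n. x + 1 / real (Suc n)) \<longlonglongrightarrow> x + 0"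
      by (intro tendsto_add tendsto_const LIMSEQ_Suc[OF lim_1_over_n])
    then have upper: "(\<lambda>n. x + 1 / real (Suc n)) \<longlonglongrightarrow> x" by simp
    have y_lim: "y \<longlonglongrightarrow> x"
    proof (rule tendsto_sandwich[OF _ _ tendsto_const upper])
      show "eventually (\<lambda>n. x \<le> y n) sequentially" "eventually (\<lambda>n. y n \<le> x + 1 / real (Suc n)) sequentially"
        by (rule always_eventually; rule allI; rule less_imp_le; rule y)+
    qed
    have lim: "(\<lambda>n. cdf \<mu> (y n)) \<longlonglongrightarrow> cdf \<mu> x" if "real_distribution \<mu>" for \<mu>
    proof (rule continuous_within_tendsto_compose'[OF _ _ y_lim])
      show "continuous (at_right x) (cdf \<mu>)"
        by (rule finite_borel_measure.cdf_is_right_cont[OF real_distribution.finite_borel_measure_M[OF that]])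
      show "y n \<in> {x<..}" for n using y(2) by simp
    qed
    have "cdf \<nu> (y n) = cdf \<nu>' (y n)" for n unfolding cdf_def by (rule eq[OF y(1)])
    then show ?thesis using lim[OF D(1)] lim[OF D(2)] by (simp add: LIMSEQ_unique)
  qed
  then show ?thesis by (intro cdf_unique D) auto
qed

text \<open>Needed to carry the statement that the mixture is almost surely a permuton over to its
  law.\<close>

lemma sets_permutons: "{\<mu> \<in> space (prob_algebra borel). permuton \<mu>} \<in> sets (prob_algebra borel)"
proof -
  let ?N = "prob_algebra (borel :: (real \<times> real) measure)" and ?U = "uniform_measure lborel {0..1::real}"
  have U: "prob_space ?U" "sets ?U = sets borel"
    by (auto intro!: prob_space_uniform_measure)
  have marginal: "{\<mu> \<in> space ?N. distr \<mu> borel f = ?U} \<in> sets ?N" if f: "f \<in> borel \<rightarrow>\<^sub>M borel"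
    for f :: "real \<times> real \<Rightarrow> real"
  proof -
    have K: "(\<lambda>\<mu>. distr \<mu> borel f) \<in> ?N \<rightarrow>\<^sub>M prob_algebra borel" by (rule measurable_distr_prob_space[OF f])
    have [measurable]: "(\<lambda>\<mu>. measure (distr \<mu> borel f) {..q}) \<in> borel_measurable ?N" for q
      by (rule measurable_compose[OF K measurable_measure_prob_algebra]) simp
    have "{\<mu> \<in> space ?N. distr \<mu> borel f = ?U} =
      {\<mu> \<in> space ?N. \<forall>q :: rat. measure (distr \<mu> borel f) {..of_rat q} = measure ?U {..of_rat q}}"
      using measurable_space[OF K] U
      by (auto intro!: real_prob_eqI_rat simp: space_prob_algebra elim!: Rats_cases)
    also have "\<dots> \<in> sets ?N" by measurable
    finally show ?thesis .
  qed
  have "{\<mu> \<in> space ?N. permuton \<mu>} = {\<mu> \<in> space ?N. distr \<mu> borel fst = ?U} \<inter> {\<mu> \<in> space ?N. distr \<mu> borel snd = ?U}"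
    by (auto simp: permuton_def space_prob_algebra)
  then show ?thesis
    using marginal[OF borel_measurable_fst_snd(1)] marginal[OF borel_measurable_fst_snd(2)] by auto
qed

text \<open>Both laws are laws of random permutons, so it suffices to compare the orders of
  \<open>k\<close> sampled points. For given ingredients the mixture yields a sum over the block
  assignment \<open>c\<close>, the sign \<open>s\<close> and the orders \<open>r\<close> of the
  blocks, whose terms are products of five factors, one per independent ingredient. The sign
  \<open>True\<close> is the event \<open>\<not> \<beta>\<close>, which has probability
  \<open>p\<close>.\<close>

theorem theorem1p6:
  fixes p :: real
    and P :: "(real \<times> real) measure measure"
    and M :: "'w measure"
    and \<Delta>0 \<Delta>1 \<Delta>2 :: "'w \<Rightarrow> real"
    and \<mu>0 \<mu>1 \<mu>2 :: "'w \<Rightarrow> (real \<times> real) measure"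
    and Z :: "'w \<Rightarrow> real \<times> real"
    and \<beta> :: "'w \<Rightarrow> bool"
  assumes p: "0 < p" "p < 1"
    and P: "brownian_separable_law p P"
    and M: "prob_space M"
    and \<Delta>_measurable:
      "(\<lambda>\<omega>. (\<Delta>0 \<omega>, \<Delta>1 \<omega>, \<Delta>2 \<omega>)) \<in> measurable M (restrict_space borel simplex3)"
    and \<Delta>_law: "distr M borel (\<lambda>\<omega>. (\<Delta>0 \<omega>, \<Delta>1 \<omega>, \<Delta>2 \<omega>)) = dirichlet3 (1/2) (1/2) (1/2)"
    and \<mu>_measurable: "\<mu>0 \<in> measurable M (prob_algebra borel)"
      "\<mu>1 \<in> measurable M (prob_algebra borel)" "\<mu>2 \<in> measurable M (prob_algebra borel)"
    and \<mu>_law: "distr M (prob_algebra borel) \<mu>0 = P"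
      "distr M (prob_algebra borel) \<mu>1 = P" "distr M (prob_algebra borel) \<mu>2 = P"
    and Z: "random_point_of M \<mu>0 Z"
    and \<beta>_measurable: "\<beta> \<in> measurable M (count_space UNIV)"
    and \<beta>_law: "distr M (count_space UNIV) \<beta> = measure_pmf (bernoulli_pmf (1 - p))"
    and indep: "prob_space.indep_sets M
      (\<lambda>i. [sets (vimage_algebra (space M) (\<lambda>\<omega>. (\<Delta>0 \<omega>, \<Delta>1 \<omega>, \<Delta>2 \<omega>)) borel),
            sets (vimage_algebra (space M) (\<lambda>\<omega>. (\<mu>0 \<omega>, Z \<omega>)) (prob_algebra borel \<Otimes>\<^sub>M borel)),
            sets (vimage_algebra (space M) \<mu>1 (prob_algebra borel)),
            sets (vimage_algebra (space M) \<mu>2 (prob_algebra borel)),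
            sets (vimage_algebra (space M) \<beta> (count_space UNIV))] ! i)
      {0..<5}"
  shows "distr M (prob_algebra borel)
      (\<lambda>\<omega>. mixture3
        (\<Delta>0 \<omega>) (distr (\<mu>0 \<omega>) borel (theta0 (\<Delta>0 \<omega>) (Z \<omega>)))
        (\<Delta>1 \<omega>) (distr (\<mu>1 \<omega>) borel (theta1 (\<Delta>0 \<omega>) (\<Delta>1 \<omega>) (\<Delta>2 \<omega>) (Z \<omega>) (of_bool (\<beta> \<omega>))))
        (\<Delta>2 \<omega>) (distr (\<mu>2 \<omega>) borel (theta2 (\<Delta>0 \<omega>) (\<Delta>1 \<omega>) (\<Delta>2 \<omega>) (Z \<omega>) (of_bool (\<beta> \<omega>))))) = P"
proof -
  interpret M: prob_space M by (rule M)
  let ?N = "prob_algebra (borel :: (real \<times> real) measure)"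
  have perm_P: "random_permuton P"
    using P by (intro random_permuton.intro random_measure_law.intro random_permuton_axioms.intro)
      (simp_all add: brownian_separable_law_def random_permuton_law_def)
  interpret P: brownian_separable P p
    using perm_P p P by (intro brownian_separable.intro brownian_separable_axioms.intro)
  define d where "d \<omega> k = (if k = 0 then \<Delta>0 \<omega> else if k = 1 then \<Delta>1 \<omega> else \<Delta>2 \<omega>)" for \<omega> and k :: nat
  define m where "m \<omega> k = (if k = 0 then \<mu>0 \<omega> else if k = 1 then \<mu>1 \<omega> else \<mu>2 \<omega>)" for \<omega> and k :: nat
  define mix where "mix \<omega> = block_mixture (d \<omega>) (m \<omega>) (Z \<omega>) (\<not> \<beta> \<omega>)" for \<omega>
  have d_simps: "d \<omega> 0 = \<Delta>0 \<omega>" "d \<omega> 1 = \<Delta>1 \<omega>" "d \<omega> 2 = \<Delta>2 \<omega>" for \<omega>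
    by (simp_all add: d_def)
  have m_simps: "m \<omega> 0 = \<mu>0 \<omega>" "m \<omega> 1 = \<mu>1 \<omega>" "m \<omega> 2 = \<mu>2 \<omega>" for \<omega>
    by (simp_all add: m_def)
  note [measurable] = \<mu>_measurable \<beta>_measurable
  have Z_meas [measurable]: "Z \<in> borel_measurable M" using Z by (simp add: random_point_of_def)
  have simplex: "\<Delta>0 \<omega> \<ge> 0" "\<Delta>1 \<omega> \<ge> 0" "\<Delta>2 \<omega> \<ge> 0" "\<Delta>0 \<omega> + \<Delta>1 \<omega> + \<Delta>2 \<omega> = 1"
    if "\<omega> \<in> space M" for \<omega>
    using measurable_space[OF \<Delta>_measurable that] by (auto simp: space_restrict_space simplex3_def)
  have \<Delta>_borel: "(\<lambda>\<omega>. (\<Delta>0 \<omega>, \<Delta>1 \<omega>, \<Delta>2 \<omega>)) \<in> borel_measurable M"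
    using \<Delta>_measurable by (auto simp: measurable_restrict_space2_iff)
  have proj [measurable]: "(\<lambda>w :: real \<times> real \<times> real. fst w) \<in> borel_measurable borel"
    "(\<lambda>w :: real \<times> real \<times> real. fst (snd w)) \<in> borel_measurable borel"
    "(\<lambda>w :: real \<times> real \<times> real. snd (snd w)) \<in> borel_measurable borel"
    by (intro borel_measurable_continuous_onI continuous_intros)+
  have [measurable]: "\<Delta>0 \<in> borel_measurable M" "\<Delta>1 \<in> borel_measurable M" "\<Delta>2 \<in> borel_measurable M"
    using measurable_compose[OF \<Delta>_borel proj(1)] measurable_compose[OF \<Delta>_borel proj(2)]
      measurable_compose[OF \<Delta>_borel proj(3)] by simp_all
  have d_meas [measurable]: "(\<lambda>\<omega>. d \<omega> k) \<in> borel_measurable M" for k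
    unfolding d_def by (cases "k = 0"; cases "k = 1") simp_all
  have m_meas [measurable]: "(\<lambda>\<omega>. m \<omega> k) \<in> M \<rightarrow>\<^sub>M ?N" for k
    unfolding m_def by (cases "k = 0"; cases "k = 1") simp_all
  have m_space: "m \<omega> k \<in> space ?N" if "\<omega> \<in> space M" for \<omega> k
    by (rule measurable_space[OF m_meas that])
  have mix_eq: "mixture3
        (\<Delta>0 \<omega>) (distr (\<mu>0 \<omega>) borel (theta0 (\<Delta>0 \<omega>) (Z \<omega>)))
        (\<Delta>1 \<omega>) (distr (\<mu>1 \<omega>) borel (theta1 (\<Delta>0 \<omega>) (\<Delta>1 \<omega>) (\<Delta>2 \<omega>) (Z \<omega>) (of_bool (\<beta> \<omega>))))
        (\<Delta>2 \<omega>) (distr (\<mu>2 \<omega>) borel (theta2 (\<Delta>0 \<omega>) (\<Delta>1 \<omega>) (\<Delta>2 \<omega>) (Z \<omega>) (of_bool (\<beta> \<omega>)))) = mix \<omega>"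
    if \<omega>: "\<omega> \<in> space M" for \<omega>
    using mixture3_eq_block_mixture[where \<mu> = "m \<omega>", OF m_space[OF \<omega>], where d = "d \<omega>" and Z = "Z \<omega>" and s = "\<not> \<beta> \<omega>"]
    unfolding mix_def d_simps m_simps not_not .
  have mix_space: "mix \<omega> \<in> space ?N" if \<omega>: "\<omega> \<in> space M" for \<omega>
    unfolding mix_def
    by (rule block_mixture_in_prob_algebra[OF m_space[OF \<omega>]]) (use simplex[OF \<omega>] in \<open>auto simp: d_def\<close>)
  have theta_meas: "(\<lambda>(\<omega>, z). theta_map (d \<omega>) (Z \<omega>) (\<not> \<beta> \<omega>) k z) \<in> M \<Otimes>\<^sub>M borel \<rightarrow>\<^sub>M borel" for k
    unfolding theta_map_def line_map_def of_bool_def case_prod_unfold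
    by (intro borel_measurable_Pair; cases "k = 0"; cases "k = 1"; simp; measurable)
  have mix_meas [measurable]: "mix \<in> M \<rightarrow>\<^sub>M ?N"
  proof (rule measurable_prob_algebra_generated)
    show "sets borel = sigma_sets UNIV (sets (borel :: (real \<times> real) measure))"
      using sets.sigma_sets_eq[of "borel :: (real \<times> real) measure"] by simp
    show "Int_stable (sets (borel :: (real \<times> real) measure))" by (auto simp: Int_stable_def)
    show "prob_space (mix \<omega>)" "sets (mix \<omega>) = sets borel" if "\<omega> \<in> space M" for \<omega>
      using mix_space[OF that] by (auto simp: space_prob_algebra)
    fix A :: "(real \<times> real) set" assume A: "A \<in> sets borel"
    have "(\<lambda>\<omega>. distr (m \<omega> k) borel (theta_map (d \<omega>) (Z \<omega>) (\<not> \<beta> \<omega>) k)) \<in> M \<rightarrow>\<^sub>M ?N" for k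
      by (rule measurable_distr_prob_space2[OF m_meas theta_meas])
    from measurable_compose[OF measurable_prob_algebraD[OF this] measurable_emeasure_subprob_algebra[OF A]]
    have [measurable]: "(\<lambda>\<omega>. emeasure (distr (m \<omega> k) borel (theta_map (d \<omega>) (Z \<omega>) (\<not> \<beta> \<omega>) k)) A) \<in> borel_measurable M" for k .
    have "(\<lambda>\<omega>. \<Sum>k\<in>{0, 1, 2}. ennreal (d \<omega> k) * emeasure (distr (m \<omega> k) borel (theta_map (d \<omega>) (Z \<omega>) (\<not> \<beta> \<omega>) k)) A)
        \<in> borel_measurable M"
      by measurable
    also have "?this \<longleftrightarrow> (\<lambda>\<omega>. emeasure (mix \<omega>) A) \<in> borel_measurable M"
      unfolding mix_def block_mixture_def
      by (intro measurable_cong emeasure_point_measure_bind[where N = borel, symmetric]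
          distr_theta_map_in_prob_algebra m_space A) auto
    finally show "(\<lambda>\<omega>. emeasure (mix \<omega>) A) \<in> borel_measurable M" .
  qed simp
  have AE_m: "AE \<omega> in M. permuton (m \<omega> k)" for k
  proof -
    have "AE \<omega> in M. permuton (\<mu> \<omega>)" if "\<mu> \<in> M \<rightarrow>\<^sub>M ?N" "distr M ?N \<mu> = P" for \<mu>
      using AE_distrD[OF that(1)] P.permutons unfolding that(2)[symmetric] .
    then show ?thesis
      unfolding m_def using \<mu>_measurable \<mu>_law by (cases "k = 0"; cases "k = 1") simp_all
  qed
  have AE_\<Delta>: "AE \<omega> in M. 0 < \<Delta>0 \<omega> \<and> 0 < \<Delta>1 \<omega> \<and> 0 < \<Delta>2 \<omega>"
  proof -
    have "AE w in distr M borel (\<lambda>\<omega>. (\<Delta>0 \<omega>, \<Delta>1 \<omega>, \<Delta>2 \<omega>)). 0 < fst w \<and> 0 < fst (snd w) \<and> 0 < snd (snd w)"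
      unfolding \<Delta>_law using AE_dirichlet3_positive[of "1/2" "1/2" "1/2"] by (simp add: case_prod_unfold)
    from AE_distrD[OF \<Delta>_borel this] show ?thesis by simp
  qed
  \<comment> \<open>\<open>Z\<close> has law \<open>\<mu>0\<close> only conditionally, so the claim
    is proved for the joint law of \<open>\<mu>0\<close> and \<open>Z\<close>, first the point for a
    fixed permuton and then the permuton.\<close>
  have AE_Z: "AE \<omega> in M. 0 < fst (Z \<omega>) \<and> fst (Z \<omega>) < 1 \<and> 0 < snd (Z \<omega>) \<and> snd (Z \<omega>) < 1"
  proof -
    let ?K = "\<lambda>m. distr m (?N \<Otimes>\<^sub>M borel) (\<lambda>z. (m, z))"
    let ?Q = "\<lambda>w :: (real \<times> real) measure \<times> (real \<times> real). 0 < fst (snd w) \<and> fst (snd w) < 1 \<and> 0 < snd (snd w) \<and> snd (snd w) < 1"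
    have K: "?K \<in> ?N \<rightarrow>\<^sub>M prob_algebra (?N \<Otimes>\<^sub>M borel)"
      by (rule measurable_distr_prob_space2[where M = borel]) auto
    have KP: "?K \<in> P \<rightarrow>\<^sub>M subprob_algebra (?N \<Otimes>\<^sub>M borel)"
      unfolding measurable_cong_sets[OF P.sets_P refl] by (rule measurable_prob_algebraD[OF K])
    have Q: "Measurable.pred (?N \<Otimes>\<^sub>M borel) ?Q" by measurable
    have "AE \<mu> in P. AE w in ?K \<mu>. ?Q w"
      using P.permutons
    proof eventually_elim
      case (elim \<mu>)
      note \<mu> = permuton_marginals[OF elim]
      have "(\<lambda>z. (\<mu>, z)) \<in> borel \<rightarrow>\<^sub>M ?N \<Otimes>\<^sub>M borel" using permuton_in_prob_algebra[OF elim] by simp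
      then have pair: "(\<lambda>z. (\<mu>, z)) \<in> \<mu> \<rightarrow>\<^sub>M ?N \<Otimes>\<^sub>M borel" unfolding measurable_cong_sets[OF \<mu>(2) refl] .
      show ?case
        unfolding AE_distr_iff[OF pair predE[OF Q]]
        using permuton_AE_component[OF elim, of 0 0] by eventually_elim simp
    qed
    then have "AE w in P \<bind> ?K. ?Q w" unfolding AE_bind[OF KP Q] .
    then have "AE w in distr M (?N \<Otimes>\<^sub>M borel) (\<lambda>\<omega>. (\<mu>0 \<omega>, Z \<omega>)). ?Q w"
      unfolding distr_random_point[OF M \<mu>_measurable(1) Z] \<mu>_law(1) .
    from AE_distrD[OF _ this] show ?thesis by simp
  qed
  have weights: "block_weights (d \<omega>)" if "0 < \<Delta>0 \<omega> \<and> 0 < \<Delta>1 \<omega> \<and> 0 < \<Delta>2 \<omega>" "\<omega> \<in> space M" for \<omega>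
    using that simplex[OF that(2)] by unfold_locales (auto simp: d_def)
  define Q where "Q = distr M ?N mix"
  have perm_Q: "random_permuton Q"
  proof (intro random_permuton.intro random_measure_law.intro random_permuton_axioms.intro)
    show "prob_space Q" unfolding Q_def by (rule M.prob_space_distr[OF mix_meas])
    show "sets Q = sets ?N" by (simp add: Q_def)
    have "AE \<omega> in M. permuton (mix \<omega>)"
      using AE_m[of 0] AE_m[of 1] AE_m[of 2] AE_\<Delta> AE_Z AE_space
    proof eventually_elim
      case (elim \<omega>)
      show ?case
        unfolding mix_def
        by (rule block_weights.permuton_block_mixture[OF weights[OF elim(4,6)]]) (use elim in auto)
    qed
    show "AE \<mu> in Q. permuton \<mu>"
    proof -
      have "{\<mu> \<in> space ?N. permuton \<mu>} \<in> sets ?N" by (rule sets_permutons)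
      then show ?thesis
        unfolding Q_def using \<open>AE \<omega> in M. permuton (mix \<omega>)\<close> by (subst AE_distr_iff[OF mix_meas])
    qed
  qed
  interpret Q: random_permuton Q by (rule perm_Q)
  have "Q = P"
  proof (rule random_permuton_eqI[OF perm_Q perm_P])
    fix k :: nat and h :: "(nat \<times> nat) set \<times> (nat \<times> nat) set \<Rightarrow> real"
    assume "k \<ge> 1"
    \<comment> \<open>The sampled points carry the labels from 1 on, which leaves 0 as the label of
      \<open>Z\<close>.\<close>
    let ?I = "{1..k}" and ?e = "0 :: nat"
    let ?F = "fiber ?I"
    let ?S = "\<lambda>c. order_pairs (insert ?e (?F c 0)) \<times> order_pairs (?F c 1) \<times> order_pairs (?F c 2)"
    have I: "finite ?I" and e: "?e \<notin> ?I" by auto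
    have finF: "finite (?F c j)" for c j by simp
    have eF: "?e \<notin> ?F c j" for c j by (simp add: fiber_def)
    \<comment> \<open>The five factors are listed in the order of the five independent
      sigma-algebras of the hypothesis; the last one selects the sign that actually occurs.\<close>
    define X where "X c s r i \<omega> = [\<Delta>0 \<omega> ^ card (?F c 0) * \<Delta>1 \<omega> ^ card (?F c 1) * \<Delta>2 \<omega> ^ card (?F c 2),
      orders_prob_with (?F c 0) ?e (\<mu>0 \<omega>) (Z \<omega>) (fst r), orders_prob (?F c 1) (\<mu>1 \<omega>) (fst (snd r)),
      orders_prob (?F c 2) (\<mu>2 \<omega>) (snd (snd r)), of_bool (s = (\<not> \<beta> \<omega>))] ! i" for c s r i \<omega>
    have X_simps: "X c s r 0 \<omega> = \<Delta>0 \<omega> ^ card (?F c 0) * \<Delta>1 \<omega> ^ card (?F c 1) * \<Delta>2 \<omega> ^ card (?F c 2)"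
      "X c s r 1 \<omega> = orders_prob_with (?F c 0) ?e (\<mu>0 \<omega>) (Z \<omega>) (fst r)"
      "X c s r 2 \<omega> = orders_prob (?F c 1) (\<mu>1 \<omega>) (fst (snd r))"
      "X c s r 3 \<omega> = orders_prob (?F c 2) (\<mu>2 \<omega>) (snd (snd r))"
      "X c s r 4 \<omega> = of_bool (s = (\<not> \<beta> \<omega>))" for c s r \<omega>
      by (simp_all add: X_def)
    have five: "{0..<5::nat} = {0, 1, 2, 3, 4}" by auto
    \<comment> \<open>Each factor is a measurable function of a single ingredient, so independence
      of the ingredients passes to the factors.\<close>
    have X_indep_sets: "X c s r i -` A \<inter> space M \<in>
      [sets (vimage_algebra (space M) (\<lambda>\<omega>. (\<Delta>0 \<omega>, \<Delta>1 \<omega>, \<Delta>2 \<omega>)) borel),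
       sets (vimage_algebra (space M) (\<lambda>\<omega>. (\<mu>0 \<omega>, Z \<omega>)) (?N \<Otimes>\<^sub>M borel)),
       sets (vimage_algebra (space M) \<mu>1 ?N), sets (vimage_algebra (space M) \<mu>2 ?N),
       sets (vimage_algebra (space M) \<beta> (count_space UNIV))] ! i"
      if i: "i \<in> {0..<5}" and A: "A \<in> sets borel" for c s r i and A :: "real set"
    proof -
      have 0: "(\<lambda>w. fst w ^ card (?F c 0) * fst (snd w) ^ card (?F c 1) * snd (snd w) ^ card (?F c 2))
          \<in> borel_measurable (borel :: (real \<times> real \<times> real) measure)"
        by measurable
      have 1: "(\<lambda>w. orders_prob_with (?F c 0) ?e (fst w) (snd w) (fst r)) \<in> borel_measurable (?N \<Otimes>\<^sub>M borel)"
        by (rule orders_prob_with_measurable[OF finF])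
      have 2: "(\<lambda>\<mu>. orders_prob (?F c 1) \<mu> (fst (snd r))) \<in> borel_measurable ?N"
        by (rule orders_prob_measurable[OF finF])
      have 3: "(\<lambda>\<mu>. orders_prob (?F c 2) \<mu> (snd (snd r))) \<in> borel_measurable ?N"
        by (rule orders_prob_measurable[OF finF])
      have 4: "(\<lambda>b. of_bool (s = (\<not> b)) :: real) \<in> borel_measurable (count_space UNIV)" by simp
      have sp: "(\<lambda>\<omega>. (\<Delta>0 \<omega>, \<Delta>1 \<omega>, \<Delta>2 \<omega>)) \<in> space M \<rightarrow> space borel"
        "(\<lambda>\<omega>. (\<mu>0 \<omega>, Z \<omega>)) \<in> space M \<rightarrow> space (?N \<Otimes>\<^sub>M borel)"
        "\<mu>1 \<in> space M \<rightarrow> space ?N" "\<mu>2 \<in> space M \<rightarrow> space ?N" "\<beta> \<in> space M \<rightarrow> space (count_space UNIV)"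
        using measurable_space[OF \<mu>_measurable(1)] measurable_space[OF \<mu>_measurable(2)]
          measurable_space[OF \<mu>_measurable(3)] by (auto simp: space_pair_measure)
      note vimage_comp_in_vimage_algebra[OF sp(1) 0 A] vimage_comp_in_vimage_algebra[OF sp(2) 1 A]
        vimage_comp_in_vimage_algebra[OF sp(3) 2 A] vimage_comp_in_vimage_algebra[OF sp(4) 3 A]
        vimage_comp_in_vimage_algebra[OF sp(5) 4 A]
      then show ?thesis
        using i unfolding five X_def by (auto simp: numeral_eq_Suc)
    qed
    have X_bounds: "0 \<le> X c s r i \<omega> \<and> X c s r i \<omega> \<le> 1" if "i \<in> {0..<5}" "\<omega> \<in> space M" for c s r i \<omega>
    proof -
      have "0 \<le> X c s r 0 \<omega> \<and> X c s r 0 \<omega> \<le> 1"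
        unfolding X_simps using simplex[OF that(2)]
        by (intro conjI mult_nonneg_nonneg zero_le_power mult_le_one power_le_one) auto
      moreover have "0 \<le> X c s r 1 \<omega> \<and> X c s r 1 \<omega> \<le> 1"
        unfolding X_simps by (intro conjI orders_prob_bounds measurable_space[OF \<mu>_measurable(1) that(2)])
      moreover have "0 \<le> X c s r 2 \<omega> \<and> X c s r 2 \<omega> \<le> 1"
        unfolding X_simps by (intro conjI orders_prob_bounds measurable_space[OF \<mu>_measurable(2) that(2)])
      moreover have "0 \<le> X c s r 3 \<omega> \<and> X c s r 3 \<omega> \<le> 1"
        unfolding X_simps by (intro conjI orders_prob_bounds measurable_space[OF \<mu>_measurable(3) that(2)])
      moreover have "0 \<le> X c s r 4 \<omega> \<and> X c s r 4 \<omega> \<le> 1" unfolding X_simps by simp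
      ultimately show ?thesis using that(1) unfolding five by auto
    qed
    have X_meas: "X c s r i \<in> borel_measurable M" if "i \<in> {0..<5}" for c s r i
    proof (rule measurableI)
      fix A :: "real set" assume "A \<in> sets borel"
      from X_indep_sets[OF that this]
      show "X c s r i -` A \<inter> space M \<in> sets M"
        using indep that unfolding M.indep_sets_def by blast
    qed simp
    have indep_X: "M.indep_vars (\<lambda>_. borel) (X c s r) {0..<5}" for c s r
      unfolding M.indep_vars_def2
    proof (intro conjI ballI X_meas)
      show "M.indep_sets (\<lambda>i. {X c s r i -` A \<inter> space M | A. A \<in> sets borel}) {0..<5}"
        by (rule M.indep_sets_mono_sets[OF indep]) (use X_indep_sets in blast)
    qed
    have int_X: "integrable M (X c s r i)" if "i \<in> {0..<5}" for c s r i
      using X_bounds[OF that] X_meas[OF that] by (intro M.integrable_const_bound[of _ 1] AE_I2) auto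
    \<comment> \<open>The expectation factorises: a Dirichlet moment, the probability of the sign,
      and three order probabilities, of which block 0 has the additional point
      \<open>Z\<close>.\<close>
    have EX: "(\<integral>\<omega>. (\<Prod>i\<in>{0..<5}. X c s r i \<omega>) \<partial>M) =
      pochhammer (1/2) (card (?F c 0)) * pochhammer (1/2) (card (?F c 1)) *
        pochhammer (1/2) (card (?F c 2)) / pochhammer (3/2) (card ?I) *
      ((if s then p else 1 - p) * (P.order_law (insert ?e (?F c 0)) (fst r) *
        P.order_law (?F c 1) (fst (snd r)) * P.order_law (?F c 2) (snd (snd r))))"
      if c: "c \<in> ?I \<rightarrow>\<^sub>E {0, 1, 2}" for c s r
    proof -
      have "(\<integral>\<omega>. (\<Prod>i\<in>{0..<5}. X c s r i \<omega>) \<partial>M) = (\<Prod>i\<in>{0..<5}. \<integral>\<omega>. X c s r i \<omega> \<partial>M)"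
        by (rule M.indep_vars_lebesgue_integral[OF _ indep_X int_X]) simp
      also have "\<dots> = (\<integral>\<omega>. X c s r 0 \<omega> \<partial>M) * (\<integral>\<omega>. X c s r 1 \<omega> \<partial>M) * (\<integral>\<omega>. X c s r 2 \<omega> \<partial>M) *
        (\<integral>\<omega>. X c s r 3 \<omega> \<partial>M) * (\<integral>\<omega>. X c s r 4 \<omega> \<partial>M)"
        unfolding five by (simp add: mult_ac)
      also have "(\<integral>\<omega>. X c s r 1 \<omega> \<partial>M) = P.order_law (insert ?e (?F c 0)) (fst r)"
        unfolding X_simps by (rule P.expectation_orders_prob_with[OF M \<mu>_measurable(1) \<mu>_law(1) Z finF eF])
      also have "(\<integral>\<omega>. X c s r 2 \<omega> \<partial>M) = P.order_law (?F c 1) (fst (snd r))"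
        unfolding X_simps by (rule P.expectation_orders_prob[OF M \<mu>_measurable(2) \<mu>_law(2) finF])
      also have "(\<integral>\<omega>. X c s r 3 \<omega> \<partial>M) = P.order_law (?F c 2) (snd (snd r))"
        unfolding X_simps by (rule P.expectation_orders_prob[OF M \<mu>_measurable(3) \<mu>_law(3) finF])
      also have "(\<integral>\<omega>. X c s r 4 \<omega> \<partial>M) = (if s then p else 1 - p)"
      proof -
        have "(\<integral>\<omega>. X c s r 4 \<omega> \<partial>M) = (\<integral>b. of_bool (s = (\<not> b)) \<partial>distr M (count_space UNIV) \<beta>)"
          unfolding X_simps by (rule integral_distr[OF \<beta>_measurable, symmetric]) simp
        also have "\<dots> = (if s then p else 1 - p)"
          unfolding \<beta>_law using p by (simp add: integral_measure_pmf[of UNIV] UNIV_bool)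
        finally show ?thesis .
      qed
      also have "(\<integral>\<omega>. X c s r 0 \<omega> \<partial>M) = pochhammer (1/2) (card (?F c 0)) * pochhammer (1/2) (card (?F c 1)) *
        pochhammer (1/2) (card (?F c 2)) / pochhammer (3/2) (card ?I)" (is "_ = ?D")
      proof -
        let ?g = "\<lambda>(x, y, z). ennreal (x ^ card (?F c 0) * y ^ card (?F c 1) * z ^ card (?F c 2))"
        have g: "?g \<in> borel_measurable borel"
          unfolding case_prod_unfold
          by (intro measurable_compose[OF _ measurable_ennreal] borel_measurable_continuous_onI continuous_intros)
        have "(\<integral>\<omega>. X c s r 0 \<omega> \<partial>M) = enn2real (\<integral>\<^sup>+\<omega>. ennreal (X c s r 0 \<omega>) \<partial>M)"
          using X_bounds[of 0] by (intro integral_eq_nn_integral X_meas AE_I2) auto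
        also have "(\<integral>\<^sup>+\<omega>. ennreal (X c s r 0 \<omega>) \<partial>M) = (\<integral>\<^sup>+w. ?g w \<partial>distr M borel (\<lambda>\<omega>. (\<Delta>0 \<omega>, \<Delta>1 \<omega>, \<Delta>2 \<omega>)))"
          using g by (subst nn_integral_distr[OF \<Delta>_borel]) (simp_all add: X_simps)
        also have "\<dots> = ennreal ?D"
          unfolding \<Delta>_law card_fibers[OF I c, symmetric]
          using nn_integral_dirichlet3_moment[of "1/2" "1/2" "1/2" "card (?F c 0)" "card (?F c 1)" "card (?F c 2)"]
          by simp
        also have "enn2real (ennreal ?D) = ?D"
        proof -
          have "pochhammer (1/2) n > (0::real)" for n by (rule pochhammer_pos) simp
          moreover have "pochhammer (3/2) n > (0::real)" for n by (rule pochhammer_pos) simp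
          ultimately have "?D \<ge> 0" by (intro divide_nonneg_nonneg mult_nonneg_nonneg less_imp_le)
          then show ?thesis by simp
        qed
        finally show ?thesis .
      qed
      finally show ?thesis by (simp add: mult_ac)
    qed
    let ?H = "\<lambda>\<mu>. \<integral>z. h (sample_orders ?I z) \<partial>PiM ?I (\<lambda>_. \<mu>)"
    have H_meas: "?H \<in> borel_measurable ?N"
    proof -
      have "(\<lambda>z. h (sample_orders ?I z)) \<in> borel_measurable (PiM ?I (\<lambda>_. borel))"
        by (rule measurable_compose[OF measurable_sample_orders[OF I]]) simp
      from measurable_compose[OF measurable_prob_algebraD[OF measurable_PiM_kernel[OF I]]
          integral_measurable_subprob_algebra[OF this]]
      show ?thesis .
    qed
    have "(\<integral>z. h (sample_orders ?I z) \<partial>sample_law ?I Q) = (\<integral>\<mu>. ?H \<mu> \<partial>Q)"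
      by (rule Q.integral_sample_law[OF I])
    also have "\<dots> = (\<integral>\<omega>. ?H (mix \<omega>) \<partial>M)"
      unfolding Q_def by (rule integral_distr[OF mix_meas H_meas])
    also have "\<dots> = (\<integral>\<omega>. (\<Sum>c\<in>?I \<rightarrow>\<^sub>E {0, 1, 2}. \<Sum>s\<in>UNIV. \<Sum>r\<in>?S c.
        h (splice_orders ?I c ?e s r) * (\<Prod>i\<in>{0..<5}. X c s r i \<omega>)) \<partial>M)"
    proof (rule integral_cong_AE)
      show "(\<lambda>\<omega>. ?H (mix \<omega>)) \<in> borel_measurable M" by (rule measurable_compose[OF mix_meas H_meas])
      show "(\<lambda>\<omega>. \<Sum>c\<in>?I \<rightarrow>\<^sub>E {0, 1, 2}. \<Sum>s\<in>UNIV. \<Sum>r\<in>?S c.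
        h (splice_orders ?I c ?e s r) * (\<Prod>i\<in>{0..<5}. X c s r i \<omega>)) \<in> borel_measurable M"
        using X_meas by (intro borel_measurable_sum borel_measurable_times borel_measurable_const borel_measurable_prod)
      show "AE \<omega> in M. ?H (mix \<omega>) = (\<Sum>c\<in>?I \<rightarrow>\<^sub>E {0, 1, 2}. \<Sum>s\<in>UNIV. \<Sum>r\<in>?S c.
        h (splice_orders ?I c ?e s r) * (\<Prod>i\<in>{0..<5}. X c s r i \<omega>))"
        using AE_m[of 0] AE_m[of 1] AE_m[of 2] AE_\<Delta> AE_Z AE_space
      proof eventually_elim
        case (elim \<omega>)
        have "?H (mix \<omega>) = (\<Sum>c\<in>?I \<rightarrow>\<^sub>E {0, 1, 2}.
          (d \<omega> 0 ^ card (?F c 0) * d \<omega> 1 ^ card (?F c 1) * d \<omega> 2 ^ card (?F c 2)) *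
          (\<Sum>(r0, r1, r2)\<in>?S c. h (splice_orders ?I c ?e (\<not> \<beta> \<omega>) (r0, r1, r2)) *
            (orders_prob_with (?F c 0) ?e (m \<omega> 0) (Z \<omega>) r0 * orders_prob (?F c 1) (m \<omega> 1) r1 *
              orders_prob (?F c 2) (m \<omega> 2) r2)))"
          unfolding mix_def
          by (rule block_weights.integral_orders_block_mixture[OF weights[OF elim(4,6)] I e]) (use elim in auto)
        also have "\<dots> = (\<Sum>c\<in>?I \<rightarrow>\<^sub>E {0, 1, 2}. \<Sum>s\<in>UNIV. \<Sum>r\<in>?S c.
          h (splice_orders ?I c ?e s r) * (\<Prod>i\<in>{0..<5}. X c s r i \<omega>))"
        proof (intro sum.cong refl)
          fix c assume "c \<in> ?I \<rightarrow>\<^sub>E {0, 1, 2::nat}"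
          \<comment> \<open>The sum over \<open>s\<close> is artificial: the indicator in the fifth
            factor leaves only the sign given by \<open>\<beta>\<close>. It is introduced so that
            the random sign appears as a factor and not inside \<open>h\<close>.\<close>
          have "(\<Sum>s\<in>UNIV. \<Sum>r\<in>?S c. h (splice_orders ?I c ?e s r) * (\<Prod>i\<in>{0..<5}. X c s r i \<omega>)) =
            (\<Sum>s\<in>UNIV. if s = (\<not> \<beta> \<omega>) then (\<Sum>r\<in>?S c. h (splice_orders ?I c ?e s r) *
              (X c s r 0 \<omega> * (X c s r 1 \<omega> * X c s r 2 \<omega> * X c s r 3 \<omega>))) else 0)"
            by (intro sum.cong refl) (simp add: five X_simps(5) mult_ac)
          also have "\<dots> = (\<Sum>r\<in>?S c. h (splice_orders ?I c ?e (\<not> \<beta> \<omega>) r) *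
              (X c (\<not> \<beta> \<omega>) r 0 \<omega> * (X c (\<not> \<beta> \<omega>) r 1 \<omega> * X c (\<not> \<beta> \<omega>) r 2 \<omega> * X c (\<not> \<beta> \<omega>) r 3 \<omega>)))"
            by (subst sum.delta) simp_all
          finally show "(d \<omega> 0 ^ card (?F c 0) * d \<omega> 1 ^ card (?F c 1) * d \<omega> 2 ^ card (?F c 2)) *
            (\<Sum>(r0, r1, r2)\<in>?S c. h (splice_orders ?I c ?e (\<not> \<beta> \<omega>) (r0, r1, r2)) *
              (orders_prob_with (?F c 0) ?e (m \<omega> 0) (Z \<omega>) r0 * orders_prob (?F c 1) (m \<omega> 1) r1 *
                orders_prob (?F c 2) (m \<omega> 2) r2)) =
            (\<Sum>s\<in>UNIV. \<Sum>r\<in>?S c. h (splice_orders ?I c ?e s r) * (\<Prod>i\<in>{0..<5}. X c s r i \<omega>))"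
            unfolding X_simps d_simps m_simps by (simp add: case_prod_unfold sum_distrib_left mult_ac)
        qed
        finally show ?case .
      qed
    qed
    also have "\<dots> = (\<Sum>c\<in>?I \<rightarrow>\<^sub>E {0, 1, 2}. \<Sum>s\<in>UNIV. \<Sum>r\<in>?S c.
        h (splice_orders ?I c ?e s r) * (\<integral>\<omega>. (\<Prod>i\<in>{0..<5}. X c s r i \<omega>) \<partial>M))"
    proof -
      have "integrable M (\<lambda>\<omega>. \<Prod>i\<in>{0..<5}. X c s r i \<omega>)" for c s r
        by (rule M.indep_vars_integrable[OF _ indep_X int_X]) simp
      then show ?thesis by simp
    qed
    also have "\<dots> = (\<Sum>c\<in>?I \<rightarrow>\<^sub>E {0, 1, 2}.
      pochhammer (1/2) (card (?F c 0)) * pochhammer (1/2) (card (?F c 1)) *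
        pochhammer (1/2) (card (?F c 2)) / pochhammer (3/2) (card ?I) *
      (\<Sum>s\<in>UNIV. (if s then p else 1 - p) *
        (\<Sum>(r0, r1, r2)\<in>?S c. h (splice_orders ?I c ?e s (r0, r1, r2)) *
          (P.order_law (insert ?e (?F c 0)) r0 * P.order_law (?F c 1) r1 * P.order_law (?F c 2) r2))))"
    proof (intro sum.cong refl)
      fix c assume c: "c \<in> ?I \<rightarrow>\<^sub>E {0, 1, 2::nat}"
      show "(\<Sum>s\<in>UNIV. \<Sum>r\<in>?S c. h (splice_orders ?I c ?e s r) * (\<integral>\<omega>. (\<Prod>i\<in>{0..<5}. X c s r i \<omega>) \<partial>M)) =
        pochhammer (1/2) (card (?F c 0)) * pochhammer (1/2) (card (?F c 1)) *
          pochhammer (1/2) (card (?F c 2)) / pochhammer (3/2) (card ?I) *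
        (\<Sum>s\<in>UNIV. (if s then p else 1 - p) *
          (\<Sum>(r0, r1, r2)\<in>?S c. h (splice_orders ?I c ?e s (r0, r1, r2)) *
            (P.order_law (insert ?e (?F c 0)) r0 * P.order_law (?F c 1) r1 * P.order_law (?F c 2) r2)))"
        unfolding EX[OF c] by (simp add: case_prod_unfold sum_distrib_left mult_ac)
    qed
    also have "\<dots> = (\<integral>z. h (sample_orders ?I z) \<partial>sample_law ?I P)"
      by (rule P.sum_splice_order_laws[OF I e])
    finally show "(\<integral>z. h (sample_orders ?I z) \<partial>sample_law ?I Q) = (\<integral>z. h (sample_orders ?I z) \<partial>sample_law ?I P)" .
  qed
  moreover have "distr M ?N
      (\<lambda>\<omega>. mixture3
        (\<Delta>0 \<omega>) (distr (\<mu>0 \<omega>) borel (theta0 (\<Delta>0 \<omega>) (Z \<omega>)))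
        (\<Delta>1 \<omega>) (distr (\<mu>1 \<omega>) borel (theta1 (\<Delta>0 \<omega>) (\<Delta>1 \<omega>) (\<Delta>2 \<omega>) (Z \<omega>) (of_bool (\<beta> \<omega>))))
        (\<Delta>2 \<omega>) (distr (\<mu>2 \<omega>) borel (theta2 (\<Delta>0 \<omega>) (\<Delta>1 \<omega>) (\<Delta>2 \<omega>) (Z \<omega>) (of_bool (\<beta> \<omega>))))) = Q"
    unfolding Q_def by (rule distr_cong[OF refl refl mix_eq])
  ultimately show ?thesis by simp
qed

end
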